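(* Let $V,V'$ be Hilbert spaces dual to each other, $U$ a Hilbert space, let $A,B,g_0,h_0,\omega,p,\lambda$ satisfy hypotheses 1–8 listed in the context, and assume $\lambda>2\omega$. Let $\Psi(x)=\inf_{u\in L^p_\lambda(0,+\infty;U)}J_\infty(0,x,u)$ be the value function. Let $x\in V'$, let $(u^*,y^* )$ be optimal at $(0,x)$ and let $\pi^*(\cdot;0,x)$ be the associated co-state. Then $$\Psi'(x)=\pi^*(0;0,x).$$ Consequently, $$\Psi'(y^*(\tau))=\pi^*(\tau;\tau,y^*(\tau))\qquad\text{for all }\tau\ge0.$$
   Context: **Spaces and notation.** $V$ and $V'$ are Hilbert spaces, dual to each other but not identified, with duality pairing $\langle\cdot,\cdot\rangle$; $V'$ is the state space. $U$ is a Hilbert space (the control space), identified with its dual, with scalar product $(\cdot|\cdot)_U$. For a Banach space $X$, $C^1_{Lip}(X)$ is the set of $f\in C^1(X)$ (Fréchet sense, real valued) whose derivative $f'$ is Lipschitz continuous; $\mathcal B_r(X)$ is the set of $f:X\to\mathbb R$ with $\sup_{x\in X}\frac{|f(x)|}{1+|x|_X^r}<+\infty$; and $\Sigma_0(X)=\{w\in\mathcal B_2(X): w \text{ is convex},\ w\in C^1_{Lip}(X)\}$. For $w\in\Sigma_0(V')$ the derivative $w'$ is a map $V'\to V$. For $h_0:U\to\mathbb R\cup\{+\infty\}$ the convex conjugate is $h_0^*(v)=\sup_{u\in U}\{(u|v)_U-h_0(u)\}$, and $\partial h_0(u)=\{v\in U: h_0(w)\ge h_0(u)+(v|w-u)_U\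 \forall w\in U\}$ is the subdifferential. **Hypotheses 1–8.** 1. $A:D(A)\subset V'\to V'$ generates a strongly continuous semigroup $\{e^{\tau A}\}_{\tau\ge0}$ on $V'$. 2. $B\in L(U,V')$ (bounded linear). 3. There is $\omega\ge0$ with $|e^{\tau A}x|_{V'}\le e^{\omega\tau}|x|_{V'}$ for all $\tau\ge0$, $x\in V'$. 4. $g_0\in\Sigma_0(V')$. 5. $h_0$ is convex, lower semicontinuous, and $\partial h_0$ is injective (i.e. $\partial h_0(u_1)\cap\partial h_0(u_2)=\emptyset$ for $u_1\ne u_2$). 6. $h_0^*(0)=0$ and $h_0^*\in\Sigma_0(U)$. 7. There are $a>0$, $b\in\mathbb R$, $p\ge2$ with $h_0(u)\ge a|u|_U^p+b$ for all $u\in U$. 8. Either (8.a) $p>2$ and $\lambda>2\omega$, or (8.b) $\lambda>\omega$ and $g_0\in\mathcal B_1(V')$. **Control problem.** $L^p_\lambda(t,+\infty;U)$ is the space of $u:[t,+\infty)\to U$ such that $\tau\mapsto u(\tau)e^{-\lambda\tau/p}$ is in $L^p(t,+\infty;U)$. For $t\ge0$, $x\in V'$ and $u\in L^p_\lambda(t,+\infty;U)$ the trajectory is $$y(\tau;t,x,u)=e^{(\tau-t)A}x+\int_t^\tau e^{(\tau-\sigma)A}Bu(\sigma)\,d\sigma,\quad \tau\ge t,$$ and the cost is $$J_\infty(t,x,u)=\int_t^{+\infty}e^{-\lambda\tau}\left[g_0(y(\tau;t,x,u))+h_0(u(\tau))\right]d\tau .$$ A couple $(u^*,y^* )$ is optimal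 at $(t,x)$ if $u^*$ minimizes $J_\infty(t,x,\cdot)$ over $L^p_\lambda(t,+\infty;U)$ and $y^*=y(\cdot;t,x,u^* )$. It is known (earlier work) that under hypotheses 1–8 one has $\Psi\in\Sigma_0(V')$, so that the Fréchet derivative $\Psi':V'\to V$ exists, and that there is a unique optimal couple at every $(t,x)$. **Co-state.** $\{e^{sA_0^*}\}_{s\ge0}$ denotes the strongly continuous semigroup on $V$ adjoint to $\{e^{sA}\}_{s\ge0}$, i.e. $\langle e^{sA_0^*}v,x\rangle=\langle v,e^{sA}x\rangle$, and $e^{(A_0^*-\lambda)s}=e^{-\lambda s}e^{sA_0^*}$. If $(u,y)$ is the optimal couple at $(t,x)$, the associated co-state $\pi^*(\cdot;t,x):[t,+\infty)\to V$ is the mild solution of $\pi'(\tau)=(\lambda-A_0^* )\pi(\tau)-g_0'(y(\tau))$, $\lim_{T\to+\infty}\pi(T)=0$, that is, by definition, $$\pi^*(\tau;t,x)=\int_\tau^{+\infty}e^{(A_0^*-\lambda)(\sigma-\tau)}g_0'(y(\sigma))\,d\sigma,\quad \tau\ge t.$$ *)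

theory Defs
  imports "HOL-Analysis.Analysis"
begin

section \<open>Bochner integral in arbitrary Banach spaces\<close>

text \<open>
  The library's Bochner integral is restricted to second countable target types, which would
  force the Hilbert spaces below to be separable. Here strong measurability (a.e. limit of simple
  functions) takes the place of separability plus Borel measurability; the rest follows
  \<^const>\<open>has_bochner_integral\<close> and \<^const>\<open>lebesgue_integral\<close>.
\<close>

definition strongly_measurable :: "'a measure \<Rightarrow> ('a \<Rightarrow> 'b::real_normed_vector) \<Rightarrow> bool" where
  "strongly_measurable M f \<longleftrightarrow>
     (\<exists>s. (\<forall>i::nat. simple_function M (s i)) \<and> (AE x in M. (\<lambda>i. s i x) \<longlonglongrightarrow> f x))"

definition has_vector_bochner_integral ::
    "'a measure \<Rightarrow> ('a \<Rightarrow> 'b::real_normed_vector) \<Rightarrow> 'b \<Rightarrow> bool" where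
  "has_vector_bochner_integral M f I \<longleftrightarrow>
     strongly_measurable M f \<and>
     (\<exists>s. (\<forall>i::nat. Bochner_Integration.simple_bochner_integrable M (s i)) \<and>
          (\<lambda>i. \<integral>\<^sup>+x. ennreal (norm (f x - s i x)) \<partial>M) \<longlonglongrightarrow> 0 \<and>
          (\<lambda>i. Bochner_Integration.simple_bochner_integral M (s i)) \<longlonglongrightarrow> I)"

definition vector_bochner_integral ::
    "'a measure \<Rightarrow> ('a \<Rightarrow> 'b::real_normed_vector) \<Rightarrow> 'b" where
  "vector_bochner_integral M f =
     (if \<exists>I. has_vector_bochner_integral M f I
      then THE I. has_vector_bochner_integral M f I else 0)"

text \<open>
  Integral of an extended-real function, positive part minus negative part
  (\<^const>\<open>e2ennreal\<close> truncates at \<open>0\<close>). Meaningful when one of the two parts is finite.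
\<close>

definition ereal_integral :: "'a measure \<Rightarrow> ('a \<Rightarrow> ereal) \<Rightarrow> ereal" where
  "ereal_integral M f =
     enn2ereal (\<integral>\<^sup>+x. e2ennreal (f x) \<partial>M) - enn2ereal (\<integral>\<^sup>+x. e2ennreal (- f x) \<partial>M)"

section \<open>Duality and semigroups\<close>

text \<open>
  \<open>pair\<close> identifies each of the two spaces isometrically with the topological dual of the other.
\<close>

definition dual_pairing ::
    "('v::real_normed_vector \<Rightarrow> 'w::real_normed_vector \<Rightarrow> real) \<Rightarrow> bool" where
  "dual_pairing pair \<longleftrightarrow>
     bounded_bilinear pair \<and>
     (\<forall>v. onorm (pair v) = norm v) \<and>
     (\<forall>x. onorm (\<lambda>v. pair v x) = norm x) \<and>
     (\<forall>\<phi>. bounded_linear \<phi> \<longrightarrow> (\<exists>v. \<phi> = pair v)) \<and>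
     (\<forall>\<phi>. bounded_linear \<phi> \<longrightarrow> (\<exists>x. \<phi> = (\<lambda>v. pair v x)))"

definition C0_semigroup :: "(real \<Rightarrow> 'a::real_normed_vector \<Rightarrow>\<^sub>L 'a) \<Rightarrow> bool" where
  "C0_semigroup S \<longleftrightarrow>
     S 0 = id_blinfun \<and>
     (\<forall>s\<ge>0. \<forall>t\<ge>0. S (s + t) = S s o\<^sub>L S t) \<and>
     (\<forall>x. continuous_on {0..} (\<lambda>t. blinfun_apply (S t) x))"

text \<open>The operator \<open>A\<close> with domain \<open>D\<close> generates \<open>S\<close>; values of \<open>A\<close> outside \<open>D\<close> are irrelevant.\<close>

definition generates_semigroup ::
    "'a::real_normed_vector set \<Rightarrow> ('a \<Rightarrow> 'a) \<Rightarrow> (real \<Rightarrow> 'a \<Rightarrow>\<^sub>L 'a) \<Rightarrow> bool" where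
  "generates_semigroup D A S \<longleftrightarrow>
     C0_semigroup S \<and>
     D = {x. \<exists>l. ((\<lambda>h. (blinfun_apply (S h) x - x) /\<^sub>R h) \<longlongrightarrow> l) (at_right 0)} \<and>
     (\<forall>x\<in>D. ((\<lambda>h. (blinfun_apply (S h) x - x) /\<^sub>R h) \<longlongrightarrow> A x) (at_right 0))"

definition adjoint_semigroup ::
    "('v::real_normed_vector \<Rightarrow> 'w::real_normed_vector \<Rightarrow> real)
      \<Rightarrow> (real \<Rightarrow> 'w \<Rightarrow>\<^sub>L 'w) \<Rightarrow> (real \<Rightarrow> 'v \<Rightarrow>\<^sub>L 'v) \<Rightarrow> bool" where
  "adjoint_semigroup pair S S0 \<longleftrightarrow>
     C0_semigroup S0 \<and>
     (\<forall>s\<ge>0. \<forall>v x. pair (blinfun_apply (S0 s) v) x = pair v (blinfun_apply (S s) x))"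

section \<open>Function classes\<close>

definition C1_Lip :: "('a::real_normed_vector \<Rightarrow> real) set" where
  "C1_Lip = {f. \<exists>f' :: 'a \<Rightarrow> 'a \<Rightarrow>\<^sub>L real.
     (\<forall>x. (f has_derivative blinfun_apply (f' x)) (at x)) \<and>
     continuous_on UNIV f' \<and> (\<exists>L. L-lipschitz_on UNIV f')}"

definition growth_class :: "nat \<Rightarrow> ('a::real_normed_vector \<Rightarrow> real) set" where
  "growth_class r = {f. bdd_above (range (\<lambda>x. \<bar>f x\<bar> / (1 + norm x ^ r)))}"

definition Sigma0 :: "('a::real_normed_vector \<Rightarrow> real) set" where
  "Sigma0 = {w \<in> growth_class 2. convex_on UNIV w \<and> w \<in> C1_Lip}"

text \<open>The derivative of a function on \<open>V'\<close>, as an element of \<open>V\<close>.\<close>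

definition dual_deriv ::
    "('v::real_normed_vector \<Rightarrow> 'w::real_normed_vector \<Rightarrow> real) \<Rightarrow> ('w \<Rightarrow> real) \<Rightarrow> 'w \<Rightarrow> 'v" where
  "dual_deriv pair f x = (THE v. (f has_derivative pair v) (at x))"

section \<open>Extended-real convex functions\<close>

definition ereal_convex :: "('a::real_vector \<Rightarrow> ereal) \<Rightarrow> bool" where
  "ereal_convex h \<longleftrightarrow>
     (\<forall>x y. \<forall>a\<ge>0. \<forall>b\<ge>0. a + b = 1 \<longrightarrow>
        h (a *\<^sub>R x + b *\<^sub>R y) \<le> ereal a * h x + ereal b * h y)"

definition lower_semicontinuous :: "('a::topological_space \<Rightarrow> ereal) \<Rightarrow> bool" where
  "lower_semicontinuous h \<longleftrightarrow> (\<forall>x. h x \<le> Liminf (at x) h)"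

definition subdifferential :: "('a::real_inner \<Rightarrow> ereal) \<Rightarrow> 'a \<Rightarrow> 'a set" where
  "subdifferential h u = {v. \<forall>w. h w \<ge> h u + ereal (v \<bullet> (w - u))}"

definition convex_conjugate :: "('a::real_inner \<Rightarrow> ereal) \<Rightarrow> 'a \<Rightarrow> ereal" where
  "convex_conjugate h v = (SUP u. ereal (v \<bullet> u) - h u)"

section \<open>The control problem\<close>

definition Lp_weighted :: "real \<Rightarrow> real \<Rightarrow> real \<Rightarrow> (real \<Rightarrow> 'u::real_normed_vector) set" where
  "Lp_weighted p lam t = {u. strongly_measurable (lebesgue_on {t..}) u \<and>
     integrable (lebesgue_on {t..}) (\<lambda>\<tau>. norm (exp (- lam * \<tau> / p) *\<^sub>R u \<tau>) powr p)}"

definition trajectory ::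
    "(real \<Rightarrow> 'w::real_normed_vector \<Rightarrow>\<^sub>L 'w) \<Rightarrow> ('u::real_normed_vector \<Rightarrow>\<^sub>L 'w)
      \<Rightarrow> real \<Rightarrow> 'w \<Rightarrow> (real \<Rightarrow> 'u) \<Rightarrow> real \<Rightarrow> 'w" where
  "trajectory S B t x u \<tau> =
     blinfun_apply (S (\<tau> - t)) x +
     vector_bochner_integral (lebesgue_on {t..\<tau>})
       (\<lambda>\<sigma>. blinfun_apply (S (\<tau> - \<sigma>)) (blinfun_apply B (u \<sigma>)))"

definition cost ::
    "(real \<Rightarrow> 'w::real_normed_vector \<Rightarrow>\<^sub>L 'w) \<Rightarrow> ('u::real_normed_vector \<Rightarrow>\<^sub>L 'w)
      \<Rightarrow> ('w \<Rightarrow> real) \<Rightarrow> ('u \<Rightarrow> ereal) \<Rightarrow> real \<Rightarrow> real \<Rightarrow> 'w \<Rightarrow> (real \<Rightarrow> 'u) \<Rightarrow> ereal" where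
  "cost S B g0 h0 lam t x u =
     ereal_integral (lebesgue_on {t..})
       (\<lambda>\<tau>. ereal (exp (- lam * \<tau>)) * (ereal (g0 (trajectory S B t x u \<tau>)) + h0 (u \<tau>)))"

definition optimal_couple ::
    "(real \<Rightarrow> 'w::real_normed_vector \<Rightarrow>\<^sub>L 'w) \<Rightarrow> ('u::real_normed_vector \<Rightarrow>\<^sub>L 'w)
      \<Rightarrow> ('w \<Rightarrow> real) \<Rightarrow> ('u \<Rightarrow> ereal) \<Rightarrow> real \<Rightarrow> real
      \<Rightarrow> real \<Rightarrow> 'w \<Rightarrow> (real \<Rightarrow> 'u) \<Rightarrow> (real \<Rightarrow> 'w) \<Rightarrow> bool" where
  "optimal_couple S B g0 h0 p lam t x u y \<longleftrightarrow>
     u \<in> Lp_weighted p lam t \<and>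
     (\<forall>v \<in> Lp_weighted p lam t. cost S B g0 h0 lam t x u \<le> cost S B g0 h0 lam t x v) \<and>
     (\<forall>\<tau>\<ge>t. y \<tau> = trajectory S B t x u \<tau>)"

text \<open>
  The infimum is finite under the standing hypotheses, so \<^const>\<open>real_of_ereal\<close> loses nothing.
\<close>

definition value_function ::
    "(real \<Rightarrow> 'w::real_normed_vector \<Rightarrow>\<^sub>L 'w) \<Rightarrow> ('u::real_normed_vector \<Rightarrow>\<^sub>L 'w)
      \<Rightarrow> ('w \<Rightarrow> real) \<Rightarrow> ('u \<Rightarrow> ereal) \<Rightarrow> real \<Rightarrow> real \<Rightarrow> 'w \<Rightarrow> real" where
  "value_function S B g0 h0 p lam x =
     real_of_ereal (INF u \<in> Lp_weighted p lam 0. cost S B g0 h0 lam 0 x u)"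

text \<open>The co-state at time \<open>\<tau>\<close> associated with a couple whose state component is \<open>y\<close>.\<close>

definition costate ::
    "('v::real_normed_vector \<Rightarrow> 'w::real_normed_vector \<Rightarrow> real) \<Rightarrow> (real \<Rightarrow> 'v \<Rightarrow>\<^sub>L 'v)
      \<Rightarrow> ('w \<Rightarrow> real) \<Rightarrow> real \<Rightarrow> (real \<Rightarrow> 'w) \<Rightarrow> real \<Rightarrow> 'v" where
  "costate pair S0 g0 lam y \<tau> =
     vector_bochner_integral (lebesgue_on {\<tau>..})
       (\<lambda>\<sigma>. exp (- lam * (\<sigma> - \<tau>)) *\<^sub>R
             blinfun_apply (S0 (\<sigma> - \<tau>)) (dual_deriv pair g0 (y \<sigma>)))"

end

theory Submission
  imports Defs
begin

text \<open>
  Let \<open>u\<close> be optimal at \<open>(0, x)\<close>, and let \<open>F z\<close> be the cost of the same control \<open>u\<close> when the initial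
  state is \<open>z\<close>. Then \<open>\<Psi> \<le> F\<close>, with equality at \<open>x\<close>. Conversely, the trajectory is affine in the
  pair (initial state, control) and the running costs are convex. So for any control \<open>v\<close>
  used from \<open>z\<close>, the midpoint of \<open>v\<close> and \<open>u\<close> is a competitor at \<open>x\<close>, the midpoint of \<open>z\<close> and \<open>2x - z\<close>,
  and \<open>2 F x \<le> J(0, z, v) + F(2x - z)\<close>. Hence \<open>2 F x - F(2x - z) \<le> \<Psi> z \<le> F z\<close>: if \<open>F\<close> has a derivative
  at \<open>x\<close> with quadratic remainder, then \<open>\<Psi>\<close> has the same one. Neither finiteness nor regularity of
  \<open>\<Psi>\<close> has to be known beforehand (\<open>value_function_has_derivative\<close>).

  Two trajectories with the same control differ by \<open>S \<sigma> (z - x)\<close>, of norm at most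
  \<open>exp (\<omega> \<sigma>) |z - x|\<close>, and \<open>g0\<close> has a Lipschitz gradient. The remainder of the discounted running cost
  is therefore at most \<open>L exp (-(lam - 2 \<omega>) \<sigma>) |z - x|\<^sup>2\<close>, which is integrable because
  \<open>lam > 2 \<omega>\<close>. The linear term \<open>\<integral> exp (- lam \<sigma>) \<langle>g0'(y \<sigma>), S \<sigma> h\<rangle> d\<sigma>\<close> is the pairing of the co-state at
  time \<open>0\<close> with \<open>h\<close>, by the definition of the adjoint semigroup (\<open>costate_functional\<close>,
  \<open>state_cost_quadratic_remainder\<close>).

  That \<open>F\<close> is finite at all rests on the integrability of \<open>exp (- lam \<sigma>) |y \<sigma>|\<^sup>2\<close>. Since \<open>p \<ge> 2\<close>,
  the function \<open>exp (- lam \<sigma> / 2) |u \<sigma>|\<close> is in \<open>L\<^sup>2\<close>; the discounted trajectory is dominated by its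
  convolution with \<open>exp (-(lam / 2 - \<omega>) \<sigma>)\<close>, and Young's inequality applies
  (\<open>trajectory_square_integrable\<close>).

  The assertion at later times is Bellman's principle: the tail of an optimal control is optimal for
  the state reached (\<open>optimal_tail\<close>), and a translation in time reduces the problem started at
  \<open>\<tau>\<close> to the one started at \<open>0\<close>, multiplying all costs by \<open>exp (- lam \<tau>)\<close> (\<open>cost_translate\<close>).

  Identities between vector-valued integrals are reduced to real integrals: the integral of a
  strongly measurable function with integrable norm commutes with bounded functionals
  (\<open>vector_bochner_integral_functional\<close>), and these separate points.
\<close>

section \<open>Strong measurability\<close>

lemma strongly_measurable_simple: "simple_function M f \<Longrightarrow> strongly_measurable M f"
  unfolding strongly_measurable_def by (intro exI[of _ "\<lambda>_. f"]) auto

text \<open>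
  Together with pairing, this takes the place of closure under pointwise limits: each integrand below
  is a continuous function of finitely many maps that are strongly measurable for obvious reasons.
\<close>

lemma strongly_measurable_compose:
  assumes f: "strongly_measurable M f" and g: "continuous_on UNIV g"
  shows "strongly_measurable M (\<lambda>x. g (f x))"
proof -
  obtain s where s: "\<And>i::nat. simple_function M (s i)" "AE x in M. (\<lambda>i. s i x) \<longlonglongrightarrow> f x"
    using f by (auto simp: strongly_measurable_def)
  have "AE x in M. (\<lambda>i. g (s i x)) \<longlonglongrightarrow> g (f x)"
    using s(2)
  proof eventually_elim
    case (elim x)
    then show ?case
      using continuous_on_tendsto_compose[OF g, of "\<lambda>i. s i x" "f x" sequentially] by simp
  qed
  moreover have "\<forall>i. simple_function M (\<lambda>x. g (s i x))"
    using s(1) by (auto intro: simple_function_compose1)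
  ultimately show ?thesis
    unfolding strongly_measurable_def by (intro exI[of _ "\<lambda>i x. g (s i x)"]) auto
qed

lemma strongly_measurable_Pair:
  assumes f: "strongly_measurable M f" and g: "strongly_measurable M g"
  shows "strongly_measurable M (\<lambda>x. (f x, g x))"
proof -
  obtain s where s: "\<And>i::nat. simple_function M (s i)" "AE x in M. (\<lambda>i. s i x) \<longlonglongrightarrow> f x"
    using f by (auto simp: strongly_measurable_def)
  obtain r where r: "\<And>i::nat. simple_function M (r i)" "AE x in M. (\<lambda>i. r i x) \<longlonglongrightarrow> g x"
    using g by (auto simp: strongly_measurable_def)
  have "AE x in M. (\<lambda>i. (s i x, r i x)) \<longlonglongrightarrow> (f x, g x)"
    using s(2) r(2) by eventually_elim (rule tendsto_Pair)
  then show ?thesis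
    unfolding strongly_measurable_def using s(1) r(1)
    by (intro exI[of _ "\<lambda>i x. (s i x, r i x)"]) auto
qed

lemma strongly_measurable_compose2:
  assumes "strongly_measurable M f" "strongly_measurable M g"
    "continuous_on UNIV (\<lambda>p. h (fst p) (snd p))"
  shows "strongly_measurable M (\<lambda>x. h (f x) (g x))"
  using strongly_measurable_compose[OF strongly_measurable_Pair[OF assms(1,2)] assms(3)] by simp

lemma strongly_measurable_scaleR:
  assumes "strongly_measurable M f" "strongly_measurable M g"
  shows "strongly_measurable M (\<lambda>x. f x *\<^sub>R g x)"
  by (rule strongly_measurable_compose2[OF assms]) (intro continuous_intros)

lemma strongly_measurable_add:
  assumes "strongly_measurable M f" "strongly_measurable M g"
  shows "strongly_measurable M (\<lambda>x. f x + g x)"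
  by (rule strongly_measurable_compose2[OF assms]) (intro continuous_intros)

lemma strongly_measurable_borel_real:
  fixes f :: "'a \<Rightarrow> real"
  assumes "f \<in> borel_measurable M"
  shows "strongly_measurable M f"
  using borel_measurable_implies_sequence_metric[OF assms, of 0]
  unfolding strongly_measurable_def by auto

lemma strongly_measurable_AE_cong:
  assumes "strongly_measurable M f" "AE x in M. f x = g x"
  shows "strongly_measurable M g"
proof -
  obtain s where s: "\<And>i::nat. simple_function M (s i)" "AE x in M. (\<lambda>i. s i x) \<longlonglongrightarrow> f x"
    using assms(1) by (auto simp: strongly_measurable_def)
  have "AE x in M. (\<lambda>i. s i x) \<longlonglongrightarrow> g x"
    using s(2) assms(2) by eventually_elim simp
  then show ?thesis
    unfolding strongly_measurable_def using s(1) by auto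
qed

text \<open>
  Off a null set, \<open>f\<close> is a pointwise limit of measurable maps into a metric space; completeness of
  the measure absorbs the null set.
\<close>

lemma strongly_measurable_imp_borel_measurable:
  assumes "complete_measure M" "strongly_measurable M f"
  shows "f \<in> borel_measurable M"
proof -
  interpret complete_measure M by fact
  obtain s where s: "\<And>i::nat. simple_function M (s i)" "AE x in M. (\<lambda>i. s i x) \<longlonglongrightarrow> f x"
    using assms(2) by (auto simp: strongly_measurable_def)
  define N where "N = {x\<in>space M. \<not> (\<lambda>i. s i x) \<longlonglongrightarrow> f x}"
  have N: "N \<in> null_sets M"
    using s(2) unfolding N_def by (simp add: AE_iff_null_sets)
  define g where "g x = (if x \<in> N then 0 else f x)" for x
  have g: "g \<in> borel_measurable M"
  proof (rule borel_measurable_LIMSEQ_metric)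
    show "(\<lambda>x. if x \<in> N then 0 else s i x) \<in> borel_measurable M" for i
      using N s(1)[of i] by (intro measurable_If_set) (auto intro: borel_measurable_simple_function)
    show "(\<lambda>i. if x \<in> N then 0 else s i x) \<longlonglongrightarrow> g x" if "x \<in> space M" for x
      using that by (auto simp: g_def N_def)
  qed
  show ?thesis
  proof (rule measurableI)
    fix A :: "'b set" assume A: "A \<in> sets borel"
    show "f -` A \<inter> space M \<in> sets M"
    proof (rule in_sets_AE)
      show "g -` A \<inter> space M \<in> sets M"
        using g A by (rule measurable_sets)
      show "AE x in M. x \<in> g -` A \<inter> space M \<longleftrightarrow> x \<in> f -` A \<inter> space M"
        using AE_not_in[OF N] by eventually_elim (simp add: g_def)
    qed simp
  qed simp
qed

lemma complete_measure_lebesgue_on: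
  assumes "A \<in> sets lebesgue"
  shows "complete_measure (lebesgue_on A)"
proof
  fix B N assume "N \<subseteq> B" "B \<in> null_sets (lebesgue_on A)"
  then show "N \<in> sets (lebesgue_on A)"
    using assms null_sets_completion_subset[of N B lborel]
    by (auto simp: null_sets_restrict_space sets_restrict_space_iff)
qed

lemma strongly_measurable_lebesgue_on_iff:
  fixes f :: "real \<Rightarrow> 'b::real_normed_vector"
  assumes A: "A \<in> sets lebesgue"
  shows "strongly_measurable (lebesgue_on A) f \<longleftrightarrow>
     strongly_measurable lebesgue (\<lambda>x. indicator A x *\<^sub>R f x)"
proof
  assume "strongly_measurable (lebesgue_on A) f"
  then obtain s where s: "\<And>i::nat. simple_function (lebesgue_on A) (s i)"
      "AE x in lebesgue_on A. (\<lambda>i. s i x) \<longlonglongrightarrow> f x"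
    by (auto simp: strongly_measurable_def)
  have "AE x in lebesgue. (\<lambda>i. indicator A x *\<^sub>R s i x) \<longlonglongrightarrow> indicator A x *\<^sub>R f x"
    using s(2) A
    by (simp add: AE_restrict_space_iff) (auto elim!: eventually_mono simp: indicator_def)
  then show "strongly_measurable lebesgue (\<lambda>x. indicator A x *\<^sub>R f x)"
    unfolding strongly_measurable_def using s(1) A
    by (intro exI[of _ "\<lambda>i x. indicator A x *\<^sub>R s i x"]) (auto simp: simple_function_restrict_space)
next
  assume "strongly_measurable lebesgue (\<lambda>x. indicator A x *\<^sub>R f x)"
  then obtain s where s: "\<And>i::nat. simple_function lebesgue (s i)"
      "AE x in lebesgue. (\<lambda>i. s i x) \<longlonglongrightarrow> indicator A x *\<^sub>R f x"
    by (auto simp: strongly_measurable_def)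
  have "simple_function (lebesgue_on A) (s i)" for i
    using s(1)[of i] A by (simp add: simple_function_restrict_space simple_function_scaleR)
  moreover have "AE x in lebesgue_on A. (\<lambda>i. s i x) \<longlonglongrightarrow> f x"
    using s(2) A by (simp add: AE_restrict_space_iff) (auto elim!: eventually_mono)
  ultimately show "strongly_measurable (lebesgue_on A) f"
    unfolding strongly_measurable_def by auto
qed

lemma strongly_measurable_lebesgue_on_subset:
  fixes f :: "real \<Rightarrow> 'b::real_normed_vector"
  assumes "strongly_measurable (lebesgue_on A) f" "B \<subseteq> A" "A \<in> sets lebesgue" "B \<in> sets lebesgue"
  shows "strongly_measurable (lebesgue_on B) f"
proof -
  have "strongly_measurable lebesgue (\<lambda>x. indicator B x *\<^sub>R (indicator A x *\<^sub>R f x))"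
    by (rule strongly_measurable_scaleR[OF strongly_measurable_simple])
      (use assms in \<open>auto simp: strongly_measurable_lebesgue_on_iff\<close>)
  also have "(\<lambda>x. indicator B x *\<^sub>R (indicator A x *\<^sub>R f x)) = (\<lambda>x. indicator B x *\<^sub>R f x)"
    using assms(2) by (auto simp: indicator_def fun_eq_iff)
  finally show ?thesis
    using assms by (simp add: strongly_measurable_lebesgue_on_iff)
qed

lemma strongly_measurable_concat:
  fixes f g :: "real \<Rightarrow> 'b::real_normed_vector"
  assumes f: "strongly_measurable (lebesgue_on {a..}) f"
    and g: "strongly_measurable (lebesgue_on {c..}) g" and "a \<le> c"
  shows "strongly_measurable (lebesgue_on {a..}) (\<lambda>x. if x < c then f x else g x)"
proof -
  have 1: "strongly_measurable (lebesgue_on {a..<c}) f"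
    by (rule strongly_measurable_lebesgue_on_subset[OF f]) auto
  have "strongly_measurable lebesgue (\<lambda>x. indicator {a..<c} x *\<^sub>R f x + indicator {c..} x *\<^sub>R g x)"
    using 1 g by (intro strongly_measurable_add) (auto simp: strongly_measurable_lebesgue_on_iff)
  also have "(\<lambda>x. indicator {a..<c} x *\<^sub>R f x + indicator {c..} x *\<^sub>R g x)
    = (\<lambda>x. indicator {a..} x *\<^sub>R (if x < c then f x else g x))"
    using assms(3) by (auto simp: indicator_def)
  finally show ?thesis
    by (simp add: strongly_measurable_lebesgue_on_iff)
qed

lemma strongly_measurable_distr:
  assumes T: "T \<in> measurable M N" "distr M N T = N" and f: "strongly_measurable N f"
  shows "strongly_measurable M (\<lambda>x. f (T x))"
proof -
  obtain s where s: "\<And>i::nat. simple_function N (s i)" "AE x in N. (\<lambda>i. s i x) \<longlonglongrightarrow> f x"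
    using f by (auto simp: strongly_measurable_def)
  have "AE x in distr M N T. (\<lambda>i. s i x) \<longlonglongrightarrow> f x"
    by (subst T(2)) (rule s(2))
  then have "AE x in M. (\<lambda>i. s i (T x)) \<longlonglongrightarrow> f (T x)"
    by (rule AE_distrD[OF T(1)])
  then show ?thesis
    unfolding strongly_measurable_def using s(1) T(1)
    by (intro exI[of _ "\<lambda>i x. s i (T x)"]) (auto intro: simple_function_comp)
qed

text \<open>
  Approximate \<open>f s\<close> by the value of \<open>f\<close> at the next point of the grid of mesh \<open>1 / (n + 1)\<close>, freezing it
  after time \<open>n\<close>: this takes finitely many values, and the grid points tend to \<open>s\<close> from the right.
  Right continuity is the property that trajectories have directly from their flow property.
\<close>

lemma strongly_measurable_right_continuous:
  fixes f :: "real \<Rightarrow> 'b::real_normed_vector"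
  assumes f: "\<And>s. s \<ge> t \<Longrightarrow> (f \<longlongrightarrow> f s) (at_right s)"
  shows "strongly_measurable (lebesgue_on {t..}) f"
proof -
  define k where "k n s = (if s \<le> real n then \<lfloor>real (Suc n) * s\<rfloor> else \<lfloor>real (Suc n) * real n\<rfloor>)" for n s
  define q where "q n s = (real_of_int (k n s) + 1) / real (Suc n)" for n s
  have k: "simple_function (lebesgue_on {t..}) (k n)" for n
    unfolding simple_function_def
  proof (intro conjI ballI)
    have "k n ` {t..} \<subseteq> {\<lfloor>real (Suc n) * t\<rfloor>..\<lfloor>real (Suc n) * real n\<rfloor>} \<union> {\<lfloor>real (Suc n) * real n\<rfloor>}"
      unfolding k_def by (auto intro!: floor_mono mult_left_mono)
    then show "finite (k n ` space (lebesgue_on {t..}))"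
      by (auto dest: finite_subset)
    fix y assume "y \<in> k n ` space (lebesgue_on {t..})"
    have [measurable]: "k n \<in> borel \<rightarrow>\<^sub>M count_space UNIV"
      unfolding k_def by measurable
    have "k n -` {y} \<inter> space borel \<in> sets borel"
      by measurable
    then show "k n -` {y} \<inter> space (lebesgue_on {t..}) \<in> sets (lebesgue_on {t..})"
      by (auto simp: sets_restrict_space)
  qed
  have "(\<lambda>n. f (q n s)) \<longlonglongrightarrow> f s" if s: "s \<ge> t" for s
  proof -
    have "filterlim (\<lambda>n. q n s) (at_right s) sequentially"
      unfolding filterlim_at
    proof 
      have ev: "\<forall>\<^sub>F n in sequentially. s \<le> real n"
        using eventually_ge_at_top[of "nat \<lceil>s\<rceil>"] by eventually_elim linarith
      have b: "s < q n s \<and> q n s \<le> s + 1 / real (Suc n)" if "s \<le> real n" for n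
      proof -
        have "real (Suc n) * s < real_of_int (k n s) + 1" "real_of_int (k n s) + 1 \<le> real (Suc n) * s + 1"
          using that by (auto simp: k_def)
        moreover have "s + 1 / real (Suc n) = (real (Suc n) * s + 1) / real (Suc n)"
          by (simp add: add_divide_distrib)
        ultimately show ?thesis
          unfolding q_def by (simp add: pos_less_divide_eq divide_right_mono mult.commute del: of_nat_Suc)
      qed
      show "\<forall>\<^sub>F n in sequentially. q n s \<in> {s<..} \<and> q n s \<noteq> s"
        using ev by eventually_elim (use b in fastforce)
      show "(\<lambda>n. q n s) \<longlonglongrightarrow> s"
      proof (rule tendsto_sandwich)
        show "\<forall>\<^sub>F n in sequentially. s \<le> q n s" "\<forall>\<^sub>F n in sequentially. q n s \<le> s + 1 / real (Suc n)"
          using ev by (eventually_elim, use b in fastforce)+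
        show "(\<lambda>n. s + 1 / real (Suc n)) \<longlonglongrightarrow> s"
          using tendsto_add[OF tendsto_const LIMSEQ_Suc[OF lim_1_over_n], of s] by simp
      qed simp
    qed
    then show ?thesis
      by (rule filterlim_compose[OF f[OF s]])
  qed
  then have "AE s in lebesgue_on {t..}. (\<lambda>n. f (q n s)) \<longlonglongrightarrow> f s"
    by (intro AE_I2) auto
  then show ?thesis
    unfolding strongly_measurable_def q_def
    by (intro exI[of _ "\<lambda>n s. f ((real_of_int (k n s) + 1) / real (Suc n))"])
      (auto intro: simple_function_compose1[OF k])
qed

lemma lebesgue_on_translate:
  fixes A :: "real set"
  assumes A: "A \<in> sets lebesgue"
  shows "(\<lambda>s. s + r) \<in> measurable (lebesgue_on A) (lebesgue_on ((\<lambda>s. s + r) ` A))"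
    and "distr (lebesgue_on A) (lebesgue_on ((\<lambda>s. s + r) ` A)) (\<lambda>s. s + r)
           = lebesgue_on ((\<lambda>s. s + r) ` A)"
    and "(\<lambda>s. s + r) ` A \<in> sets lebesgue"
proof -
  have m: "(\<lambda>s. s + r') \<in> lebesgue \<rightarrow>\<^sub>M lebesgue" for r' :: real
    using lebesgue_affine_measurable[where c= "\<lambda>x::real. 1" and t = r'] by (simp add: add.commute)
  have d: "distr lebesgue lebesgue (\<lambda>s. s + r) = lebesgue"
    using lebesgue_real_affine[of 1 r] by (simp add: add.commute density_1)
  have im: "(\<lambda>s. s + r) ` B = (\<lambda>s. s + (- r)) -` B \<inter> space lebesgue" for B
    using image_iff by fastforce
  show im_sets: "(\<lambda>s. s + r) ` A \<in> sets lebesgue"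
    unfolding im using A m by (rule measurable_sets[rotated])
  show m': "(\<lambda>s. s + r) \<in> measurable (lebesgue_on A) (lebesgue_on ((\<lambda>s. s + r) ` A))"
    by (rule measurable_restrict_space3[OF m]) auto
  show "distr (lebesgue_on A) (lebesgue_on ((\<lambda>s. s + r) ` A)) (\<lambda>s. s + r)
           = lebesgue_on ((\<lambda>s. s + r) ` A)"
  proof (rule measure_eqI)
    fix B assume "B \<in> sets (distr (lebesgue_on A) (lebesgue_on ((\<lambda>s. s + r) ` A)) (\<lambda>s. s + r))"
    then have B: "B \<in> sets (lebesgue_on ((\<lambda>s. s + r) ` A))" by simp
    then have B': "B \<in> sets lebesgue" "B \<subseteq> (\<lambda>s. s + r) ` A"
      using im_sets by (auto simp: sets_restrict_space_iff)
    have "emeasure (distr (lebesgue_on A) (lebesgue_on ((\<lambda>s. s + r) ` A)) (\<lambda>s. s + r)) B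
      = emeasure (lebesgue_on A) ((\<lambda>s. s + r) -` B \<inter> A)"
      using emeasure_distr[OF m' B] by simp
    also have "(\<lambda>s. s + r) -` B \<inter> A = (\<lambda>s. s + r) -` B \<inter> space lebesgue"
      using B'(2) by auto
    also have "emeasure (lebesgue_on A) \<dots> = emeasure lebesgue \<dots>"
      using A B'(2) by (intro emeasure_restrict_space) auto
    also have "\<dots> = emeasure (distr lebesgue lebesgue (\<lambda>s. s + r)) B"
      using emeasure_distr[OF m B'(1), of r] by simp
    also have "\<dots> = emeasure (lebesgue_on ((\<lambda>s. s + r) ` A)) B"
      unfolding d using im_sets B'(2) by (intro emeasure_restrict_space[symmetric]) auto
    finally show "emeasure (distr (lebesgue_on A) (lebesgue_on ((\<lambda>s. s + r) ` A)) (\<lambda>s. s + r)) B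
      = emeasure (lebesgue_on ((\<lambda>s. s + r) ` A)) B" .
  qed simp
qed

section \<open>The Bochner integral in a Hilbert space\<close>

lemma simple_bochner_integral_dist_le:
  assumes M: "complete_measure M" and f: "strongly_measurable M f"
    and s: "Bochner_Integration.simple_bochner_integrable M s"
    and t: "Bochner_Integration.simple_bochner_integrable M t"
  shows "ennreal (norm (Bochner_Integration.simple_bochner_integral M s -
             Bochner_Integration.simple_bochner_integral M t)) \<le>
    (\<integral>\<^sup>+ x. norm (f x - s x) \<partial>M) + (\<integral>\<^sup>+ x. norm (f x - t x) \<partial>M)"
    (is "ennreal (norm (?s - ?t)) \<le> ?S + ?T")
proof -
  have meas: "(\<lambda>x. norm (f x - r x)) \<in> borel_measurable M"
    if "Bochner_Integration.simple_bochner_integrable M r" for r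
  proof (rule strongly_measurable_imp_borel_measurable[OF M])
    have "strongly_measurable M r"
      using that by (auto intro: strongly_measurable_simple elim: Bochner_Integration.simple_bochner_integrable.cases)
    with f show "strongly_measurable M (\<lambda>x. norm (f x - r x))"
      by (rule strongly_measurable_compose2) (intro continuous_intros)
  qed
  have "ennreal (norm (?s - ?t)) = norm (Bochner_Integration.simple_bochner_integral M (\<lambda>x. s x - t x))"
    using s t by (subst simple_bochner_integral_diff) auto
  also have "\<dots> \<le> Bochner_Integration.simple_bochner_integral M (\<lambda>x. norm (s x - t x))"
    using simple_bochner_integrable_compose2[of "(-)" M "s" "t"] s t
    by (auto intro!: simple_bochner_integral_norm_bound)
  also have "\<dots> = (\<integral>\<^sup>+x. norm (s x - t x) \<partial>M)"
    using simple_bochner_integrable_compose2[of "\<lambda>x y. norm (x - y)" M "s" "t"] s t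
    by (auto intro!: simple_bochner_integral_eq_nn_integral)
  also have "\<dots> \<le> (\<integral>\<^sup>+x. ennreal (norm (f x - s x)) + ennreal (norm (f x - t x)) \<partial>M)"
  proof (intro nn_integral_mono)
    fix x
    have "norm (s x - t x) \<le> norm (f x - s x) + norm (f x - t x)"
      by (metis dual_order.refl norm_diff_triangle_le norm_minus_commute)
    from ennreal_leI[OF this]
    show "ennreal (norm (s x - t x)) \<le> ennreal (norm (f x - s x)) + ennreal (norm (f x - t x))"
      by simp
  qed
  also have "\<dots> = ?S + ?T"
    using meas[OF s] meas[OF t] by (intro nn_integral_add) auto
  finally show ?thesis .
qed

text \<open>
  Setting the approximating simple functions to \<open>0\<close> wherever their norm exceeds \<open>2 |f|\<close> keeps them simple
  and convergent, and makes the error at most \<open>3 |f|\<close>. By dominated convergence they then converge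
  in mean, and their integrals form a Cauchy sequence.
\<close>

lemma has_vector_bochner_integral_exists:
  fixes f :: "'a \<Rightarrow> 'b::banach"
  assumes M: "complete_measure M" and f: "strongly_measurable M f"
    and int: "integrable M (\<lambda>x. norm (f x))"
  shows "\<exists>I. has_vector_bochner_integral M f I"
proof -
  obtain s where s: "\<And>i::nat. simple_function M (s i)" "AE x in M. (\<lambda>i. s i x) \<longlonglongrightarrow> f x"
    using f by (auto simp: strongly_measurable_def)
  have nf[measurable]: "(\<lambda>x. norm (f x)) \<in> borel_measurable M"
    using int by auto
  have fin: "(\<integral>\<^sup>+x. ennreal (norm (f x)) \<partial>M) < \<infinity>"
    using int by (simp add: integrable_iff_bounded)
  define E where "E i = {x\<in>space M. norm (s i x) \<le> 2 * norm (f x)}" for i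
  define r where "r i x = indicator (E i) x *\<^sub>R s i x" for i x
  have E: "E i \<in> sets M" for i
  proof -
    have [measurable]: "(\<lambda>x. norm (s i x)) \<in> borel_measurable M"
      using borel_measurable_simple_function[OF s(1)[of i]] by simp
    show ?thesis unfolding E_def by measurable
  qed
  have r: "simple_function M (r i)" for i
    unfolding r_def using E s(1) by (intro simple_function_scaleR) auto
  have r_le: "norm (r i x) \<le> 2 * norm (f x)" for i x
    by (auto simp: r_def E_def indicator_def)
  have r_lim: "AE x in M. (\<lambda>i. r i x) \<longlonglongrightarrow> f x"
    using s(2) AE_space
  proof eventually_elim
    case (elim x)
    show ?case
    proof (cases "f x = 0")
      case True
      then have "r i x = 0" for i
        using r_le[of i x] by simp
      then show ?thesis using True by simp
    next
      case False
      then have "norm (f x) < 2 * norm (f x)" by simp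
      then have "\<forall>\<^sub>F i in sequentially. norm (s i x) < 2 * norm (f x)"
        using order_tendstoD(2)[OF tendsto_norm[OF elim(1)]] by blast
      then have "\<forall>\<^sub>F i in sequentially. s i x = r i x"
        by eventually_elim (use elim in \<open>simp add: r_def E_def\<close>)
      with elim(1) show ?thesis
        by (rule Lim_transform_eventually)
    qed
  qed
  have sbi: "Bochner_Integration.simple_bochner_integrable M (r i)" for i
  proof (rule simple_bochner_integrableI_bounded[OF r])
    have "(\<integral>\<^sup>+x. ennreal (norm (r i x)) \<partial>M) \<le> (\<integral>\<^sup>+x. 2 * ennreal (norm (f x)) \<partial>M)"
      using ennreal_leI[OF r_le[of i]] by (intro nn_integral_mono) (simp add: ennreal_mult)
    also have "\<dots> = 2 * (\<integral>\<^sup>+x. ennreal (norm (f x)) \<partial>M)"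
      by (intro nn_integral_cmult) auto
    also have "\<dots> < \<infinity>"
      using fin by (simp add: ennreal_mult_less_top)
    finally show "(\<integral>\<^sup>+x. ennreal (norm (r i x)) \<partial>M) < \<infinity>" .
  qed
  have conv: "(\<lambda>i. \<integral>\<^sup>+x. ennreal (norm (f x - r i x)) \<partial>M) \<longlonglongrightarrow> (\<integral>\<^sup>+x. 0 \<partial>M)"
  proof (rule nn_integral_dominated_convergence[where w = "\<lambda>x. 3 * ennreal (norm (f x))"])
    show "(\<lambda>x. ennreal (norm (f x - r i x))) \<in> borel_measurable M" for i
    proof -
      have "strongly_measurable M (\<lambda>x. norm (f x - r i x))"
        by (rule strongly_measurable_compose2[OF f strongly_measurable_simple[OF r]]) (intro continuous_intros)
      from strongly_measurable_imp_borel_measurable[OF M this] show ?thesis by simp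
    qed
    show "AE x in M. ennreal (norm (f x - r i x)) \<le> 3 * ennreal (norm (f x))" for i
    proof (rule AE_I2)
      fix x
      have "norm (f x - r i x) \<le> 3 * norm (f x)"
        using norm_triangle_ineq4[of "f x" "r i x"] r_le[of i x] by simp
      from ennreal_leI[OF this] show "ennreal (norm (f x - r i x)) \<le> 3 * ennreal (norm (f x))"
        by (simp add: ennreal_mult)
    qed
    show "(\<integral>\<^sup>+x. 3 * ennreal (norm (f x)) \<partial>M) < \<infinity>"
      using fin by (simp add: nn_integral_cmult ennreal_mult_less_top)
    show "AE x in M. (\<lambda>i. ennreal (norm (f x - r i x))) \<longlonglongrightarrow> 0"
      using r_lim
    proof eventually_elim
      case (elim x)
      have "(\<lambda>i. norm (f x - r i x)) \<longlonglongrightarrow> norm (f x - f x)"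
        by (intro tendsto_intros elim)
      then show ?case
        using tendsto_ennrealI[of "\<lambda>i. norm (f x - r i x)" 0 sequentially] by simp
    qed
  qed simp_all
  then have conv0: "(\<lambda>i. \<integral>\<^sup>+x. ennreal (norm (f x - r i x)) \<partial>M) \<longlonglongrightarrow> 0"
    by simp
  have "Cauchy (\<lambda>i. Bochner_Integration.simple_bochner_integral M (r i))"
  proof (rule metric_CauchyI)
    fix e :: real assume e: "e > 0"
    then have "0 < ennreal (e / 2)" by simp
    from order_tendstoD(2)[OF conv0 this] obtain N where
      N: "\<And>i. i \<ge> N \<Longrightarrow> (\<integral>\<^sup>+x. ennreal (norm (f x - r i x)) \<partial>M) < ennreal (e / 2)"
      by (auto simp: eventually_sequentially)
    show "\<exists>N. \<forall>m\<ge>N. \<forall>n\<ge>N. dist (Bochner_Integration.simple_bochner_integral M (r m))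
         (Bochner_Integration.simple_bochner_integral M (r n)) < e"
    proof (intro exI[of _ N] allI impI)
      fix m n assume mn: "m \<ge> N" "n \<ge> N"
      have "ennreal (norm (Bochner_Integration.simple_bochner_integral M (r m) -
         Bochner_Integration.simple_bochner_integral M (r n))) \<le>
         (\<integral>\<^sup>+x. ennreal (norm (f x - r m x)) \<partial>M) + (\<integral>\<^sup>+x. ennreal (norm (f x - r n x)) \<partial>M)"
        by (rule simple_bochner_integral_dist_le[OF M f sbi sbi])
      also have "\<dots> < ennreal (e / 2) + ennreal (e / 2)"
        by (rule add_strict_mono[OF N[OF mn(1)] N[OF mn(2)]])
      also have "\<dots> = ennreal e"
        using e by (simp flip: ennreal_plus)
      finally show "dist (Bochner_Integration.simple_bochner_integral M (r m))
         (Bochner_Integration.simple_bochner_integral M (r n)) < e"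
        using e by (simp add: dist_norm ennreal_less_iff)
    qed
  qed
  then obtain I where "(\<lambda>i. Bochner_Integration.simple_bochner_integral M (r i)) \<longlonglongrightarrow> I"
    using Cauchy_convergent_iff convergent_def by blast
  with f sbi conv0 show ?thesis
    unfolding has_vector_bochner_integral_def by blast
qed

lemma has_vector_bochner_integral_functional:
  fixes f :: "'a \<Rightarrow> 'b::real_normed_vector" and \<phi> :: "'b \<Rightarrow> real"
  assumes M: "complete_measure M" and I: "has_vector_bochner_integral M f I"
    and \<phi>: "bounded_linear \<phi>"
  shows "has_bochner_integral M (\<lambda>x. \<phi> (f x)) (\<phi> I)"
proof -
  interpret bounded_linear \<phi> by fact
  obtain s where f: "strongly_measurable M f"
    and s: "\<And>i::nat. Bochner_Integration.simple_bochner_integrable M (s i)"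
    and f_s: "(\<lambda>i. \<integral>\<^sup>+x. ennreal (norm (f x - s i x)) \<partial>M) \<longlonglongrightarrow> 0"
    and lim: "(\<lambda>i. Bochner_Integration.simple_bochner_integral M (s i)) \<longlonglongrightarrow> I"
    using I unfolding has_vector_bochner_integral_def by blast
  have ss: "strongly_measurable M (s i)" for i
    using s[of i] by (auto intro: strongly_measurable_simple elim: Bochner_Integration.simple_bochner_integrable.cases)
  obtain K where K: "K > 0" "\<And>x. norm (\<phi> x) \<le> norm x * K"
    using pos_bounded by auto
  show ?thesis
  proof (rule has_bochner_integral.intros)
    show "(\<lambda>x. \<phi> (f x)) \<in> borel_measurable M"
      by (rule strongly_measurable_imp_borel_measurable[OF M strongly_measurable_compose[OF f]])
        (rule linear_continuous_on[OF \<phi>])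
    show "Bochner_Integration.simple_bochner_integrable M (\<lambda>x. \<phi> (s i x))" for i
      using s[of i] by (auto intro: simple_bochner_integrable_compose2 zero)
    show "(\<lambda>i. Bochner_Integration.simple_bochner_integral M (\<lambda>x. \<phi> (s i x))) \<longlonglongrightarrow> \<phi> I"
      using tendsto[OF lim] by (simp add: simple_bochner_integral_linear[OF linear_axioms s])
    show "(\<lambda>i. \<integral>\<^sup>+x. ennreal (norm (\<phi> (f x) - \<phi> (s i x))) \<partial>M) \<longlonglongrightarrow> 0"
    proof (rule tendsto_sandwich[where f = "\<lambda>_. 0"])
      show "\<forall>\<^sub>F i in sequentially. (\<integral>\<^sup>+x. ennreal (norm (\<phi> (f x) - \<phi> (s i x))) \<partial>M)
          \<le> ennreal K * (\<integral>\<^sup>+x. ennreal (norm (f x - s i x)) \<partial>M)"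
      proof (intro always_eventually allI)
        fix i
        have "strongly_measurable M (\<lambda>x. norm (f x - s i x))"
          by (rule strongly_measurable_compose2[OF f ss]) (intro continuous_intros)
        then have "(\<lambda>x. norm (f x - s i x)) \<in> borel_measurable M"
          by (rule strongly_measurable_imp_borel_measurable[OF M])
        moreover have "(\<integral>\<^sup>+x. ennreal (norm (\<phi> (f x) - \<phi> (s i x))) \<partial>M)
            \<le> (\<integral>\<^sup>+x. ennreal K * ennreal (norm (f x - s i x)) \<partial>M)"
          using K by (intro nn_integral_mono) (auto simp: ac_simps simp flip: diff ennreal_mult intro!: ennreal_leI)
        ultimately show "(\<integral>\<^sup>+x. ennreal (norm (\<phi> (f x) - \<phi> (s i x))) \<partial>M)
          \<le> ennreal K * (\<integral>\<^sup>+x. ennreal (norm (f x - s i x)) \<partial>M)"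
          by (simp add: nn_integral_cmult)
      qed
      show "(\<lambda>i. ennreal K * (\<integral>\<^sup>+x. ennreal (norm (f x - s i x)) \<partial>M)) \<longlonglongrightarrow> 0"
        using ennreal_tendsto_cmult[OF _ f_s, of "ennreal K"] by simp
    qed auto
  qed
qed

text \<open>
  The inner products with fixed vectors are bounded functionals; applied to two candidate values of the
  integral they show that the value is unique.
\<close>

lemma vector_bochner_integral_functional:
  fixes f :: "'a \<Rightarrow> 'b::{real_inner, banach}" and \<phi> :: "'b \<Rightarrow> real"
  assumes M: "complete_measure M" and f: "strongly_measurable M f"
    and int: "integrable M (\<lambda>x. norm (f x))" and \<phi>: "bounded_linear \<phi>"
  shows "integrable M (\<lambda>x. \<phi> (f x))"
    and "\<phi> (vector_bochner_integral M f) = (LINT x|M. \<phi> (f x))"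
proof -
  obtain I where I: "has_vector_bochner_integral M f I"
    using has_vector_bochner_integral_exists[OF M f int] by blast
  have unique: "J = I" if "has_vector_bochner_integral M f J" for J
  proof -
    have "c \<bullet> J = c \<bullet> I" for c
      using has_vector_bochner_integral_functional[OF M that bounded_linear_inner_right, of c]
        has_vector_bochner_integral_functional[OF M I bounded_linear_inner_right, of c]
      by (rule has_bochner_integral_eq)
    then show ?thesis
      by (metis vector_eq_ldot)
  qed
  have "vector_bochner_integral M f = I"
    using the_equality[of "has_vector_bochner_integral M f", OF I unique] I
    unfolding vector_bochner_integral_def by auto
  with has_vector_bochner_integral_functional[OF M I \<phi>]
  show "integrable M (\<lambda>x. \<phi> (f x))" "\<phi> (vector_bochner_integral M f) = (LINT x|M. \<phi> (f x))"
    by (auto simp: has_bochner_integral_iff)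
qed

text \<open>
  Pair the integral with itself and apply the Cauchy-Schwarz inequality under the integral sign.
\<close>

lemma norm_vector_bochner_integral_le:
  fixes f :: "'a \<Rightarrow> 'b::{real_inner, banach}"
  assumes M: "complete_measure M" and f: "strongly_measurable M f"
    and int: "integrable M (\<lambda>x. norm (f x))"
  shows "norm (vector_bochner_integral M f) \<le> (LINT x|M. norm (f x))"
proof -
  define I where "I = vector_bochner_integral M f"
  have "norm I * norm I = I \<bullet> I"
    by (metis power2_norm_eq_inner power2_eq_square)
  also have "\<dots> = (LINT x|M. I \<bullet> f x)"
    unfolding I_def by (rule vector_bochner_integral_functional(2)[OF M f int bounded_linear_inner_right])
  also have "\<dots> \<le> (LINT x|M. norm I * norm (f x))"
    using vector_bochner_integral_functional(1)[OF M f int bounded_linear_inner_right] int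
    by (intro integral_mono) (auto simp: norm_cauchy_schwarz)
  also have "\<dots> = norm I * (LINT x|M. norm (f x))"
    by simp
  finally have *: "norm I * norm I \<le> norm I * (LINT x|M. norm (f x))" .
  show ?thesis
  proof (cases "norm I = 0")
    case True
    then show ?thesis
      unfolding I_def[symmetric] by (simp add: Bochner_Integration.integral_nonneg)
  next
    case False
    then show ?thesis
      using * unfolding I_def[symmetric] by simp
  qed
qed

section \<open>Integrals over half-lines\<close>

lemma borel_measurable_lebesgue_onI:
  "f \<in> borel_measurable borel \<Longrightarrow> f \<in> borel_measurable (lebesgue_on A)"
  by (intro measurable_restrict_space1 measurable_completion) simp

lemma lebesgue_on_integrable_subset:
  fixes f :: "real \<Rightarrow> real"
  assumes "integrable (lebesgue_on A) f" "B \<subseteq> A" "A \<in> sets lebesgue" "B \<in> sets lebesgue"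
  shows "integrable (lebesgue_on B) f"
proof -
  have "set_integrable lebesgue A f"
    using assms(1,3) by (simp add: integrable_restrict_space set_integrable_def)
  then have "set_integrable lebesgue B f"
    by (rule set_integrable_subset) (use assms in auto)
  then show ?thesis
    using assms(4) by (simp add: integrable_restrict_space set_integrable_def)
qed

lemma lebesgue_on_integral_Un:
  fixes f :: "real \<Rightarrow> real"
  assumes f: "integrable (lebesgue_on (A \<union> C)) f" and A: "A \<in> sets lebesgue" and C: "C \<in> sets lebesgue"
    and AC: "A \<inter> C \<subseteq> {c}"
  shows "(LINT x|lebesgue_on (A \<union> C). f x) = (LINT x|lebesgue_on A. f x) + (LINT x|lebesgue_on C. f x)"
proof -
  have "AE x in lebesgue. x \<noteq> c"
    using AE_not_in[of "{c}" "lebesgue :: real measure"] by simp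
  then have ae: "AE x in lebesgue. \<not> (x \<in> A \<and> x \<in> C)"
    by eventually_elim (use AC in auto)
  have "integrable (lebesgue_on A) f" "integrable (lebesgue_on C) f"
    using lebesgue_on_integrable_subset[OF f] A C by auto
  then have "set_integrable lebesgue A f" "set_integrable lebesgue C f"
    using A C by (simp_all add: integrable_restrict_space set_integrable_def)
  from set_integral_Un_AE[OF ae A C this] show ?thesis
    using A C by (simp add: integral_restrict_space set_lebesgue_integral_def)
qed

lemma integrable_exp_halfline:
  fixes c t :: real
  assumes "c > 0"
  shows "integrable (lebesgue_on {t..}) (\<lambda>s. exp (- c * s))"
    and "(\<integral>\<^sup>+s\<in>{t..}. ennreal (exp (- c * s)) \<partial>lebesgue) = ennreal (exp (- c * t) / c)"
proof -
  note h = has_integral_exp_minus_to_infinity[OF assms, of t]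
  have "(\<lambda>s. exp (- c * s)) absolutely_integrable_on {t..}"
    using h by (intro nonnegative_absolutely_integrable_1) (auto simp: integrable_on_def)
  then show "integrable (lebesgue_on {t..}) (\<lambda>s. exp (- c * s))"
    by (simp add: integrable_restrict_space set_integrable_def)
  show "(\<integral>\<^sup>+s\<in>{t..}. ennreal (exp (- c * s)) \<partial>lebesgue) = ennreal (exp (- c * t) / c)"
    using nn_integral_has_integral_lebesgue'[OF _ h] by (simp add: nn_integral_completion)
qed

text \<open>
  Makes Tonelli's theorem available on half-lines.
\<close>

lemma sigma_finite_measure_halfline: "sigma_finite_measure (lebesgue_on {t::real..})"
proof
  show "\<exists>A. countable A \<and> A \<subseteq> sets (lebesgue_on {t..}) \<and> \<Union> A = space (lebesgue_on {t..}) \<and>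
      (\<forall>a\<in>A. emeasure (lebesgue_on {t..}) a \<noteq> \<infinity>)"
  proof (intro exI[of _ "range (\<lambda>n. {t..t + real n})"] conjI ballI)
    show "\<Union> (range (\<lambda>n. {t..t + real n})) = space (lebesgue_on {t..})"
    proof safe
      fix s assume "s \<in> space (lebesgue_on {t..})"
      then have "s \<in> {t..t + real (nat \<lceil>s - t\<rceil>)}"
        by simp linarith
      then show "s \<in> \<Union> (range (\<lambda>n. {t..t + real n}))" by blast
    qed auto
    show "range (\<lambda>n. {t..t + real n}) \<subseteq> sets (lebesgue_on {t..})"
      by (auto simp: sets_restrict_space_iff)
    fix a assume "a \<in> range (\<lambda>n. {t..t + real n})"
    then show "emeasure (lebesgue_on {t..}) a \<noteq> \<infinity>"
      by (auto simp: emeasure_restrict_space)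
  qed simp
qed

lemma vector_bochner_integral_translate:
  fixes f :: "real \<Rightarrow> 'b::{real_inner, banach}"
  assumes A: "A \<in> sets lebesgue" "(\<lambda>s. s + r) ` A = A'"
    and f: "strongly_measurable (lebesgue_on A') f"
    and int: "integrable (lebesgue_on A') (\<lambda>s. norm (f s))"
  shows "vector_bochner_integral (lebesgue_on A) (\<lambda>s. f (s + r)) = vector_bochner_integral (lebesgue_on A') f"
proof -
  note T = lebesgue_on_translate[OF A(1), of r, unfolded A(2)]
  have sm: "strongly_measurable (lebesgue_on A) (\<lambda>s. f (s + r))"
    by (rule strongly_measurable_distr[OF T(1,2) f])
  have "integrable (distr (lebesgue_on A) (lebesgue_on A') (\<lambda>s. s + r)) (\<lambda>s. norm (f s))"
    by (subst T(2)) (rule int)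
  then have int': "integrable (lebesgue_on A) (\<lambda>s. norm (f (s + r)))"
    by (rule integrable_distr[OF T(1)])
  have "c \<bullet> vector_bochner_integral (lebesgue_on A) (\<lambda>s. f (s + r)) = c \<bullet> vector_bochner_integral (lebesgue_on A') f" for c
  proof -
    note F = vector_bochner_integral_functional[OF complete_measure_lebesgue_on[OF T(3)] f int bounded_linear_inner_right, of c]
    have "c \<bullet> vector_bochner_integral (lebesgue_on A') f = (LINT s|distr (lebesgue_on A) (lebesgue_on A') (\<lambda>s. s + r). c \<bullet> f s)"
      unfolding T(2) by (rule F(2))
    also have "\<dots> = (LINT s|lebesgue_on A. c \<bullet> f (s + r))"
      using F(1) by (intro integral_distr[OF T(1)]) auto
    also have "\<dots> = c \<bullet> vector_bochner_integral (lebesgue_on A) (\<lambda>s. f (s + r))"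
      by (rule vector_bochner_integral_functional(2)[OF complete_measure_lebesgue_on[OF A(1)] sm int' bounded_linear_inner_right, symmetric])
    finally show ?thesis ..
  qed
  then show ?thesis
    using vector_eq_ldot by blast
qed

section \<open>Trajectories\<close>

text \<open>
  Strong continuity and the local bound on the norms give joint continuity. The argument \<open>max 0\<close>
  extends the semigroup to negative times, so that the map is continuous everywhere and can be
  composed with strongly measurable maps.
\<close>

lemma semigroup_jointly_continuous:
  fixes S :: "real \<Rightarrow> 'w::real_normed_vector \<Rightarrow>\<^sub>L 'w"
  assumes S: "C0_semigroup S"
    and bound: "\<And>\<tau> z. \<tau> \<ge> 0 \<Longrightarrow> norm (blinfun_apply (S \<tau>) z) \<le> exp (\<omega> * \<tau>) * norm z"
  shows "continuous_on UNIV (\<lambda>p. blinfun_apply (S (max 0 (fst p))) (snd p))"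
  unfolding continuous_on_def
proof
  fix p :: "real \<times> 'w"
  let ?q = "\<lambda>p :: real \<times> 'w. max 0 (fst p)"
  have q: "(?q \<longlongrightarrow> ?q p) (at p within UNIV)"
    by (intro tendsto_intros)
  have c: "continuous_on {0..} (\<lambda>t. blinfun_apply (S t) (snd p))"
    using S by (simp add: C0_semigroup_def)
  have "((\<lambda>p'. blinfun_apply (S (?q p')) (snd p)) \<longlongrightarrow> blinfun_apply (S (?q p)) (snd p)) (at p within UNIV)"
    by (rule continuous_on_tendsto_compose[OF c q]) auto
  moreover have "((\<lambda>p'. blinfun_apply (S (?q p')) (snd p' - snd p)) \<longlongrightarrow> 0) (at p within UNIV)"
  proof (rule Lim_null_comparison)
    show "\<forall>\<^sub>F p' in at p within UNIV. norm (blinfun_apply (S (?q p')) (snd p' - snd p))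
        \<le> exp (\<omega> * ?q p') * norm (snd p' - snd p)"
      by (intro always_eventually allI bound) simp
    have "((\<lambda>p'. exp (\<omega> * ?q p') * norm (snd p' - snd p)) \<longlongrightarrow> exp (\<omega> * ?q p) * norm (snd p - snd p)) (at p within UNIV)"
      by (intro tendsto_intros q)
    then show "((\<lambda>p'. exp (\<omega> * ?q p') * norm (snd p' - snd p)) \<longlongrightarrow> 0) (at p within UNIV)"
      by simp
  qed
  ultimately have "((\<lambda>p'. blinfun_apply (S (?q p')) (snd p' - snd p) + blinfun_apply (S (?q p')) (snd p))
      \<longlongrightarrow> 0 + blinfun_apply (S (?q p)) (snd p)) (at p within UNIV)"
    by (intro tendsto_add)
  then show "((\<lambda>p'. blinfun_apply (S (?q p')) (snd p')) \<longlongrightarrow> blinfun_apply (S (?q p)) (snd p)) (at p within UNIV)"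
    by (simp add: blinfun.diff_right)
qed

locale controlled_system =
  fixes S :: "real \<Rightarrow> 'w::{real_inner, banach} \<Rightarrow>\<^sub>L 'w"
    and B :: "'u::{real_inner, banach} \<Rightarrow>\<^sub>L 'w"
    and \<omega> lam :: real
  assumes semigroup: "C0_semigroup S"
    and omega_nonneg: "\<omega> \<ge> 0"
    and growth: "\<tau> \<ge> 0 \<Longrightarrow> norm (blinfun_apply (S \<tau>) z) \<le> exp (\<omega> * \<tau>) * norm z"
    and lam_gt: "lam > 2 * \<omega>"
begin

text \<open>
  The weighted space \<open>L\<^sup>2\<close> contains the weighted \<open>L\<^sup>p\<close> for \<open>p \<ge> 2\<close>, and all estimates on trajectories are
  \<open>L\<^sup>2\<close> estimates in which the exponent \<open>p\<close> does not occur.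
\<close>

definition admissible :: "real \<Rightarrow> (real \<Rightarrow> 'u) \<Rightarrow> bool" where
  "admissible t u \<longleftrightarrow> strongly_measurable (lebesgue_on {t..}) u \<and>
     integrable (lebesgue_on {t..}) (\<lambda>\<sigma>. exp (- lam * \<sigma>) * (norm (u \<sigma>))\<^sup>2)"

abbreviation traj :: "real \<Rightarrow> 'w \<Rightarrow> (real \<Rightarrow> 'u) \<Rightarrow> real \<Rightarrow> 'w" where
  "traj \<equiv> trajectory S B"

lemma lam_pos: "lam > 0"
  using lam_gt omega_nonneg by linarith

lemma semigroup_add: "s \<ge> 0 \<Longrightarrow> t \<ge> 0 \<Longrightarrow> blinfun_apply (S (s + t)) z = blinfun_apply (S s) (blinfun_apply (S t) z)"
  using semigroup by (simp add: C0_semigroup_def)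

lemma semigroup_zero: "blinfun_apply (S 0) z = z"
  using semigroup by (simp add: C0_semigroup_def)

lemma admissible_mono: "admissible t u \<Longrightarrow> t \<le> c \<Longrightarrow> admissible c u"
  unfolding admissible_def
  by (auto intro: strongly_measurable_lebesgue_on_subset[of "{t..}"] lebesgue_on_integrable_subset[of "{t..}"])

lemma admissible_norm_integrable:
  assumes "admissible t u"
  shows "integrable (lebesgue_on {t..\<tau>}) (\<lambda>\<sigma>. norm (u \<sigma>))"
proof (rule Bochner_Integration.integrable_bound)
  have "integrable (lebesgue_on {t..\<tau>}) (\<lambda>\<sigma>. exp (- lam * \<sigma>) * (norm (u \<sigma>))\<^sup>2)"
    using assms by (auto simp: admissible_def intro: lebesgue_on_integrable_subset[of "{t..}"])
  moreover have "integrable (lebesgue_on {t..\<tau>}) (\<lambda>\<sigma>. 1::real)"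
    by (simp add: integrable_restrict_space)
  ultimately show "integrable (lebesgue_on {t..\<tau>}) (\<lambda>\<sigma>. 1 + exp (lam * \<tau>) * (exp (- lam * \<sigma>) * (norm (u \<sigma>))\<^sup>2))"
    by simp
  have "strongly_measurable (lebesgue_on {t..\<tau>}) u"
    using assms by (auto simp: admissible_def intro: strongly_measurable_lebesgue_on_subset[of "{t..}"])
  from strongly_measurable_imp_borel_measurable[OF complete_measure_lebesgue_on this]
  show "(\<lambda>\<sigma>. norm (u \<sigma>)) \<in> borel_measurable (lebesgue_on {t..\<tau>})"
    by simp
  show "AE \<sigma> in lebesgue_on {t..\<tau>}. norm (norm (u \<sigma>)) \<le>
      norm (1 + exp (lam * \<tau>) * (exp (- lam * \<sigma>) * (norm (u \<sigma>))\<^sup>2))"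
  proof (rule AE_I2)
    fix \<sigma> assume "\<sigma> \<in> space (lebesgue_on {t..\<tau>})"
    then have "1 \<le> exp (lam * \<tau>) * exp (- lam * \<sigma>)"
      using lam_pos by (simp flip: exp_add)
    then have "(norm (u \<sigma>))\<^sup>2 \<le> exp (lam * \<tau>) * exp (- lam * \<sigma>) * (norm (u \<sigma>))\<^sup>2"
      using mult_right_mono[of 1 _ "(norm (u \<sigma>))\<^sup>2"] by simp
    moreover have "norm (u \<sigma>) \<le> 1 + (norm (u \<sigma>))\<^sup>2"
      using zero_le_power2[of "norm (u \<sigma>) - 1"] by (simp add: power2_eq_square algebra_simps)
        (smt (verit) norm_ge_zero)
    ultimately show "norm (norm (u \<sigma>)) \<le>
      norm (1 + exp (lam * \<tau>) * (exp (- lam * \<sigma>) * (norm (u \<sigma>))\<^sup>2))"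
      by (simp add: mult.assoc)
  qed
qed

lemma trajectory_integrand:
  assumes u: "admissible t u"
  shows "strongly_measurable (lebesgue_on {t..\<tau>}) (\<lambda>\<sigma>. blinfun_apply (S (\<tau> - \<sigma>)) (blinfun_apply B (u \<sigma>)))"
    (is ?m)
    and "integrable (lebesgue_on {t..\<tau>}) (\<lambda>\<sigma>. norm (blinfun_apply (S (\<tau> - \<sigma>)) (blinfun_apply B (u \<sigma>))))"
    (is ?i)
    and "integrable (lebesgue_on {t..\<tau>}) (\<lambda>\<sigma>. exp (\<omega> * (\<tau> - \<sigma>)) * norm (u \<sigma>))"
    (is ?e)
    and "norm (vector_bochner_integral (lebesgue_on {t..\<tau>}) (\<lambda>\<sigma>. blinfun_apply (S (\<tau> - \<sigma>)) (blinfun_apply B (u \<sigma>))))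
      \<le> norm B * (LINT \<sigma>|lebesgue_on {t..\<tau>}. exp (\<omega> * (\<tau> - \<sigma>)) * norm (u \<sigma>))"
    (is ?n)
proof -
  let ?M = "lebesgue_on {t..\<tau>}"
  let ?f = "\<lambda>\<sigma>. blinfun_apply (S (\<tau> - \<sigma>)) (blinfun_apply B (u \<sigma>))"
  have cM: "complete_measure ?M" by (rule complete_measure_lebesgue_on) simp
  have um: "strongly_measurable ?M u"
    using u by (auto simp: admissible_def intro: strongly_measurable_lebesgue_on_subset[of "{t..}"])
  have tm: "strongly_measurable ?M (\<lambda>\<sigma>. \<tau> - \<sigma>)"
    by (intro strongly_measurable_borel_real borel_measurable_lebesgue_onI) simp
  have Bm: "strongly_measurable ?M (\<lambda>\<sigma>. blinfun_apply B (u \<sigma>))"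
    by (rule strongly_measurable_compose[OF um]) (intro continuous_intros)
  have "strongly_measurable ?M (\<lambda>\<sigma>. blinfun_apply (S (max 0 (\<tau> - \<sigma>))) (blinfun_apply B (u \<sigma>)))"
    by (rule strongly_measurable_compose2[OF tm Bm semigroup_jointly_continuous[OF semigroup growth]])
  then show m: ?m
    by (rule strongly_measurable_AE_cong) (auto intro!: AE_I2)
  have ni: "integrable ?M (\<lambda>\<sigma>. norm (u \<sigma>))"
    by (rule admissible_norm_integrable[OF u])
  show e: ?e
  proof (rule Bochner_Integration.integrable_bound)
    show "integrable ?M (\<lambda>\<sigma>. exp (\<omega> * (\<tau> - t)) * norm (u \<sigma>))"
      using ni by simp
    show "(\<lambda>\<sigma>. exp (\<omega> * (\<tau> - \<sigma>)) * norm (u \<sigma>)) \<in> borel_measurable ?M"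
      using ni by (intro borel_measurable_times[OF borel_measurable_lebesgue_onI]) auto
    show "AE \<sigma> in ?M. norm (exp (\<omega> * (\<tau> - \<sigma>)) * norm (u \<sigma>)) \<le> norm (exp (\<omega> * (\<tau> - t)) * norm (u \<sigma>))"
      using omega_nonneg by (intro AE_I2) (auto intro!: mult_right_mono mult_left_mono)
  qed
  have le: "norm (?f \<sigma>) \<le> norm B * (exp (\<omega> * (\<tau> - \<sigma>)) * norm (u \<sigma>))" if "\<sigma> \<in> {t..\<tau>}" for \<sigma>
  proof -
    have "norm (?f \<sigma>) \<le> exp (\<omega> * (\<tau> - \<sigma>)) * norm (blinfun_apply B (u \<sigma>))"
      using that by (intro growth) auto
    also have "\<dots> \<le> exp (\<omega> * (\<tau> - \<sigma>)) * (norm B * norm (u \<sigma>))"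
      by (intro mult_left_mono norm_blinfun) auto
    finally show ?thesis by (simp add: ac_simps)
  qed
  have e': "integrable ?M (\<lambda>\<sigma>. norm B * (exp (\<omega> * (\<tau> - \<sigma>)) * norm (u \<sigma>)))"
    using e by simp
  show i: ?i
  proof (rule Bochner_Integration.integrable_bound[OF e'])
    show "(\<lambda>\<sigma>. norm (?f \<sigma>)) \<in> borel_measurable ?M"
      using strongly_measurable_imp_borel_measurable[OF cM m] by simp
    show "AE \<sigma> in ?M. norm (norm (?f \<sigma>)) \<le> norm (norm B * (exp (\<omega> * (\<tau> - \<sigma>)) * norm (u \<sigma>)))"
      using le by (intro AE_I2) (auto simp: abs_mult)
  qed
  have "norm (vector_bochner_integral ?M ?f) \<le> (LINT \<sigma>|?M. norm (?f \<sigma>))"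
    by (rule norm_vector_bochner_integral_le[OF cM m i])
  also have "\<dots> \<le> (LINT \<sigma>|?M. norm B * (exp (\<omega> * (\<tau> - \<sigma>)) * norm (u \<sigma>)))"
    by (rule integral_mono[OF i e']) (use le in auto)
  finally show ?n
    by simp
qed

lemma trajectory_functional:
  fixes \<phi> :: "'w \<Rightarrow> real"
  assumes u: "admissible t u" and \<phi>: "bounded_linear \<phi>"
  shows "integrable (lebesgue_on {t..\<tau>}) (\<lambda>\<sigma>. \<phi> (blinfun_apply (S (\<tau> - \<sigma>)) (blinfun_apply B (u \<sigma>))))"
    and "\<phi> (traj t z u \<tau>) = \<phi> (blinfun_apply (S (\<tau> - t)) z) +
      (LINT \<sigma>|lebesgue_on {t..\<tau>}. \<phi> (blinfun_apply (S (\<tau> - \<sigma>)) (blinfun_apply B (u \<sigma>))))"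
proof -
  note F = vector_bochner_integral_functional[OF complete_measure_lebesgue_on trajectory_integrand(1,2)[OF u] \<phi>, of \<tau>]
  show "integrable (lebesgue_on {t..\<tau>}) (\<lambda>\<sigma>. \<phi> (blinfun_apply (S (\<tau> - \<sigma>)) (blinfun_apply B (u \<sigma>))))"
    by (rule F(1)) simp
  show "\<phi> (traj t z u \<tau>) = \<phi> (blinfun_apply (S (\<tau> - t)) z) +
      (LINT \<sigma>|lebesgue_on {t..\<tau>}. \<phi> (blinfun_apply (S (\<tau> - \<sigma>)) (blinfun_apply B (u \<sigma>))))"
    using F(2) by (simp add: trajectory_def linear_add[OF bounded_linear.linear[OF \<phi>]])
qed

lemma trajectory_diff: "traj t z u \<tau> - traj t x u \<tau> = blinfun_apply (S (\<tau> - t)) (z - x)"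
  by (simp add: trajectory_def blinfun.diff_right)

lemma admissible_midpoint:
  assumes u: "admissible t u" and v: "admissible t v"
  shows "admissible t (\<lambda>s. (1/2) *\<^sub>R u s + (1/2) *\<^sub>R v s)"
proof -
  let ?M = "lebesgue_on {t..}" and ?w = "\<lambda>s. (1/2) *\<^sub>R u s + (1/2) *\<^sub>R v s"
  have m: "strongly_measurable ?M ?w"
    using u v unfolding admissible_def
    by (intro strongly_measurable_add strongly_measurable_scaleR[OF strongly_measurable_simple]) auto
  have sq: "(norm (?w s))\<^sup>2 \<le> (norm (u s))\<^sup>2 + (norm (v s))\<^sup>2" for s
  proof -
    have "norm (?w s) \<le> (norm (u s) + norm (v s)) / 2"
      using norm_triangle_ineq[of "(1/2) *\<^sub>R u s" "(1/2) *\<^sub>R v s"] by simp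
    then have "(norm (?w s))\<^sup>2 \<le> ((norm (u s) + norm (v s)) / 2)\<^sup>2"
      by (rule power_mono) simp
    also have "\<dots> \<le> (norm (u s))\<^sup>2 + (norm (v s))\<^sup>2"
    proof -
      have "((a + b) / 2)\<^sup>2 \<le> a\<^sup>2 + b\<^sup>2" for a b :: real
      proof -
        have "a\<^sup>2 + b\<^sup>2 = ((a + b) / 2)\<^sup>2 + (((a - b) / 2)\<^sup>2 + (a\<^sup>2 + b\<^sup>2) / 2)"
          by (simp add: power2_eq_square field_simps)
        moreover have "0 \<le> ((a - b) / 2)\<^sup>2 + (a\<^sup>2 + b\<^sup>2) / 2"
          by simp
        ultimately show ?thesis by linarith
      qed
      then show ?thesis .
    qed
    finally show ?thesis .
  qed
  \<comment> \<open>x\<close>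
  have "integrable ?M (\<lambda>s. exp (- lam * s) * (norm (?w s))\<^sup>2)"
  proof (rule Bochner_Integration.integrable_bound)
    show "integrable ?M (\<lambda>s. exp (- lam * s) * (norm (u s))\<^sup>2 + exp (- lam * s) * (norm (v s))\<^sup>2)"
      using u v by (auto simp: admissible_def)
    have "?w \<in> borel_measurable ?M"
      using strongly_measurable_imp_borel_measurable[OF complete_measure_lebesgue_on m] by simp
    then have "(\<lambda>s. norm (?w s)) \<in> borel_measurable ?M" by simp
    then show "(\<lambda>s. exp (- lam * s) * (norm (?w s))\<^sup>2) \<in> borel_measurable ?M"
      by (intro borel_measurable_times[OF borel_measurable_lebesgue_onI] borel_measurable_power) auto
    show "AE s in ?M. norm (exp (- lam * s) * (norm (?w s))\<^sup>2) \<le>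
        norm (exp (- lam * s) * (norm (u s))\<^sup>2 + exp (- lam * s) * (norm (v s))\<^sup>2)"
    proof (rule AE_I2)
      fix s
      have "exp (- lam * s) * (norm (?w s))\<^sup>2 \<le> exp (- lam * s) * ((norm (u s))\<^sup>2 + (norm (v s))\<^sup>2)"
        using sq[of s] by (rule mult_left_mono) simp
      also have "\<dots> = exp (- lam * s) * (norm (u s))\<^sup>2 + exp (- lam * s) * (norm (v s))\<^sup>2"
        by (rule distrib_left)
      finally show "norm (exp (- lam * s) * (norm (?w s))\<^sup>2) \<le>
        norm (exp (- lam * s) * (norm (u s))\<^sup>2 + exp (- lam * s) * (norm (v s))\<^sup>2)"
        by (smt (verit, best) real_norm_def exp_ge_zero mult_nonneg_nonneg zero_le_power2)
    qed
  qed
  with m show ?thesis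
    by (simp add: admissible_def)
qed

lemma trajectory_midpoint:
  assumes u: "admissible t u" and v: "admissible t v"
  shows "traj t ((1/2) *\<^sub>R x + (1/2) *\<^sub>R z) (\<lambda>s. (1/2) *\<^sub>R u s + (1/2) *\<^sub>R v s) \<tau>
    = (1/2) *\<^sub>R traj t x u \<tau> + (1/2) *\<^sub>R traj t z v \<tau>"
proof -
  have "c \<bullet> traj t ((1/2) *\<^sub>R x + (1/2) *\<^sub>R z) (\<lambda>s. (1/2) *\<^sub>R u s + (1/2) *\<^sub>R v s) \<tau>
    = c \<bullet> ((1/2) *\<^sub>R traj t x u \<tau> + (1/2) *\<^sub>R traj t z v \<tau>)" for c
    using trajectory_functional(1)[OF u bounded_linear_inner_right, of \<tau> c]
      trajectory_functional(1)[OF v bounded_linear_inner_right, of \<tau> c]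
    by (simp add: inner_add_right trajectory_functional(2)[OF _ bounded_linear_inner_right]
        u v admissible_midpoint blinfun.add_right blinfun.scaleR_right) argo
  then show ?thesis
    using vector_eq_ldot by blast
qed

text \<open>
  The flow property: the trajectory can be restarted at time \<open>c\<close> from the state reached there. Tested
  against a vector \<open>e\<close>, it is the semigroup law under the integral plus additivity over intervals.
\<close>

lemma trajectory_cocycle:
  assumes u: "admissible t u" and "t \<le> c" "c \<le> \<tau>"
  shows "traj c (traj t z u c) u \<tau> = traj t z u \<tau>"
proof -
  have "e \<bullet> traj c (traj t z u c) u \<tau> = e \<bullet> traj t z u \<tau>" for e
  proof -
    let ?g = "\<lambda>\<sigma>. e \<bullet> blinfun_apply (S (\<tau> - \<sigma>)) (blinfun_apply B (u \<sigma>))"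
    have bl: "bounded_linear (\<lambda>y. e \<bullet> blinfun_apply (S (\<tau> - c)) y)"
      by (intro bounded_linear_compose[OF bounded_linear_inner_right blinfun.bounded_linear_right])
    have eq: "blinfun_apply (S (\<tau> - c)) (blinfun_apply (S (c - \<sigma>)) y) = blinfun_apply (S (\<tau> - \<sigma>)) y"
      if "\<sigma> \<le> c" for \<sigma> y
      using semigroup_add[of "\<tau> - c" "c - \<sigma>" y] that assms by simp
    have "e \<bullet> traj c (traj t z u c) u \<tau> = e \<bullet> blinfun_apply (S (\<tau> - c)) (traj t z u c)
        + (LINT \<sigma>|lebesgue_on {c..\<tau>}. ?g \<sigma>)"
      using assms by (intro trajectory_functional(2) bounded_linear_inner_right admissible_mono[OF u])
    also have "e \<bullet> blinfun_apply (S (\<tau> - c)) (traj t z u c) = e \<bullet> blinfun_apply (S (\<tau> - t)) z +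
        (LINT \<sigma>|lebesgue_on {t..c}. e \<bullet> blinfun_apply (S (\<tau> - c)) (blinfun_apply (S (c - \<sigma>)) (blinfun_apply B (u \<sigma>))))"
      unfolding trajectory_functional(2)[OF u bl] using eq assms by simp
    also have "(LINT \<sigma>|lebesgue_on {t..c}. e \<bullet> blinfun_apply (S (\<tau> - c)) (blinfun_apply (S (c - \<sigma>)) (blinfun_apply B (u \<sigma>))))
        = (LINT \<sigma>|lebesgue_on {t..c}. ?g \<sigma>)"
      by (rule Bochner_Integration.integral_cong) (auto simp: eq)
    also have "e \<bullet> blinfun_apply (S (\<tau> - t)) z + (LINT \<sigma>|lebesgue_on {t..c}. ?g \<sigma>) + (LINT \<sigma>|lebesgue_on {c..\<tau>}. ?g \<sigma>)
      = e \<bullet> blinfun_apply (S (\<tau> - t)) z + (LINT \<sigma>|lebesgue_on {t..\<tau>}. ?g \<sigma>)"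
    proof -
      have "{t..\<tau>} = {t..c} \<union> {c..\<tau>}" "{t..c} \<inter> {c..\<tau>} \<subseteq> {c}"
        using assms by auto
      then show ?thesis
        using lebesgue_on_integral_Un[of "{t..c}" "{c..\<tau>}" ?g c]
          trajectory_functional(1)[OF u bounded_linear_inner_right, of \<tau> e] by auto
    qed
    also have "\<dots> = e \<bullet> traj t z u \<tau>"
      by (rule trajectory_functional(2)[OF u bounded_linear_inner_right, symmetric])
    finally show ?thesis .
  qed
  then show ?thesis
    using vector_eq_ldot by blast
qed

text \<open>
  The controls may differ at the end point \<open>\<tau>\<close>, a null set; this is what makes the lemma apply up to and
  including the switching time of a concatenated control.
\<close>

lemma trajectory_cong:
  assumes u: "admissible t u" and v: "admissible t v" and eq: "\<And>\<sigma>. t \<le> \<sigma> \<Longrightarrow> \<sigma> < \<tau> \<Longrightarrow> u \<sigma> = v \<sigma>"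
  shows "traj t z u \<tau> = traj t z v \<tau>"
proof -
  have "c \<bullet> traj t z u \<tau> = c \<bullet> traj t z v \<tau>" for c
  proof -
    have "AE x in lebesgue. x \<noteq> \<tau>"
      using AE_not_in[of "{\<tau>}" "lebesgue :: real measure"] by simp
    then have "AE x in lebesgue_on {t..\<tau>}. c \<bullet> blinfun_apply (S (\<tau> - x)) (blinfun_apply B (u x))
        = c \<bullet> blinfun_apply (S (\<tau> - x)) (blinfun_apply B (v x))"
      by (subst AE_restrict_space_iff, simp, elim eventually_mono) (use eq in auto)
    then have "(LINT \<sigma>|lebesgue_on {t..\<tau>}. c \<bullet> blinfun_apply (S (\<tau> - \<sigma>)) (blinfun_apply B (u \<sigma>)))
      = (LINT \<sigma>|lebesgue_on {t..\<tau>}. c \<bullet> blinfun_apply (S (\<tau> - \<sigma>)) (blinfun_apply B (v \<sigma>)))"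
      using trajectory_functional(1)[OF u bounded_linear_inner_right, of \<tau> c]
        trajectory_functional(1)[OF v bounded_linear_inner_right, of \<tau> c]
      by (intro integral_cong_AE) auto
    then show ?thesis
      by (simp add: trajectory_functional(2)[OF _ bounded_linear_inner_right] u v)
  qed
  then show ?thesis
    using vector_eq_ldot by blast
qed

lemma trajectory_translate:
  assumes "admissible (t + r) u"
  shows "traj t z (\<lambda>s. u (s + r)) \<tau> = traj (t + r) z u (\<tau> + r)"
  using vector_bochner_integral_translate[of "{t..\<tau>}" r, OF _ image_add_atLeastAtMost' trajectory_integrand(1,2)[OF assms]]
  by (simp add: trajectory_def)

text \<open>
  By the flow property, the increment after \<open>s\<close> is the semigroup acting on the state at \<open>s\<close> for
  a short time, plus an integral over a short interval; the latter is controlled by the indefinite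
  integral of \<open>|u|\<close>, which is continuous.
\<close>

lemma trajectory_right_continuous:
  assumes u: "admissible t u" and s: "t \<le> s"
  shows "(traj t z u \<longlongrightarrow> traj t z u s) (at_right s)"
proof -
  define y where "y = traj t z u s"
  have us: "admissible s u" by (rule admissible_mono[OF u s])
  have ni: "integrable (lebesgue_on {s..s+1}) (\<lambda>\<sigma>. norm (u \<sigma>))"
    by (rule admissible_norm_integrable[OF us])
  define N where "N \<tau> = integral {s..\<tau>} (\<lambda>\<sigma>. norm (u \<sigma>))" for \<tau>
  have "continuous_on {s..s+1} N"
    unfolding N_def by (rule indefinite_integral_continuous_1[OF integrable_on_lebesgue_on[OF ni]]) simp
  then have "(N \<longlongrightarrow> N s) (at s within {s..s+1})"
    by (simp add: continuous_on_def)
  then have N: "(N \<longlongrightarrow> 0) (at_right s)"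
    by (simp add: N_def at_within_Icc_at_right)
  have ev: "\<forall>\<^sub>F \<tau> in at_right s. s < \<tau> \<and> \<tau> < s + 1"
    using eventually_at_right_real[of s "s + 1"] by simp
  let ?I = "\<lambda>\<tau>. vector_bochner_integral (lebesgue_on {s..\<tau>}) (\<lambda>\<sigma>. blinfun_apply (S (\<tau> - \<sigma>)) (blinfun_apply B (u \<sigma>)))"
  have "(?I \<longlongrightarrow> 0) (at_right s)"
  proof (rule Lim_null_comparison)
    show "\<forall>\<^sub>F \<tau> in at_right s. norm (?I \<tau>) \<le> norm B * (exp \<omega> * N \<tau>)"
      using ev
    proof eventually_elim
      case (elim \<tau>)
      have ni': "integrable (lebesgue_on {s..\<tau>}) (\<lambda>\<sigma>. norm (u \<sigma>))"
        by (rule admissible_norm_integrable[OF us])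
      have "norm (?I \<tau>) \<le> norm B * (LINT \<sigma>|lebesgue_on {s..\<tau>}. exp (\<omega> * (\<tau> - \<sigma>)) * norm (u \<sigma>))"
        by (rule trajectory_integrand(4)[OF us])
      also have "(LINT \<sigma>|lebesgue_on {s..\<tau>}. exp (\<omega> * (\<tau> - \<sigma>)) * norm (u \<sigma>))
          \<le> (LINT \<sigma>|lebesgue_on {s..\<tau>}. exp \<omega> * norm (u \<sigma>))"
      proof (rule integral_mono)
        fix \<sigma> assume "\<sigma> \<in> space (lebesgue_on {s..\<tau>})"
        then have "\<omega> * (\<tau> - \<sigma>) \<le> \<omega> * 1"
          using elim omega_nonneg by (intro mult_left_mono) auto
        then show "exp (\<omega> * (\<tau> - \<sigma>)) * norm (u \<sigma>) \<le> exp \<omega> * norm (u \<sigma>)"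
          by (intro mult_right_mono) auto
      qed (use ni' trajectory_integrand(3)[OF us] in auto)
      also have "\<dots> = exp \<omega> * N \<tau>"
        using lebesgue_integral_eq_integral[OF ni'] by (simp add: N_def)
      finally show ?case
        by (simp add: mult_left_mono)
    qed
    have "((\<lambda>\<tau>. norm B * (exp \<omega> * N \<tau>)) \<longlongrightarrow> norm B * (exp \<omega> * 0)) (at_right s)"
      by (intro tendsto_intros N)
    then show "((\<lambda>\<tau>. norm B * (exp \<omega> * N \<tau>)) \<longlongrightarrow> 0) (at_right s)" by simp
  qed
  moreover have "((\<lambda>\<tau>. blinfun_apply (S (\<tau> - s)) y) \<longlongrightarrow> blinfun_apply (S 0) y) (at_right s)"
  proof (rule continuous_on_tendsto_compose[where f = "\<lambda>t. blinfun_apply (S t) y" and s = "{0..}"])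
    show "continuous_on {0..} (\<lambda>t. blinfun_apply (S t) y)"
      using semigroup by (simp add: C0_semigroup_def)
    have "((\<lambda>\<tau>. \<tau> - s) \<longlongrightarrow> s - s) (at_right s)"
      by (intro tendsto_intros)
    then show "((\<lambda>\<tau>. \<tau> - s) \<longlongrightarrow> 0) (at_right s)" by simp
    show "\<forall>\<^sub>F \<tau> in at_right s. \<tau> - s \<in> {0..}"
      using ev by eventually_elim simp
  qed simp
  ultimately have "((\<lambda>\<tau>. blinfun_apply (S (\<tau> - s)) y + ?I \<tau>) \<longlongrightarrow> y + 0) (at_right s)"
    by (intro tendsto_add) (auto simp: semigroup_zero)
  moreover have "\<forall>\<^sub>F \<tau> in at_right s. blinfun_apply (S (\<tau> - s)) y + ?I \<tau> = traj t z u \<tau>"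
    using ev
  proof eventually_elim
    case (elim \<tau>)
    show ?case
      using trajectory_cocycle[OF u s, of \<tau> z] elim by (simp add: trajectory_def[of _ _ s] y_def)
  qed
  ultimately show ?thesis
    by (auto simp: y_def intro: Lim_transform_eventually)
qed

lemma trajectory_strongly_measurable:
  assumes "admissible t u"
  shows "strongly_measurable (lebesgue_on {t..}) (traj t z u)"
  by (rule strongly_measurable_right_continuous) (rule trajectory_right_continuous[OF assms])

end

section \<open>Weighted square integrability of trajectories\<close>

text \<open>
  Cauchy-Schwarz for the kernel \<open>exp (- e (\<tau> - \<sigma>))\<close>, whose total mass is at most \<open>1 / e\<close>. It follows
  from \<open>2 r \<le> c + r\<^sup>2 / c\<close>, integrated against the kernel, with the best constant \<open>c\<close>.
\<close>

lemma exponential_convolution_pointwise: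
  fixes r :: "real \<Rightarrow> real"
  assumes e: "e > 0"
    and r1: "integrable (lebesgue_on {t..\<tau>}) (\<lambda>\<sigma>. exp (- e * (\<tau> - \<sigma>)) * r \<sigma>)"
    and r2: "integrable (lebesgue_on {t..\<tau>}) (\<lambda>\<sigma>. exp (- e * (\<tau> - \<sigma>)) * (r \<sigma>)\<^sup>2)"
    and nonneg: "\<And>\<sigma>. r \<sigma> \<ge> 0" and "t \<le> \<tau>"
  shows "(LINT \<sigma>|lebesgue_on {t..\<tau>}. exp (- e * (\<tau> - \<sigma>)) * r \<sigma>)\<^sup>2
    \<le> (1 / e) * (LINT \<sigma>|lebesgue_on {t..\<tau>}. exp (- e * (\<tau> - \<sigma>)) * (r \<sigma>)\<^sup>2)"
proof -
  let ?M = "lebesgue_on {t..\<tau>}"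
  let ?k = "\<lambda>\<sigma>. exp (- e * (\<tau> - \<sigma>))"
  define I where "I = (LINT \<sigma>|?M. ?k \<sigma> * r \<sigma>)"
  define K where "K = (LINT \<sigma>|?M. ?k \<sigma> * (r \<sigma>)\<^sup>2)"
  have hk: "(?k has_integral (1 - exp (- e * (\<tau> - t))) / e) {t..\<tau>}"
  proof -
    have "((\<lambda>\<sigma>. exp (- e * (\<tau> - \<sigma>)) / e) has_vector_derivative ?k \<sigma>) (at \<sigma> within {t..\<tau>})" for \<sigma>
      unfolding has_real_derivative_iff_has_vector_derivative[symmetric]
      using e by (auto intro!: derivative_eq_intros)
    from fundamental_theorem_of_calculus[OF \<open>t \<le> \<tau>\<close> this] show ?thesis
      by (simp add: diff_divide_distrib)
  qed
  have "?k absolutely_integrable_on {t..\<tau>}"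
    using hk by (intro nonnegative_absolutely_integrable_1) (auto simp: integrable_on_def)
  then have k: "integrable ?M ?k"
    by (simp add: integrable_restrict_space set_integrable_def)
  have "(LINT \<sigma>|?M. ?k \<sigma>) = (1 - exp (- e * (\<tau> - t))) / e"
    using lebesgue_integral_eq_integral[OF k] integral_unique[OF hk] by simp
  also have "\<dots> \<le> 1 / e"
    using e by (intro divide_right_mono) auto
  finally have k_le: "(LINT \<sigma>|?M. ?k \<sigma>) \<le> 1 / e" .
  have young: "2 * I \<le> c * (1 / e) + K / c" if c: "c > 0" for c
  proof -
    have "2 * I = (LINT \<sigma>|?M. 2 * (?k \<sigma> * r \<sigma>))"
      by (simp add: I_def)
    also have "\<dots> \<le> (LINT \<sigma>|?M. c * ?k \<sigma> + (1 / c) * (?k \<sigma> * (r \<sigma>)\<^sup>2))"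
    proof (rule integral_mono)
      show "integrable ?M (\<lambda>\<sigma>. 2 * (?k \<sigma> * r \<sigma>))"
        by (rule integrable_mult_right[OF r1])
      show "integrable ?M (\<lambda>\<sigma>. c * ?k \<sigma> + (1 / c) * (?k \<sigma> * (r \<sigma>)\<^sup>2))"
        by (intro Bochner_Integration.integrable_add integrable_mult_right k r2)
      fix \<sigma>
      have "0 \<le> (c - r \<sigma>)\<^sup>2 / c"
        using c by simp
      also have "(c - r \<sigma>)\<^sup>2 / c = c + (1 / c) * (r \<sigma>)\<^sup>2 - 2 * r \<sigma>"
        using c by (simp add: power2_diff field_simps power2_eq_square)
      finally have "2 * r \<sigma> \<le> c + (1 / c) * (r \<sigma>)\<^sup>2" by simp
      from mult_left_mono[OF this, of "?k \<sigma>"]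
      show "2 * (?k \<sigma> * r \<sigma>) \<le> c * ?k \<sigma> + (1 / c) * (?k \<sigma> * (r \<sigma>)\<^sup>2)"
        by (simp add: algebra_simps)
    qed
    also have "\<dots> = c * (LINT \<sigma>|?M. ?k \<sigma>) + (1 / c) * K"
      by (simp only: K_def integral_mult_right_zero
          Bochner_Integration.integral_add[OF integrable_mult_right[OF k, of c] integrable_mult_right[OF r2, of "1 / c"]])
    also have "\<dots> \<le> c * (1 / e) + K / c"
      using mult_left_mono[OF k_le, of c] c by simp
    finally show ?thesis .
  qed
  have I0: "I \<ge> 0"
    unfolding I_def by (intro Bochner_Integration.integral_nonneg) (simp add: nonneg)
  have K0: "K \<ge> 0"
    unfolding K_def by (intro Bochner_Integration.integral_nonneg) simp
  have "I\<^sup>2 \<le> (1 / e) * K"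
  proof (cases "I = 0")
    case False
    then have "I > 0" using I0 by simp
    then have "2 * I \<le> I + K / (e * I)"
      \<comment> \<open>The choice \<open>c = e I\<close> minimises the right-hand side once \<open>I\<^sup>2 = K / e\<close>.\<close>
      using young[of "e * I"] e by simp
    then have "I \<le> K / (e * I)" by simp
    then have "I * (e * I) \<le> K"
      using \<open>I > 0\<close> e by (simp add: pos_le_divide_eq)
    then show ?thesis
      using e by (simp add: field_simps power2_eq_square)
  qed (use K0 e in simp)
  then show ?thesis
    by (simp add: I_def K_def)
qed

text \<open>
  Young's inequality for the convolution with an exponential kernel, by Tonelli's theorem. The
  measurable majorant \<open>J\<close> can be added to other terms under the integral without any discussion of
  the measurability of the convolution itself.
\<close>

lemma exponential_convolution_L2:
  fixes r :: "real \<Rightarrow> real"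
  assumes e: "e > 0" and nonneg: "\<And>\<sigma>. r \<sigma> \<ge> 0"
    and r1: "\<And>\<tau>. integrable (lebesgue_on {t..\<tau>}) (\<lambda>\<sigma>. exp (- e * (\<tau> - \<sigma>)) * r \<sigma>)"
    and r2: "integrable (lebesgue_on {t..}) (\<lambda>\<sigma>. (r \<sigma>)\<^sup>2)"
  obtains J :: "real \<Rightarrow> ennreal" where "J \<in> borel_measurable (lebesgue_on {t..})"
    "(\<integral>\<^sup>+\<tau>. J \<tau> \<partial>lebesgue_on {t..}) < \<infinity>"
    "\<And>\<tau>. \<tau> \<ge> t \<Longrightarrow> ennreal ((LINT \<sigma>|lebesgue_on {t..\<tau>}. exp (- e * (\<tau> - \<sigma>)) * r \<sigma>)\<^sup>2) \<le> J \<tau>"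
proof
  let ?M = "lebesgue_on {t..}"
  interpret M: sigma_finite_measure ?M by (rule sigma_finite_measure_halfline)
  interpret MM: pair_sigma_finite ?M ?M ..
  define F where "F \<sigma> \<tau> = ennreal (exp (- e * (\<tau> - \<sigma>)) * (r \<sigma>)\<^sup>2) * indicator {\<sigma>..} \<tau>" for \<sigma> \<tau>
  have id: "(\<lambda>s. s) \<in> borel_measurable ?M"
    by (rule borel_measurable_lebesgue_onI) simp
  have [measurable]: "(\<lambda>s. (r s)\<^sup>2) \<in> borel_measurable ?M"
    using r2 by auto
  have [measurable]: "fst \<in> borel_measurable (?M \<Otimes>\<^sub>M ?M)" "snd \<in> borel_measurable (?M \<Otimes>\<^sub>M ?M)"
    using measurable_compose[OF measurable_fst id] measurable_compose[OF measurable_snd id] by auto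
  have F_eq: "(\<lambda>p. F (fst p) (snd p)) = (\<lambda>p. ennreal (exp (- e * (snd p - fst p)) * (r (fst p))\<^sup>2)
      * (if fst p \<le> snd p then 1 else 0))"
    by (auto simp: F_def indicator_def fun_eq_iff)
  have [measurable]: "(\<lambda>p. (r (fst p))\<^sup>2) \<in> borel_measurable (?M \<Otimes>\<^sub>M ?M)"
    by (rule measurable_compose[OF measurable_fst]) measurable
  have "(\<lambda>p. F (fst p) (snd p)) \<in> borel_measurable (?M \<Otimes>\<^sub>M ?M)"
    unfolding F_eq by measurable
  then have F: "case_prod F \<in> borel_measurable (?M \<Otimes>\<^sub>M ?M)"
    by (simp add: case_prod_unfold)
  then have F': "(\<lambda>(\<tau>, \<sigma>). F \<sigma> \<tau>) \<in> borel_measurable (?M \<Otimes>\<^sub>M ?M)"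
    using measurable_compose[OF measurable_pair_swap' F] by (simp add: case_prod_unfold)
  show "(\<lambda>\<tau>. ennreal (1 / e) * (\<integral>\<^sup>+\<sigma>. F \<sigma> \<tau> \<partial>?M)) \<in> borel_measurable ?M"
    using M.borel_measurable_nn_integral[OF F'] by simp
  have inner: "(\<integral>\<^sup>+\<tau>. F \<sigma> \<tau> \<partial>?M) = ennreal (1 / e) * ennreal ((r \<sigma>)\<^sup>2)" if \<sigma>: "\<sigma> \<ge> t" for \<sigma>
  proof -
    have "(\<integral>\<^sup>+\<tau>. F \<sigma> \<tau> \<partial>?M) = (\<integral>\<^sup>+\<tau>. F \<sigma> \<tau> * indicator {t..} \<tau> \<partial>lebesgue)"
      by (subst nn_integral_restrict_space) auto
    also have "\<dots> = (\<integral>\<^sup>+\<tau>. ennreal (exp (e * \<sigma>) * (r \<sigma>)\<^sup>2) * (ennreal (exp (- e * \<tau>)) * indicator {\<sigma>..} \<tau>) \<partial>lebesgue)"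
      using \<sigma> by (intro nn_integral_cong)
        (auto simp: F_def indicator_def algebra_simps exp_diff exp_minus field_simps simp flip: ennreal_mult exp_add)
    also have "\<dots> = ennreal (exp (e * \<sigma>) * (r \<sigma>)\<^sup>2) * (\<integral>\<^sup>+\<tau>\<in>{\<sigma>..}. ennreal (exp (- e * \<tau>)) \<partial>lebesgue)"
      by (intro nn_integral_cmult borel_measurable_times_ennreal measurable_completion) auto
    also have "\<dots> = ennreal (exp (e * \<sigma>) * (r \<sigma>)\<^sup>2) * ennreal (exp (- e * \<sigma>) / e)"
      by (simp only: integrable_exp_halfline(2)[OF e])
    also have "\<dots> = ennreal (1 / e) * ennreal ((r \<sigma>)\<^sup>2)"
      using e by (simp add: exp_minus field_simps flip: ennreal_mult)
    finally show ?thesis .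
  qed
  have "(\<integral>\<^sup>+\<tau>. ennreal (1 / e) * (\<integral>\<^sup>+\<sigma>. F \<sigma> \<tau> \<partial>?M) \<partial>?M) = ennreal (1 / e) * (\<integral>\<^sup>+\<tau>. \<integral>\<^sup>+\<sigma>. F \<sigma> \<tau> \<partial>?M \<partial>?M)"
    using M.borel_measurable_nn_integral[OF F'] by (intro nn_integral_cmult) simp
  also have "(\<integral>\<^sup>+\<tau>. \<integral>\<^sup>+\<sigma>. F \<sigma> \<tau> \<partial>?M \<partial>?M) = (\<integral>\<^sup>+\<sigma>. \<integral>\<^sup>+\<tau>. F \<sigma> \<tau> \<partial>?M \<partial>?M)"
    by (rule MM.Fubini'[OF F])
  also have "\<dots> = (\<integral>\<^sup>+\<sigma>. ennreal (1 / e) * ennreal ((r \<sigma>)\<^sup>2) \<partial>?M)"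
    by (intro nn_integral_cong inner) simp
  also have "\<dots> = ennreal (1 / e) * (\<integral>\<^sup>+\<sigma>. ennreal ((r \<sigma>)\<^sup>2) \<partial>?M)"
    by (intro nn_integral_cmult) auto
  also have "ennreal (1 / e) * \<dots> < \<infinity>"
    using r2 by (simp add: integrable_iff_bounded ennreal_mult_less_top)
  finally show "(\<integral>\<^sup>+\<tau>. ennreal (1 / e) * (\<integral>\<^sup>+\<sigma>. F \<sigma> \<tau> \<partial>?M) \<partial>?M) < \<infinity>" .
  fix \<tau> assume \<tau>: "\<tau> \<ge> t"
  let ?k = "\<lambda>\<sigma>. exp (- e * (\<tau> - \<sigma>))"
  have k2: "integrable (lebesgue_on {t..\<tau>}) (\<lambda>\<sigma>. ?k \<sigma> * (r \<sigma>)\<^sup>2)"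
  proof (rule Bochner_Integration.integrable_bound)
    show r2': "integrable (lebesgue_on {t..\<tau>}) (\<lambda>\<sigma>. (r \<sigma>)\<^sup>2)"
      by (rule lebesgue_on_integrable_subset[OF r2]) auto
    then show "(\<lambda>\<sigma>. ?k \<sigma> * (r \<sigma>)\<^sup>2) \<in> borel_measurable (lebesgue_on {t..\<tau>})"
      by (intro borel_measurable_times[OF borel_measurable_lebesgue_onI]) auto
    show "AE \<sigma> in lebesgue_on {t..\<tau>}. norm (?k \<sigma> * (r \<sigma>)\<^sup>2) \<le> norm ((r \<sigma>)\<^sup>2)"
      using e by (intro AE_I2) (auto simp: abs_mult intro!: mult_left_le_one_le)
  qed
  have "ennreal (LINT \<sigma>|lebesgue_on {t..\<tau>}. ?k \<sigma> * (r \<sigma>)\<^sup>2) = (\<integral>\<^sup>+\<sigma>. ennreal (?k \<sigma> * (r \<sigma>)\<^sup>2) \<partial>lebesgue_on {t..\<tau>})"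
    by (rule nn_integral_eq_integral[OF k2, symmetric]) simp
  also have "\<dots> = (\<integral>\<^sup>+\<sigma>. F \<sigma> \<tau> \<partial>?M)"
    by (simp add: nn_integral_restrict_space) (intro nn_integral_cong, auto simp: F_def indicator_def)
  finally have "ennreal (LINT \<sigma>|lebesgue_on {t..\<tau>}. ?k \<sigma> * (r \<sigma>)\<^sup>2) = (\<integral>\<^sup>+\<sigma>. F \<sigma> \<tau> \<partial>?M)" .
  with ennreal_leI[OF exponential_convolution_pointwise[OF e r1 k2 nonneg \<tau>]] e
  show "ennreal ((LINT \<sigma>|lebesgue_on {t..\<tau>}. ?k \<sigma> * r \<sigma>)\<^sup>2) \<le> ennreal (1 / e) * (\<integral>\<^sup>+\<sigma>. F \<sigma> \<tau> \<partial>?M)"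
    by (simp only: ennreal_mult' zero_le_divide_1_iff less_imp_le)
qed

context controlled_system
begin

text \<open>
  With \<open>e = lam / 2 - \<omega>\<close>, the factor \<open>exp (- lam \<tau> / 2)\<close> turns the growth bound \<open>exp (\<omega> (\<tau> - \<sigma>))\<close> into the
  decaying kernel \<open>exp (- e (\<tau> - \<sigma>))\<close> acting on the \<open>L\<^sup>2\<close> function \<open>exp (- lam \<sigma> / 2) |u \<sigma>|\<close>.
\<close>

lemma trajectory_square_integrable:
  assumes u: "admissible t u"
  shows "integrable (lebesgue_on {t..}) (\<lambda>\<tau>. exp (- lam * \<tau>) * (norm (traj t z u \<tau>))\<^sup>2)"
proof -
  let ?M = "lebesgue_on {t..}"
  define e where "e = (lam - 2 * \<omega>) / 2"
  have e: "e > 0" using lam_gt by (simp add: e_def)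
  define r where "r \<sigma> = exp (- lam * \<sigma> / 2) * norm (u \<sigma>)" for \<sigma>
  have r: "exp (- e * (\<tau> - \<sigma>)) * r \<sigma> = exp (- lam * \<tau> / 2) * (exp (\<omega> * (\<tau> - \<sigma>)) * norm (u \<sigma>))" for \<tau> \<sigma>
    by (simp add: r_def e_def field_simps flip: exp_add)
  have r1: "integrable (lebesgue_on {t..\<tau>}) (\<lambda>\<sigma>. exp (- e * (\<tau> - \<sigma>)) * r \<sigma>)" for \<tau>
    unfolding r by (rule integrable_mult_right[OF trajectory_integrand(3)[OF u]])
  have "(r \<sigma>)\<^sup>2 = exp (- lam * \<sigma>) * (norm (u \<sigma>))\<^sup>2" for \<sigma>
    by (simp add: r_def power_mult_distrib flip: exp_double)
  then have r2: "integrable ?M (\<lambda>\<sigma>. (r \<sigma>)\<^sup>2)"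
    using u by (simp add: admissible_def)
  obtain J where J: "J \<in> borel_measurable ?M" "(\<integral>\<^sup>+\<tau>. J \<tau> \<partial>?M) < \<infinity>"
    "\<And>\<tau>. \<tau> \<ge> t \<Longrightarrow> ennreal ((LINT \<sigma>|lebesgue_on {t..\<tau>}. exp (- e * (\<tau> - \<sigma>)) * r \<sigma>)\<^sup>2) \<le> J \<tau>"
    by (rule exponential_convolution_L2[OF e _ r1 r2]) (auto simp: r_def)
  define c where "c = exp (- 2 * \<omega> * t) * (norm z)\<^sup>2"
  have le: "ennreal (exp (- lam * \<tau>) * (norm (traj t z u \<tau>))\<^sup>2)
      \<le> ennreal (2 * c * exp (- (2 * e) * \<tau>)) + ennreal (2 * (norm B)\<^sup>2) * J \<tau>" if \<tau>: "\<tau> \<ge> t" for \<tau>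
  proof -
    define I where "I = (LINT \<sigma>|lebesgue_on {t..\<tau>}. exp (- e * (\<tau> - \<sigma>)) * r \<sigma>)"
    have I: "I = exp (- lam * \<tau> / 2) * (LINT \<sigma>|lebesgue_on {t..\<tau>}. exp (\<omega> * (\<tau> - \<sigma>)) * norm (u \<sigma>))"
      unfolding I_def r by simp
    have "norm (traj t z u \<tau>) \<le> exp (\<omega> * (\<tau> - t)) * norm z +
        norm B * (LINT \<sigma>|lebesgue_on {t..\<tau>}. exp (\<omega> * (\<tau> - \<sigma>)) * norm (u \<sigma>))"
      unfolding trajectory_def using \<tau>
      by (intro order_trans[OF norm_triangle_ineq] add_mono growth trajectory_integrand(4)[OF u]) auto
    from mult_left_mono[OF this, of "exp (- lam * \<tau> / 2)"]
    have "exp (- lam * \<tau> / 2) * norm (traj t z u \<tau>) \<le> exp (- lam * \<tau> / 2) * (exp (\<omega> * (\<tau> - t)) * norm z) + norm B * I"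
      unfolding I by (simp add: algebra_simps)
    then have "(exp (- lam * \<tau> / 2) * norm (traj t z u \<tau>))\<^sup>2 \<le>
       (exp (- lam * \<tau> / 2) * (exp (\<omega> * (\<tau> - t)) * norm z) + norm B * I)\<^sup>2"
      by (rule power_mono) simp
    also have "\<dots> \<le> 2 * (exp (- lam * \<tau> / 2) * (exp (\<omega> * (\<tau> - t)) * norm z))\<^sup>2 + 2 * (norm B * I)\<^sup>2"
    proof -
      have "(x + y)\<^sup>2 \<le> 2 * x\<^sup>2 + 2 * y\<^sup>2" for x y :: real
      proof -
        have "2 * x\<^sup>2 + 2 * y\<^sup>2 = (x + y)\<^sup>2 + (x - y)\<^sup>2" by (simp add: power2_eq_square algebra_simps)
        then show ?thesis using zero_le_power2[of "x - y"] by linarith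
      qed
      then show ?thesis .
    qed
    also have "(exp (- lam * \<tau> / 2) * (exp (\<omega> * (\<tau> - t)) * norm z))\<^sup>2 = c * exp (- (2 * e) * \<tau>)"
      by (simp add: c_def e_def power_mult_distrib field_simps flip: exp_double exp_add)
    also have "(exp (- lam * \<tau> / 2) * norm (traj t z u \<tau>))\<^sup>2 = exp (- lam * \<tau>) * (norm (traj t z u \<tau>))\<^sup>2"
      by (simp add: power_mult_distrib flip: exp_double)
    finally have "exp (- lam * \<tau>) * (norm (traj t z u \<tau>))\<^sup>2 \<le> 2 * c * exp (- (2 * e) * \<tau>) + (2 * (norm B)\<^sup>2) * I\<^sup>2"
      by (simp add: power_mult_distrib)
    then have "ennreal (exp (- lam * \<tau>) * (norm (traj t z u \<tau>))\<^sup>2) \<le> ennreal (2 * c * exp (- (2 * e) * \<tau>) + (2 * (norm B)\<^sup>2) * I\<^sup>2)"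
      by (rule ennreal_leI)
    also have "\<dots> = ennreal (2 * c * exp (- (2 * e) * \<tau>)) + ennreal (2 * (norm B)\<^sup>2) * ennreal (I\<^sup>2)"
      by (simp add: ennreal_plus c_def ennreal_mult'')
    also have "\<dots> \<le> ennreal (2 * c * exp (- (2 * e) * \<tau>)) + ennreal (2 * (norm B)\<^sup>2) * J \<tau>"
      using J(3)[OF \<tau>] unfolding I_def by (intro add_mono mult_left_mono) auto
    finally show ?thesis .
  qed
  have m: "(\<lambda>\<tau>. exp (- lam * \<tau>) * (norm (traj t z u \<tau>))\<^sup>2) \<in> borel_measurable ?M"
    using strongly_measurable_imp_borel_measurable[OF complete_measure_lebesgue_on trajectory_strongly_measurable[OF u]]
    by (intro borel_measurable_times[OF borel_measurable_lebesgue_onI] borel_measurable_power borel_measurable_norm) auto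
  have i: "integrable ?M (\<lambda>\<tau>. 2 * c * exp (- (2 * e) * \<tau>))"
    using integrable_exp_halfline(1)[of "2 * e" t] e by (intro integrable_mult_right) simp
  have "(\<integral>\<^sup>+\<tau>. ennreal (norm (exp (- lam * \<tau>) * (norm (traj t z u \<tau>))\<^sup>2)) \<partial>?M) \<le>
      (\<integral>\<^sup>+\<tau>. ennreal (2 * c * exp (- (2 * e) * \<tau>)) + ennreal (2 * (norm B)\<^sup>2) * J \<tau> \<partial>?M)"
    using le by (intro nn_integral_mono) (simp add: abs_mult)
  also have "\<dots> = (\<integral>\<^sup>+\<tau>. ennreal (2 * c * exp (- (2 * e) * \<tau>)) \<partial>?M) + ennreal (2 * (norm B)\<^sup>2) * (\<integral>\<^sup>+\<tau>. J \<tau> \<partial>?M)"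
    using i J(1) by (subst nn_integral_add) (auto simp: nn_integral_cmult)
  also have "\<dots> < \<infinity>"
    using J(2) nn_integral_eq_integral[OF i] by (simp add: c_def ennreal_mult_less_top)
  finally show ?thesis
    using m by (simp add: integrable_iff_bounded)
qed

end

section \<open>Integrals of extended-real cost densities\<close>

text \<open>
  With \<open>f = g + H\<close>, positive and negative parts satisfy \<open>f\<^sup>+ + g\<^sup>- = g\<^sup>+ + H + f\<^sup>-\<close> at every point, also
  where \<open>H\<close> is infinite. Integrate, and use that \<open>f\<^sup>- \<le> g\<^sup>-\<close> has a finite integral.
\<close>

lemma ereal_integral_add_nonneg:
  fixes g :: "'a \<Rightarrow> real" and H :: "'a \<Rightarrow> ereal"
  assumes g: "integrable M g" and H: "H \<in> borel_measurable M" "\<And>x. H x \<ge> 0"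
  shows "ereal_integral M (\<lambda>x. ereal (g x) + H x) =
    ereal (LINT x|M. g x) + enn2ereal (\<integral>\<^sup>+x. e2ennreal (H x) \<partial>M)"
proof -
  let ?f = "\<lambda>x. ereal (g x) + H x"
  have [measurable]: "g \<in> borel_measurable M" "H \<in> borel_measurable M"
    using g H by auto
  define P where "P = (\<integral>\<^sup>+x. e2ennreal (?f x) \<partial>M)"
  define N where "N = (\<integral>\<^sup>+x. e2ennreal (- ?f x) \<partial>M)"
  define gp where "gp = (\<integral>\<^sup>+x. ennreal (g x) \<partial>M)"
  define gn where "gn = (\<integral>\<^sup>+x. ennreal (- g x) \<partial>M)"
  define K where "K = (\<integral>\<^sup>+x. e2ennreal (H x) \<partial>M)"
  \<comment> \<open>Each part is written on the side where it carries a plus sign, so no difference of infinite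
    values appears.\<close>
  have pt: "e2ennreal (?f x) + ennreal (- g x) = ennreal (g x) + e2ennreal (H x) + e2ennreal (- ?f x)" for x
  proof (cases "H x")
    case (real h)
    then have h: "h \<ge> 0" using H(2)[of x] by simp
    have m: "ennreal y = ennreal (max 0 y)" for y
      by (cases "y \<ge> 0") (auto simp: ennreal_neg)
    have "ennreal (g x + h) + ennreal (- g x) = ennreal (g x) + ennreal h + ennreal (- (g x + h))"
      unfolding m[of "g x + h"] m[of "- g x"] m[of "g x"] m[of "- (g x + h)"]
      using h by (auto simp: max_def simp flip: ennreal_plus)
    then show ?thesis
      by (simp add: real e2ennreal_ereal)
  next
    case PInf
    then show ?thesis by (simp add: e2ennreal_infty)
  next
    case MInf
    then show ?thesis using H(2)[of x] by simp
  qed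
  have "P + gn = (\<integral>\<^sup>+x. e2ennreal (?f x) + ennreal (- g x) \<partial>M)"
    unfolding P_def gn_def by (rule nn_integral_add[symmetric]) measurable
  also have "\<dots> = (\<integral>\<^sup>+x. ennreal (g x) + e2ennreal (H x) + e2ennreal (- ?f x) \<partial>M)"
    by (simp only: pt)
  also have "\<dots> = gp + K + N"
    unfolding gp_def K_def N_def by (subst nn_integral_add, measurable)+
  finally have eq: "P + gn = gp + K + N" .
  have fin: "gp < \<infinity>" "gn < \<infinity>"
    using g unfolding real_integrable_def gp_def gn_def by (auto simp: less_top)
  have "N \<le> gn"
    unfolding N_def gn_def
  proof (rule nn_integral_mono)
    fix x
    have "- ?f x \<le> ereal (- g x)"
      using H(2)[of x] by (cases "H x") auto
    then show "e2ennreal (- ?f x) \<le> ennreal (- g x)"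
      using e2ennreal_mono by (fastforce simp flip: e2ennreal_ereal)
  qed
  then have finN: "N < \<infinity>" using fin by (meson le_less_trans)
  obtain rp where rp: "gp = ennreal rp" "rp \<ge> 0" using fin by (cases gp) auto
  obtain rn where rn: "gn = ennreal rn" "rn \<ge> 0" using fin by (cases gn) auto
  obtain n where n: "N = ennreal n" "n \<ge> 0" using finN by (cases N) auto
  have "(LINT x|M. g x) = rp - rn"
    using real_lebesgue_integral_def[OF g] rp rn by (simp add: gp_def gn_def)
  moreover have "enn2ereal P - enn2ereal N = ereal (rp - rn) + enn2ereal K"
  proof (cases K)
    case (real k)
    then have "P + gn = ennreal (rp + k + n)"
      using eq rp rn n by simp
    then have "P \<noteq> \<infinity>"
      by (metis ennreal_add_eq_top ennreal_neq_top infinity_ennreal_def)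
    then obtain q where q: "P = ennreal q" "q \<ge> 0" by (cases P) auto
    have "ennreal (q + rn) = ennreal (rp + k + n)"
      using eq q rn rp real n by (simp add: ennreal_plus)
    then have "q + rn = rp + k + n"
      using q rn rp real n by (subst (asm) ennreal_inj) auto
    then show ?thesis
      using q rn rp real n by (simp add: enn2ereal_ennreal)
  next
    case top
    then have "P = top" using eq rn by (auto simp: ennreal_add_eq_top)
    then show ?thesis using top n by (simp add: enn2ereal_ennreal)
  qed
  ultimately show ?thesis
    by (simp add: ereal_integral_def P_def N_def K_def)
qed

section \<open>The control problem\<close>

lemma borel_measurable_lower_semicontinuous:
  fixes h :: "'a::topological_space \<Rightarrow> ereal"
  assumes "lower_semicontinuous h"
  shows "h \<in> borel_measurable borel"
  unfolding borel_measurable_ereal_iff_Ioi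
proof
  fix c
  have "open (h -` {c<..})"
  proof (subst open_subopen, intro ballI)
    fix x assume x: "x \<in> h -` {c<..}"
    then have "c < Liminf (at x) h"
      using assms by (auto simp: lower_semicontinuous_def intro: less_le_trans)
    then have "\<forall>\<^sub>F y in at x. c < h y"
      by (rule less_LiminfD)
    then have "\<forall>\<^sub>F y in nhds x. c < h y"
      using x by (simp add: eventually_nhds_conv_at)
    then obtain T where "open T" "x \<in> T" "\<forall>y\<in>T. c < h y"
      by (auto simp: eventually_nhds)
    then show "\<exists>T. open T \<and> x \<in> T \<and> T \<subseteq> h -` {c<..}"
      by (intro exI[of _ T]) auto
  qed
  then show "h -` {c<..} \<inter> space borel \<in> sets borel"
    by simp
qed

lemma has_derivative_quadratic_remainder:
  fixes f :: "'a::real_normed_vector \<Rightarrow> real"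
  assumes P: "bounded_linear P" and C: "\<And>z. \<bar>f z - f x - P (z - x)\<bar> \<le> C * (norm (z - x))\<^sup>2"
  shows "(f has_derivative P) (at x)"
  unfolding has_derivative_at
proof (intro conjI P)
  show "(\<lambda>h. norm (f (x + h) - f x - P h) / norm h) \<midarrow>0\<rightarrow> 0"
  proof (rule Lim_null_comparison)
    show "\<forall>\<^sub>F h in at 0. norm (norm (f (x + h) - f x - P h) / norm h) \<le> C * norm h"
    proof (rule eventually_at_filter[THEN iffD2], rule always_eventually, intro allI impI)
      fix h :: 'a assume "h \<noteq> 0"
      then show "norm (norm (f (x + h) - f x - P h) / norm h) \<le> C * norm h"
        using C[of "x + h"] by (simp add: divide_le_eq power2_eq_square mult.assoc)
    qed
    have "(\<lambda>h::'a. C * norm h) \<midarrow>0\<rightarrow> C * norm (0::'a)"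
      by (intro tendsto_intros)
    then show "(\<lambda>h::'a. C * norm h) \<midarrow>0\<rightarrow> 0" by simp
  qed
qed

lemma weighted_norm_powr:
  fixes z :: "'u::real_normed_vector"
  assumes "p > 0"
  shows "norm (exp (- lam * \<tau> / p) *\<^sub>R z) powr p = exp (- lam * \<tau>) * norm z powr p"
  using assms by (simp add: powr_mult exp_powr_real)

lemma Lp_weighted_iff:
  assumes "p > 0"
  shows "u \<in> Lp_weighted p lam t \<longleftrightarrow> strongly_measurable (lebesgue_on {t..}) u \<and>
    integrable (lebesgue_on {t..}) (\<lambda>\<tau>. exp (- lam * \<tau>) * norm (u \<tau>) powr p)"
  unfolding Lp_weighted_def mem_Collect_eq weighted_norm_powr[OF assms] ..

lemma Lp_weighted_mono:
  assumes "p > 0" "u \<in> Lp_weighted p lam t" "t \<le> c"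
  shows "u \<in> Lp_weighted p lam c"
  using assms(2,3) unfolding Lp_weighted_iff[OF assms(1)]
  by (auto intro: strongly_measurable_lebesgue_on_subset[of "{t..}"] lebesgue_on_integrable_subset[of "{t..}"])

lemma weighted_powr_measurable:
  fixes u :: "real \<Rightarrow> 'u::real_normed_vector"
  assumes "strongly_measurable (lebesgue_on {t..}) u"
  shows "(\<lambda>\<tau>. exp (- lam * \<tau>) * norm (u \<tau>) powr p) \<in> borel_measurable (lebesgue_on {t..})"
proof -
  have "u \<in> borel_measurable (lebesgue_on {t..})"
    by (rule strongly_measurable_imp_borel_measurable[OF complete_measure_lebesgue_on assms]) simp
  then have "(\<lambda>\<tau>. norm (u \<tau>) powr p) \<in> borel_measurable (lebesgue_on {t..})"
    by simp
  then show ?thesis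
    by (intro borel_measurable_times[OF borel_measurable_lebesgue_onI]) auto
qed

lemma Lp_weighted_concat:
  fixes u v :: "real \<Rightarrow> 'u::real_normed_vector"
  assumes p: "p > 0" and u: "u \<in> Lp_weighted p lam t" and v: "v \<in> Lp_weighted p lam c" and "t \<le> c"
  shows "(\<lambda>s. if s < c then u s else v s) \<in> Lp_weighted p lam t"
proof -
  let ?w = "\<lambda>s. if s < c then u s else v s"
  let ?q = "\<lambda>u \<tau>. exp (- lam * \<tau>) * norm (u \<tau> :: 'u) powr p"
  have w: "strongly_measurable (lebesgue_on {t..}) ?w"
    using u v \<open>t \<le> c\<close> unfolding Lp_weighted_iff[OF p] by (intro strongly_measurable_concat) auto
  have iu: "integrable lebesgue (\<lambda>s. indicator {t..} s *\<^sub>R ?q u s)"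
    using u unfolding Lp_weighted_iff[OF p] by (simp add: integrable_restrict_space)
  have iv: "integrable lebesgue (\<lambda>s. indicator {c..} s *\<^sub>R ?q v s)"
    using v unfolding Lp_weighted_iff[OF p] by (simp add: integrable_restrict_space)
  have "integrable lebesgue (\<lambda>s. indicator {t..} s *\<^sub>R ?q ?w s)"
  proof (rule Bochner_Integration.integrable_bound[OF Bochner_Integration.integrable_add[OF iu iv]])
    show "(\<lambda>s. indicator {t..} s *\<^sub>R ?q ?w s) \<in> borel_measurable lebesgue"
      using weighted_powr_measurable[OF w, of lam p] by (subst borel_measurable_restrict_space_iff[symmetric]) auto
    show "AE s in lebesgue. norm (indicator {t..} s *\<^sub>R ?q ?w s)
        \<le> norm (indicator {t..} s *\<^sub>R ?q u s + indicator {c..} s *\<^sub>R ?q v s)"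
      by (intro AE_I2) (auto simp: indicator_def)
  qed
  with w show ?thesis
    unfolding Lp_weighted_iff[OF p] by (simp add: integrable_restrict_space)
qed

lemma Lp_weighted_midpoint:
  fixes u v :: "real \<Rightarrow> 'u::real_normed_vector"
  assumes p: "p > 0" and u: "u \<in> Lp_weighted p lam t" and v: "v \<in> Lp_weighted p lam t"
  shows "(\<lambda>s. (1/2) *\<^sub>R u s + (1/2) *\<^sub>R v s) \<in> Lp_weighted p lam t"
proof -
  let ?M = "lebesgue_on {t..}" and ?w = "\<lambda>s. (1/2) *\<^sub>R u s + (1/2) *\<^sub>R v s"
  have w: "strongly_measurable ?M ?w"
    using u v unfolding Lp_weighted_iff[OF p]
    by (intro strongly_measurable_add strongly_measurable_scaleR[OF strongly_measurable_simple]) auto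
  have le: "norm (?w s) powr p \<le> norm (u s) powr p + norm (v s) powr p" for s
  proof -
    have "norm (?w s) \<le> (norm (u s) + norm (v s)) / 2"
      using norm_triangle_ineq[of "(1/2) *\<^sub>R u s" "(1/2) *\<^sub>R v s"] by simp
    also have "\<dots> \<le> max (norm (u s)) (norm (v s))"
      by simp
    finally have "norm (?w s) powr p \<le> max (norm (u s)) (norm (v s)) powr p"
      using p by (intro powr_mono2) auto
    also have "\<dots> \<le> norm (u s) powr p + norm (v s) powr p"
      by (simp add: max_def)
    finally show ?thesis .
  qed
  have "integrable ?M (\<lambda>s. exp (- lam * s) * norm (?w s) powr p)"
  proof (rule Bochner_Integration.integrable_bound)
    show "integrable ?M (\<lambda>s. exp (- lam * s) * norm (u s) powr p + exp (- lam * s) * norm (v s) powr p)"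
      using u v unfolding Lp_weighted_iff[OF p] by auto
    show "AE s in ?M. norm (exp (- lam * s) * norm (?w s) powr p)
        \<le> norm (exp (- lam * s) * norm (u s) powr p + exp (- lam * s) * norm (v s) powr p)"
    proof (rule AE_I2)
      fix s
      show "norm (exp (- lam * s) * norm (?w s) powr p)
        \<le> norm (exp (- lam * s) * norm (u s) powr p + exp (- lam * s) * norm (v s) powr p)"
        using mult_left_mono[OF le[of s], of "exp (- lam * s)"]
        by (simp add: abs_mult distrib_left del: scaleR_half_double)
    qed
  qed (rule weighted_powr_measurable[OF w])
  with w show ?thesis
    unfolding Lp_weighted_iff[OF p] by simp
qed

lemma Lp_weighted_const:
  assumes "p > 0" "lam > 0"
  shows "(\<lambda>s. c) \<in> Lp_weighted p lam t"
  unfolding Lp_weighted_iff[OF assms(1)]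
  using integrable_exp_halfline(1)[OF assms(2), of t]
  by (auto intro!: strongly_measurable_simple)

lemma Lp_weighted_translate:
  fixes u :: "real \<Rightarrow> 'u::real_normed_vector"
  assumes p: "p > 0" and u: "u \<in> Lp_weighted p lam (t + r)"
  shows "(\<lambda>s. u (s + r)) \<in> Lp_weighted p lam t"
proof -
  have im: "(\<lambda>s. s + r) ` {t..} = {t + r..}"
    using image_add_atLeast[of r t] by (simp add: add.commute[of r] image_def)
  note T = lebesgue_on_translate[of "{t..}" r, unfolded im, simplified]
  have "integrable (distr (lebesgue_on {t..}) (lebesgue_on {t + r..}) (\<lambda>s. s + r)) (\<lambda>\<tau>. exp (- lam * \<tau>) * norm (u \<tau>) powr p)"
    unfolding T(2) using u unfolding Lp_weighted_iff[OF p] by blast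
  from integrable_mult_right[OF integrable_distr[OF T(1) this], of "exp (lam * r)"]
  have i: "integrable (lebesgue_on {t..}) (\<lambda>s. exp (lam * r) * (exp (- lam * (s + r)) * norm (u (s + r)) powr p))" .
  have eq: "exp (lam * r) * (exp (- lam * (s + r)) * norm (u (s + r)) powr p) = exp (- lam * s) * norm (u (s + r)) powr p" for s
  proof -
    have "exp (lam * r) * exp (- lam * (s + r)) = exp (- lam * s)"
      by (simp add: distrib_left flip: exp_add)
    then show ?thesis
      by (simp only: mult.assoc[symmetric])
  qed
  have "strongly_measurable (lebesgue_on {t..}) (\<lambda>s. u (s + r))"
    using strongly_measurable_distr[OF T(1,2)] u unfolding Lp_weighted_iff[OF p] by blast
  with i show ?thesis
    unfolding Lp_weighted_iff[OF p] eq by blast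
qed

text \<open>
  That the conjugate of \<open>h0\<close> vanishes at \<open>0\<close> means \<open>inf h0 = 0\<close>; it is used in the form of the two
  assumptions \<open>h0_nonneg\<close> and \<open>h0_proper\<close>.
\<close>

locale control_problem = controlled_system S B \<omega> lam
  for S :: "real \<Rightarrow> 'w::{real_inner, banach} \<Rightarrow>\<^sub>L 'w"
    and B :: "'u::{real_inner, banach} \<Rightarrow>\<^sub>L 'w" and \<omega> lam :: real +
  fixes pair :: "'v::{real_inner, banach} \<Rightarrow> 'w \<Rightarrow> real" and S0 :: "real \<Rightarrow> 'v \<Rightarrow>\<^sub>L 'v"
    and g0 :: "'w \<Rightarrow> real" and h0 :: "'u \<Rightarrow> ereal" and p :: real
  assumes duality: "dual_pairing pair"
    and adjoint: "adjoint_semigroup pair S S0"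
    and g0: "g0 \<in> Sigma0"
    and h0_convex: "ereal_convex h0"
    and h0_lsc: "lower_semicontinuous h0"
    and h0_nonneg: "h0 c \<ge> 0"
    and h0_proper: "\<exists>c. h0 c \<noteq> \<infinity>"
    and p: "p \<ge> 2"
begin

abbreviation Lp :: "real \<Rightarrow> (real \<Rightarrow> 'u) set" where "Lp \<equiv> Lp_weighted p lam"
abbreviation "J \<equiv> cost S B g0 h0 lam"
abbreviation "\<Psi> \<equiv> value_function S B g0 h0 p lam"
abbreviation "optimal \<equiv> optimal_couple S B g0 h0 p lam"
abbreviation "grad \<equiv> dual_deriv pair g0"

lemma p_pos: "p > 0" using p by simp

sublocale pairing: bounded_bilinear pair
  using duality by (simp add: dual_pairing_def)

lemma onorm_pair: "onorm (pair v) = norm v"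
  using duality by (simp add: dual_pairing_def)

lemma Lp_admissible:
  assumes u: "u \<in> Lp t"
  shows "admissible t u"
proof -
  have um: "strongly_measurable (lebesgue_on {t..}) u"
    using u unfolding Lp_weighted_iff[OF p_pos] by blast
  have sq: "n\<^sup>2 \<le> 1 + n powr p" if "n \<ge> 0" for n :: real
  proof (cases "n \<le> 1")
    case True
    then have "n\<^sup>2 \<le> 1" using that by (simp add: power_le_one)
    then show ?thesis by (simp add: add_increasing2)
  next
    case False
    then have "n\<^sup>2 = n powr 2" by simp
    also have "\<dots> \<le> n powr p" using False p by (intro powr_mono) auto
    finally show ?thesis by simp
  qed
  have "integrable (lebesgue_on {t..}) (\<lambda>\<sigma>. exp (- lam * \<sigma>) * (norm (u \<sigma>))\<^sup>2)"
  proof (rule Bochner_Integration.integrable_bound)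
    show "integrable (lebesgue_on {t..}) (\<lambda>\<sigma>. exp (- lam * \<sigma>) + exp (- lam * \<sigma>) * norm (u \<sigma>) powr p)"
      using u integrable_exp_halfline(1)[OF lam_pos, of t] unfolding Lp_weighted_iff[OF p_pos] by auto
    have "u \<in> borel_measurable (lebesgue_on {t..})"
      by (rule strongly_measurable_imp_borel_measurable[OF complete_measure_lebesgue_on um]) simp
    then show "(\<lambda>\<sigma>. exp (- lam * \<sigma>) * (norm (u \<sigma>))\<^sup>2) \<in> borel_measurable (lebesgue_on {t..})"
      by (intro borel_measurable_times[OF borel_measurable_lebesgue_onI] borel_measurable_power) auto
    show "AE \<sigma> in lebesgue_on {t..}. norm (exp (- lam * \<sigma>) * (norm (u \<sigma>))\<^sup>2)
        \<le> norm (exp (- lam * \<sigma>) + exp (- lam * \<sigma>) * norm (u \<sigma>) powr p)"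
    proof (rule AE_I2)
      fix \<sigma>
      show "norm (exp (- lam * \<sigma>) * (norm (u \<sigma>))\<^sup>2) \<le> norm (exp (- lam * \<sigma>) + exp (- lam * \<sigma>) * norm (u \<sigma>) powr p)"
        using mult_left_mono[OF sq[of "norm (u \<sigma>)"], of "exp (- lam * \<sigma>)"]
        by (simp add: abs_mult distrib_left)
    qed
  qed
  with um show ?thesis
    by (simp add: admissible_def)
qed

section \<open>The running cost of the state\<close>

lemma g0_convex: "g0 ((1/2) *\<^sub>R y + (1/2) *\<^sub>R z) \<le> (1/2) * g0 y + (1/2) * g0 z"
proof -
  have "convex_on UNIV g0" using g0 by (simp add: Sigma0_def)
  from convex_onD[OF this, of "1/2" y z] show ?thesis by simp
qed

lemma g0_growth: obtains C where "C \<ge> 0" "\<And>y. \<bar>g0 y\<bar> \<le> C * (1 + (norm y)\<^sup>2)"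
proof -
  have "bdd_above (range (\<lambda>y. \<bar>g0 y\<bar> / (1 + norm y ^ 2)))"
    using g0 by (simp add: Sigma0_def growth_class_def)
  then obtain C where C: "\<And>y. \<bar>g0 y\<bar> / (1 + (norm y)\<^sup>2) \<le> C"
    by (auto simp: bdd_above_def)
  have pos: "1 + (norm y)\<^sup>2 > 0" for y :: 'w
    by (simp add: add_pos_nonneg)
  have "\<bar>g0 y\<bar> \<le> C * (1 + (norm y)\<^sup>2)" for y
    using C[of y] pos[of y] by (simp add: pos_divide_le_eq)
  moreover have "C \<ge> 0"
    by (rule order_trans[OF _ C[of 0]]) simp
  ultimately show thesis using that by blast
qed

lemma pair_inject: "pair v = pair w \<Longrightarrow> v = w"
proof -
  assume "pair v = pair w"
  then have "pair (v - w) = (\<lambda>_. 0)"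
    by (auto simp: fun_eq_iff pairing.diff_left)
  then have "norm (v - w) = 0"
    using onorm_pair[of "v - w"] by (simp add: onorm_zero)
  then show ?thesis by simp
qed

text \<open>
  The pairing is isometric onto the dual space, so the gradient inherits the Lipschitz constant of the
  derivative.
\<close>

lemma grad:
  obtains L where "L \<ge> 0" "\<And>z. (g0 has_derivative pair (grad z)) (at z)"
    "\<And>y z. norm (grad y - grad z) \<le> L * norm (y - z)"
proof -
  obtain f' L where f': "\<And>x. (g0 has_derivative blinfun_apply (f' x)) (at x)" and L: "L-lipschitz_on UNIV f'"
    using g0 by (auto simp: Sigma0_def C1_Lip_def)
  have ex: "\<exists>v. blinfun_apply (f' z) = pair v" for z
    using duality blinfun.bounded_linear_right[of "f' z"] unfolding dual_pairing_def by blast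
  have grad: "(g0 has_derivative pair (grad z)) (at z)" for z
  proof -
    obtain v where v: "blinfun_apply (f' z) = pair v" using ex by blast
    have gv: "(g0 has_derivative pair v) (at z)" using f'[of z] v by simp
    have "grad z = v"
      unfolding dual_deriv_def
    proof (rule the_equality)
      show "(g0 has_derivative pair v) (at z)" by (rule gv)
      show "w = v" if "(g0 has_derivative pair w) (at z)" for w
        by (rule pair_inject[OF has_derivative_unique[OF that gv]])
    qed
    then show ?thesis using gv by simp
  qed
  have eq: "pair (grad z) = blinfun_apply (f' z)" for z
    by (rule has_derivative_unique[OF grad f'])
  have "norm (grad y - grad z) \<le> L * norm (y - z)" for y z
  proof -
    have "pair (grad y - grad z) = blinfun_apply (f' y - f' z)"
      by (simp add: fun_eq_iff pairing.diff_left eq blinfun.diff_left)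
    then have "norm (grad y - grad z) = norm (f' y - f' z)"
      using onorm_pair[of "grad y - grad z"] by (simp add: norm_blinfun.rep_eq)
    also have "\<dots> \<le> L * norm (y - z)"
      using lipschitz_onD[OF L] by (simp add: dist_norm)
    finally show ?thesis .
  qed
  moreover have "L \<ge> 0" using lipschitz_on_nonneg[OF L] .
  ultimately show thesis using that grad by blast
qed

text \<open>
  The mean value inequality on the ball of radius \<open>|h|\<close> about \<open>y\<close>, for \<open>g0\<close> minus its linearisation at \<open>y\<close>.
\<close>

lemma g0_quadratic_remainder:
  obtains L where "L \<ge> 0" "\<And>y h. \<bar>g0 (y + h) - g0 y - pair (grad y) h\<bar> \<le> L * (norm h)\<^sup>2"
proof -
  obtain L where L: "L \<ge> 0" "\<And>z. (g0 has_derivative pair (grad z)) (at z)"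
    "\<And>y z. norm (grad y - grad z) \<le> L * norm (y - z)"
    by (rule grad) blast
  have "\<bar>g0 (y + h) - g0 y - pair (grad y) h\<bar> \<le> L * (norm h)\<^sup>2" for y h
  proof -
    define k where "k z = g0 z - pair (grad y) z" for z
    have "norm (k (y + h) - k y) \<le> (L * norm h) * norm (y + h - y)"
    proof (rule differentiable_bound[where S = "cball y (norm h)" and f' = "\<lambda>z. pair (grad z - grad y)"])
      fix z assume z: "z \<in> cball y (norm h)"
      have "(k has_derivative (\<lambda>d. pair (grad z) d - pair (grad y) d)) (at z)"
        unfolding k_def by (intro has_derivative_diff L(2) bounded_linear_imp_has_derivative pairing.bounded_linear_right)
      moreover have "(\<lambda>d. pair (grad z) d - pair (grad y) d) = pair (grad z - grad y)"
        by (simp add: fun_eq_iff pairing.diff_left)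
      ultimately show "(k has_derivative pair (grad z - grad y)) (at z within cball y (norm h))"
        by (simp add: has_derivative_at_withinI)
      have "norm (z - y) \<le> norm h"
        using z by (simp add: dist_norm norm_minus_commute)
      then show "onorm (pair (grad z - grad y)) \<le> L * norm h"
        unfolding onorm_pair using L(3)[of z y] mult_left_mono[OF _ L(1)] by (meson order_trans)
    qed (auto simp: dist_norm)
    then show ?thesis
      by (simp add: k_def pairing.add_right power2_eq_square algebra_simps)
  qed
  with L(1) show thesis using that by blast
qed

lemma g0_continuous: "continuous_on UNIV g0"
proof (rule grad)
  fix L :: real assume "\<And>z. (g0 has_derivative pair (grad z)) (at z)"
  then show ?thesis
    by (intro continuous_at_imp_continuous_on ballI has_derivative_continuous) blast
qed

lemma grad_continuous: "continuous_on UNIV grad"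
proof (rule grad)
  fix L :: real assume "L \<ge> 0" "\<And>y z. norm (grad y - grad z) \<le> L * norm (y - z)"
  then have "L-lipschitz_on UNIV grad"
    by (intro lipschitz_onI) (auto simp: dist_norm)
  then show ?thesis
    by (rule lipschitz_on_continuous_on)
qed

definition state_cost :: "real \<Rightarrow> 'w \<Rightarrow> (real \<Rightarrow> 'u) \<Rightarrow> real" where
  "state_cost t z u = (LINT \<tau>|lebesgue_on {t..}. exp (- lam * \<tau>) * g0 (traj t z u \<tau>))"

lemma state_cost_integrable:
  assumes u: "admissible t u"
  shows "integrable (lebesgue_on {t..}) (\<lambda>\<tau>. exp (- lam * \<tau>) * g0 (traj t z u \<tau>))"
proof -
  obtain C where C: "C \<ge> 0" "\<And>y. \<bar>g0 y\<bar> \<le> C * (1 + (norm y)\<^sup>2)"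
    by (rule g0_growth) blast
  show ?thesis
  proof (rule Bochner_Integration.integrable_bound)
    show "integrable (lebesgue_on {t..}) (\<lambda>\<tau>. C * (exp (- lam * \<tau>) + exp (- lam * \<tau>) * (norm (traj t z u \<tau>))\<^sup>2))"
      by (intro integrable_mult_right Bochner_Integration.integrable_add integrable_exp_halfline(1)
          lam_pos trajectory_square_integrable u)
    have "(\<lambda>\<tau>. g0 (traj t z u \<tau>)) \<in> borel_measurable (lebesgue_on {t..})"
      by (rule strongly_measurable_imp_borel_measurable[OF complete_measure_lebesgue_on
            strongly_measurable_compose[OF trajectory_strongly_measurable[OF u] g0_continuous]]) simp
    then show "(\<lambda>\<tau>. exp (- lam * \<tau>) * g0 (traj t z u \<tau>)) \<in> borel_measurable (lebesgue_on {t..})"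
      by (intro borel_measurable_times[OF borel_measurable_lebesgue_onI]) auto
    show "AE \<tau> in lebesgue_on {t..}. norm (exp (- lam * \<tau>) * g0 (traj t z u \<tau>))
      \<le> norm (C * (exp (- lam * \<tau>) + exp (- lam * \<tau>) * (norm (traj t z u \<tau>))\<^sup>2))"
    proof (rule AE_I2)
      fix \<tau>
      have "exp (- lam * \<tau>) * \<bar>g0 (traj t z u \<tau>)\<bar> \<le> exp (- lam * \<tau>) * (C * (1 + (norm (traj t z u \<tau>))\<^sup>2))"
        by (intro mult_left_mono C(2)) simp
      then show "norm (exp (- lam * \<tau>) * g0 (traj t z u \<tau>))
        \<le> norm (C * (exp (- lam * \<tau>) + exp (- lam * \<tau>) * (norm (traj t z u \<tau>))\<^sup>2))"
        using C(1) by (simp add: abs_mult algebra_simps)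
    qed
  qed
qed

lemma state_cost_midpoint:
  assumes u: "admissible t u" and v: "admissible t v"
  shows "state_cost t ((1/2) *\<^sub>R x + (1/2) *\<^sub>R z) (\<lambda>s. (1/2) *\<^sub>R u s + (1/2) *\<^sub>R v s)
    \<le> (1/2) * state_cost t x u + (1/2) * state_cost t z v"
proof -
  let ?M = "lebesgue_on {t..}"
  let ?gu = "\<lambda>\<tau>. exp (- lam * \<tau>) * g0 (traj t x u \<tau>)" and ?gv = "\<lambda>\<tau>. exp (- lam * \<tau>) * g0 (traj t z v \<tau>)"
  have "state_cost t ((1/2) *\<^sub>R x + (1/2) *\<^sub>R z) (\<lambda>s. (1/2) *\<^sub>R u s + (1/2) *\<^sub>R v s)
      \<le> (LINT \<tau>|?M. (1/2) * ?gu \<tau> + (1/2) * ?gv \<tau>)"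
    unfolding state_cost_def
  proof (rule integral_mono)
    show "integrable ?M (\<lambda>\<tau>. exp (- lam * \<tau>) * g0 (traj t ((1/2) *\<^sub>R x + (1/2) *\<^sub>R z) (\<lambda>s. (1/2) *\<^sub>R u s + (1/2) *\<^sub>R v s) \<tau>))"
      by (rule state_cost_integrable[OF admissible_midpoint[OF u v]])
    show "integrable ?M (\<lambda>\<tau>. (1/2) * ?gu \<tau> + (1/2) * ?gv \<tau>)"
      by (intro Bochner_Integration.integrable_add integrable_mult_right state_cost_integrable u v)
    fix \<tau>
    show "exp (- lam * \<tau>) * g0 (traj t ((1/2) *\<^sub>R x + (1/2) *\<^sub>R z) (\<lambda>s. (1/2) *\<^sub>R u s + (1/2) *\<^sub>R v s) \<tau>)
        \<le> (1/2) * ?gu \<tau> + (1/2) * ?gv \<tau>"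
      unfolding trajectory_midpoint[OF u v]
      using mult_left_mono[OF g0_convex[of "traj t x u \<tau>" "traj t z v \<tau>"], of "exp (- lam * \<tau>)"]
      by (simp add: algebra_simps)
  qed
  also have "\<dots> = (1/2) * state_cost t x u + (1/2) * state_cost t z v"
    unfolding state_cost_def
    by (simp only: integral_mult_right_zero Bochner_Integration.integral_add[OF
          integrable_mult_right[OF state_cost_integrable[OF u]] integrable_mult_right[OF state_cost_integrable[OF v]]])
  finally show ?thesis .
qed

section \<open>The running cost of the control\<close>

definition control_cost :: "real \<Rightarrow> (real \<Rightarrow> 'u) \<Rightarrow> ennreal" where
  "control_cost t u = (\<integral>\<^sup>+\<tau>. ennreal (exp (- lam * \<tau>)) * e2ennreal (h0 (u \<tau>)) \<partial>lebesgue_on {t..})"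

lemma control_cost_measurable:
  assumes u: "admissible t u"
  shows "(\<lambda>\<tau>. h0 (u \<tau>)) \<in> borel_measurable (lebesgue_on {t..})" (is ?h)
    and "(\<lambda>\<tau>. ennreal (exp (- lam * \<tau>)) * e2ennreal (h0 (u \<tau>))) \<in> borel_measurable (lebesgue_on {t..})"
      (is ?e)
proof -
  have "u \<in> borel_measurable (lebesgue_on {t..})"
    using u by (intro strongly_measurable_imp_borel_measurable complete_measure_lebesgue_on) (auto simp: admissible_def)
  then show h: ?h
    by (rule measurable_compose[OF _ borel_measurable_lower_semicontinuous[OF h0_lsc]])
  have "(\<lambda>\<tau>. exp (- lam * \<tau>)) \<in> borel_measurable (lebesgue_on {t..})"
    by (rule borel_measurable_lebesgue_onI) simp
  with h show ?e by measurable
qed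

text \<open>
  Separates a finite part, on which convexity and differentiation act, from a nonnegative part
  that does not depend on the initial state and may be infinite.
\<close>

lemma cost_eq:
  assumes u: "admissible t u"
  shows "J t z u = ereal (state_cost t z u) + enn2ereal (control_cost t u)"
proof -
  let ?M = "lebesgue_on {t..}"
  let ?H = "\<lambda>\<tau>. ereal (exp (- lam * \<tau>)) * h0 (u \<tau>)"
  have "(\<lambda>\<tau>. exp (- lam * \<tau>)) \<in> borel_measurable ?M"
    by (rule borel_measurable_lebesgue_onI) simp
  then have Hm: "?H \<in> borel_measurable ?M"
    using control_cost_measurable(1)[OF u] by (intro borel_measurable_ereal_times borel_measurable_ereal)
  have dist: "ereal (exp (- lam * \<tau>)) * (ereal y + h0 c) = ereal (exp (- lam * \<tau>) * y) + ereal (exp (- lam * \<tau>)) * h0 c" for \<tau> y c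
    using h0_nonneg[of c] by (cases "h0 c") (auto simp: distrib_left)
  have He: "e2ennreal (?H \<tau>) = ennreal (exp (- lam * \<tau>)) * e2ennreal (h0 (u \<tau>))" for \<tau>
    using h0_nonneg[of "u \<tau>"]
    by (cases "h0 (u \<tau>)") (auto simp: e2ennreal_ereal ennreal_mult e2ennreal_infty ennreal_mult_top)
  have "J t z u = ereal_integral ?M (\<lambda>\<tau>. ereal (exp (- lam * \<tau>) * g0 (traj t z u \<tau>)) + ?H \<tau>)"
    unfolding cost_def dist ..
  also have "\<dots> = ereal (state_cost t z u) + enn2ereal (\<integral>\<^sup>+\<tau>. e2ennreal (?H \<tau>) \<partial>?M)"
    unfolding state_cost_def
    by (rule ereal_integral_add_nonneg[OF state_cost_integrable[OF u] Hm]) (simp add: h0_nonneg)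
  finally show ?thesis
    by (simp only: control_cost_def He)
qed

lemma control_cost_midpoint:
  assumes u: "admissible t u" and v: "admissible t v"
  shows "control_cost t (\<lambda>s. (1/2) *\<^sub>R u s + (1/2) *\<^sub>R v s)
    \<le> ennreal (1/2) * control_cost t u + ennreal (1/2) * control_cost t v"
proof -
  let ?M = "lebesgue_on {t..}"
  let ?k = "\<lambda>u \<tau>. ennreal (exp (- lam * \<tau>)) * e2ennreal (h0 (u \<tau>))"
  have conv: "e2ennreal (h0 ((1/2) *\<^sub>R c + (1/2) *\<^sub>R d)) \<le> ennreal (1/2) * e2ennreal (h0 c) + ennreal (1/2) * e2ennreal (h0 d)" for c d
  proof -
    have "h0 ((1/2) *\<^sub>R c + (1/2) *\<^sub>R d) \<le> ereal (1/2) * h0 c + ereal (1/2) * h0 d"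
      using h0_convex[unfolded ereal_convex_def, rule_format, of "1/2" "1/2" c d] by simp
    moreover have "enn2ereal (ennreal (1/2)) = ereal (1/2)"
      by (rule enn2ereal_ennreal) simp
    ultimately show ?thesis
      by (simp only: less_eq_ennreal.rep_eq plus_ennreal.rep_eq times_ennreal.rep_eq enn2ereal_e2ennreal[OF h0_nonneg])
  qed
  have "control_cost t (\<lambda>s. (1/2) *\<^sub>R u s + (1/2) *\<^sub>R v s) \<le> (\<integral>\<^sup>+\<tau>. ennreal (1/2) * ?k u \<tau> + ennreal (1/2) * ?k v \<tau> \<partial>?M)"
    unfolding control_cost_def
  proof (rule nn_integral_mono)
    fix \<tau>
    show "?k (\<lambda>s. (1/2) *\<^sub>R u s + (1/2) *\<^sub>R v s) \<tau> \<le> ennreal (1/2) * ?k u \<tau> + ennreal (1/2) * ?k v \<tau>"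
      using mult_left_mono[OF conv[of "u \<tau>" "v \<tau>"], of "ennreal (exp (- lam * \<tau>))"]
      by (simp add: distrib_left mult.left_commute)
  qed
  also have "\<dots> = ennreal (1/2) * control_cost t u + ennreal (1/2) * control_cost t v"
    unfolding control_cost_def using control_cost_measurable(2)[OF u] control_cost_measurable(2)[OF v]
    by (subst nn_integral_add) (auto simp: nn_integral_cmult)
  finally show ?thesis .
qed

text \<open>
  A constant control at a point where \<open>h0\<close> is finite is a competitor of finite cost, because \<open>lam > 0\<close>.
\<close>

lemma optimal_cost_finite:
  assumes u: "u \<in> Lp t" and opt: "\<And>v. v \<in> Lp t \<Longrightarrow> J t x u \<le> J t x v"
  obtains k where "k \<ge> 0" "control_cost t u = ennreal k"
proof -
  obtain c where c: "h0 c \<noteq> \<infinity>" using h0_proper by blast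
  then obtain m where m: "h0 c = ereal m" "m \<ge> 0"
    using h0_nonneg[of c] by (cases "h0 c") auto
  have cLp: "(\<lambda>s. c) \<in> Lp t" by (rule Lp_weighted_const[OF p_pos lam_pos])
  have "control_cost t (\<lambda>s. c) = (\<integral>\<^sup>+\<tau>. ennreal (exp (- lam * \<tau>) * m) \<partial>lebesgue_on {t..})"
    using m by (simp add: control_cost_def e2ennreal_ereal flip: ennreal_mult)
  also have "\<dots> < \<infinity>"
    using nn_integral_eq_integral[OF integrable_mult_left[OF integrable_exp_halfline(1)[OF lam_pos, of t], of m]] m(2)
    by simp
  finally have "J t x (\<lambda>s. c) < \<infinity>"
    unfolding cost_eq[OF Lp_admissible[OF cLp]] by (cases "control_cost t (\<lambda>s. c)") auto
  with opt[OF cLp] have "J t x u < \<infinity>" by (rule le_less_trans)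
  then have "control_cost t u \<noteq> \<infinity>"
    unfolding cost_eq[OF Lp_admissible[OF u]] by auto
  then show thesis
    using that by (cases "control_cost t u") auto
qed

section \<open>The co-state\<close>

text \<open>
  Norms in \<open>V\<close> are operator norms under the pairing, so the growth bound passes to the adjoint.
\<close>

lemma adjoint_growth:
  assumes "s \<ge> 0"
  shows "norm (blinfun_apply (S0 s) v) \<le> exp (\<omega> * s) * norm v"
proof -
  have "onorm (pair (blinfun_apply (S0 s) v)) \<le> exp (\<omega> * s) * norm v"
  proof (rule onorm_bound)
    fix x
    have "norm (pair (blinfun_apply (S0 s) v) x) = norm (pair v (blinfun_apply (S s) x))"
      using adjoint assms by (simp add: adjoint_semigroup_def)
    also have "\<dots> \<le> norm v * norm (blinfun_apply (S s) x)"
      using onorm[OF pairing.bounded_linear_right, of v] by (simp add: onorm_pair)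
    also have "\<dots> \<le> norm v * (exp (\<omega> * s) * norm x)"
      by (intro mult_left_mono growth assms) simp
    finally show "norm (pair (blinfun_apply (S0 s) v) x) \<le> exp (\<omega> * s) * norm v * norm x"
      by (simp add: ac_simps)
  qed simp
  then show ?thesis by (simp add: onorm_pair)
qed

text \<open>
  The norm is at most the product of \<open>exp ((\<omega> - lam / 2) \<sigma>)\<close> and \<open>exp (- lam \<sigma> / 2) |g0'(y \<sigma>)|\<close>. The first
  factor is square integrable because \<open>lam > 2 \<omega>\<close>, the second because \<open>g0'\<close> has linear growth and the
  trajectory is square integrable with weight \<open>exp (- lam \<sigma>)\<close>.
\<close>

lemma costate_integrand:
  assumes u: "admissible 0 u" and y: "\<forall>\<sigma>\<ge>0. y \<sigma> = traj 0 z u \<sigma>"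
  shows "strongly_measurable (lebesgue_on {0..}) (\<lambda>\<sigma>. exp (- lam * (\<sigma> - 0)) *\<^sub>R blinfun_apply (S0 (\<sigma> - 0)) (grad (y \<sigma>)))"
      (is "strongly_measurable ?M ?f")
    and "integrable (lebesgue_on {0..}) (\<lambda>\<sigma>. norm (exp (- lam * (\<sigma> - 0)) *\<^sub>R blinfun_apply (S0 (\<sigma> - 0)) (grad (y \<sigma>))))"
proof -
  have S0: "C0_semigroup S0" using adjoint by (simp add: adjoint_semigroup_def)
  have id: "strongly_measurable ?M (\<lambda>\<sigma>. \<sigma>)"
    by (intro strongly_measurable_borel_real borel_measurable_lebesgue_onI) simp
  have ex: "strongly_measurable ?M (\<lambda>\<sigma>. exp (- lam * (\<sigma> - 0)))"
    by (intro strongly_measurable_borel_real borel_measurable_lebesgue_onI) simp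
  have ym: "strongly_measurable ?M (\<lambda>\<sigma>. grad (traj 0 z u \<sigma>))"
    by (rule strongly_measurable_compose[OF trajectory_strongly_measurable[OF u] grad_continuous])
  have "strongly_measurable ?M (\<lambda>\<sigma>. exp (- lam * (\<sigma> - 0)) *\<^sub>R blinfun_apply (S0 (max 0 \<sigma>)) (grad (traj 0 z u \<sigma>)))"
    by (rule strongly_measurable_scaleR[OF ex strongly_measurable_compose2[OF id ym
            semigroup_jointly_continuous[OF S0 adjoint_growth]]])
  then show m: "strongly_measurable ?M ?f"
    by (rule strongly_measurable_AE_cong) (auto intro!: AE_I2 simp: y)
  obtain L where L: "L \<ge> 0" "\<And>y z. norm (grad y - grad z) \<le> L * norm (y - z)"
    by (rule grad) blast
  \<comment> \<open>Bounding the product \<open>\<alpha> \<beta>\<close> of the two factors by \<open>\<alpha>\<^sup>2 + \<beta>\<^sup>2\<close> leads to this integrable majorant.\<close>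
  let ?b = "\<lambda>\<sigma>. exp (- (lam - 2 * \<omega>) * \<sigma>) + (2 * (norm (grad 0))\<^sup>2) * exp (- lam * \<sigma>)
      + (2 * L\<^sup>2) * (exp (- lam * \<sigma>) * (norm (traj 0 z u \<sigma>))\<^sup>2)"
  show "integrable ?M (\<lambda>\<sigma>. norm (?f \<sigma>))"
  proof (rule Bochner_Integration.integrable_bound)
    show "integrable ?M ?b"
      using lam_gt by (intro Bochner_Integration.integrable_add integrable_mult_right integrable_exp_halfline(1)
          lam_pos trajectory_square_integrable u) simp
    show "(\<lambda>\<sigma>. norm (?f \<sigma>)) \<in> borel_measurable ?M"
      by (rule measurable_compose[OF strongly_measurable_imp_borel_measurable[OF complete_measure_lebesgue_on m]
            borel_measurable_norm]) simp
    show "AE \<sigma> in ?M. norm (norm (?f \<sigma>)) \<le> norm (?b \<sigma>)"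
    proof (rule AE_I2)
      fix \<sigma> assume "\<sigma> \<in> space ?M"
      then have \<sigma>: "\<sigma> \<ge> 0" by simp
      let ?y = "traj 0 z u \<sigma>"
      define \<alpha> where "\<alpha> = exp ((\<omega> - lam / 2) * \<sigma>)"
      define \<beta> where "\<beta> = exp (- lam * \<sigma> / 2) * norm (grad ?y)"
      have "norm (?f \<sigma>) \<le> exp (- lam * \<sigma>) * (exp (\<omega> * \<sigma>) * norm (grad ?y))"
        using adjoint_growth[OF \<sigma>, of "grad ?y"] by (simp add: y[rule_format, OF \<sigma>] mult_left_mono)
      also have "\<dots> = \<alpha> * \<beta>"
      proof -
        have "\<alpha> * exp (- lam * \<sigma> / 2) = exp ((\<omega> - lam / 2) * \<sigma> + - lam * \<sigma> / 2)"
          by (simp only: \<alpha>_def exp_add)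
        also have "(\<omega> - lam / 2) * \<sigma> + - lam * \<sigma> / 2 = - lam * \<sigma> + \<omega> * \<sigma>"
          by (simp add: field_simps)
        also have "exp (- lam * \<sigma> + \<omega> * \<sigma>) = exp (- lam * \<sigma>) * exp (\<omega> * \<sigma>)"
          by (rule exp_add)
        finally show ?thesis
          by (simp only: \<beta>_def mult.assoc[symmetric])
      qed
      also have "\<dots> \<le> \<alpha>\<^sup>2 + \<beta>\<^sup>2"
      proof -
        have "0 \<le> \<alpha> * \<beta>" by (simp add: \<alpha>_def \<beta>_def)
        then show ?thesis using sum_squares_bound[of \<alpha> \<beta>] by linarith
      qed
      also have "\<alpha>\<^sup>2 = exp (- (lam - 2 * \<omega>) * \<sigma>)"
        unfolding \<alpha>_def exp_double[symmetric] by (rule arg_cong[of _ _ exp]) (simp add: algebra_simps)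
      also have "\<beta>\<^sup>2 \<le> (2 * (norm (grad 0))\<^sup>2) * exp (- lam * \<sigma>) + (2 * L\<^sup>2) * (exp (- lam * \<sigma>) * (norm ?y)\<^sup>2)"
      proof -
        have "norm (grad ?y) \<le> norm (grad 0) + L * norm ?y"
          using L(2)[of ?y 0] norm_triangle_ineq2[of "grad ?y" "grad 0"] by simp
        then have "(norm (grad ?y))\<^sup>2 \<le> (norm (grad 0) + L * norm ?y)\<^sup>2"
          by (rule power_mono) simp
        also have "\<dots> \<le> 2 * (norm (grad 0))\<^sup>2 + 2 * (L * norm ?y)\<^sup>2"
          using sum_squares_bound[of "norm (grad 0)" "L * norm ?y"] unfolding power2_sum by linarith
        finally have "exp (- lam * \<sigma>) * (norm (grad ?y))\<^sup>2 \<le>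
            exp (- lam * \<sigma>) * (2 * (norm (grad 0))\<^sup>2 + 2 * (L * norm ?y)\<^sup>2)"
          by (rule mult_left_mono) simp
        moreover have "\<beta>\<^sup>2 = exp (- lam * \<sigma>) * (norm (grad ?y))\<^sup>2"
          by (simp add: \<beta>_def power_mult_distrib flip: exp_double)
        ultimately show ?thesis
          by (simp add: algebra_simps power_mult_distrib)
      qed
      finally show "norm (norm (?f \<sigma>)) \<le> norm (?b \<sigma>)"
        by (simp add: add.assoc)
    qed
  qed
qed

lemma costate_functional:
  assumes u: "admissible 0 u" and y: "\<forall>\<sigma>\<ge>0. y \<sigma> = traj 0 z u \<sigma>"
  shows "integrable (lebesgue_on {0..}) (\<lambda>\<sigma>. exp (- lam * \<sigma>) * pair (grad (y \<sigma>)) (blinfun_apply (S \<sigma>) h))"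
    and "pair (costate pair S0 g0 lam y 0) h =
      (LINT \<sigma>|lebesgue_on {0..}. exp (- lam * \<sigma>) * pair (grad (y \<sigma>)) (blinfun_apply (S \<sigma>) h))"
proof -
  let ?M = "lebesgue_on {0::real..}"
  let ?f = "\<lambda>\<sigma>. exp (- lam * (\<sigma> - 0)) *\<^sub>R blinfun_apply (S0 (\<sigma> - 0)) (grad (y \<sigma>))"
  have cM: "complete_measure ?M" by (rule complete_measure_lebesgue_on) simp
  note F = vector_bochner_integral_functional[OF cM costate_integrand[OF u y] pairing.bounded_linear_left, of h]
  have eq: "pair (?f \<sigma>) h = exp (- lam * \<sigma>) * pair (grad (y \<sigma>)) (blinfun_apply (S \<sigma>) h)" if "\<sigma> \<in> space ?M" for \<sigma>
    using adjoint that by (simp add: adjoint_semigroup_def pairing.scaleR_left)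
  show "integrable ?M (\<lambda>\<sigma>. exp (- lam * \<sigma>) * pair (grad (y \<sigma>)) (blinfun_apply (S \<sigma>) h))"
    using F(1) by (subst (asm) Bochner_Integration.integrable_cong[OF refl eq]) auto
  show "pair (costate pair S0 g0 lam y 0) h =
      (LINT \<sigma>|?M. exp (- lam * \<sigma>) * pair (grad (y \<sigma>)) (blinfun_apply (S \<sigma>) h))"
    unfolding costate_def F(2) by (rule Bochner_Integration.integral_cong[OF refl eq])
qed

text \<open>
  The trajectories from \<open>z\<close> and \<open>x\<close> differ by \<open>S \<sigma> (z - x)\<close>, and the co-state collects the linear terms. What
  remains is integrated against \<open>exp (- lam \<sigma>) exp (2 \<omega> \<sigma>)\<close>, a decaying exponential.
\<close>

lemma state_cost_quadratic_remainder:
  assumes u: "admissible 0 u" and y: "\<forall>\<sigma>\<ge>0. y \<sigma> = traj 0 x u \<sigma>"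
  obtains C where "\<And>z. \<bar>state_cost 0 z u - state_cost 0 x u - pair (costate pair S0 g0 lam y 0) (z - x)\<bar>
      \<le> C * (norm (z - x))\<^sup>2"
proof -
  let ?M = "lebesgue_on {0::real..}"
  obtain L where L: "L \<ge> 0" "\<And>y h. \<bar>g0 (y + h) - g0 y - pair (grad y) h\<bar> \<le> L * (norm h)\<^sup>2"
    by (rule g0_quadratic_remainder) blast
  let ?e = "\<lambda>\<sigma>. exp (- (lam - 2 * \<omega>) * \<sigma>)"
  have e: "integrable ?M ?e"
    using lam_gt by (intro integrable_exp_halfline(1)) simp
  have "\<bar>state_cost 0 z u - state_cost 0 x u - pair (costate pair S0 g0 lam y 0) (z - x)\<bar>
      \<le> (L * (LINT \<sigma>|?M. ?e \<sigma>)) * (norm (z - x))\<^sup>2" for z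
  proof -
    let ?h = "\<lambda>\<sigma>. blinfun_apply (S \<sigma>) (z - x)"
    let ?r = "\<lambda>\<sigma>. exp (- lam * \<sigma>) * g0 (traj 0 z u \<sigma>) - exp (- lam * \<sigma>) * g0 (traj 0 x u \<sigma>)
        - exp (- lam * \<sigma>) * pair (grad (y \<sigma>)) (?h \<sigma>)"
    note int = state_cost_integrable[OF u, of z] state_cost_integrable[OF u, of x]
      costate_functional(1)[OF u y, of "z - x"]
    have eq: "state_cost 0 z u - state_cost 0 x u - pair (costate pair S0 g0 lam y 0) (z - x) = (LINT \<sigma>|?M. ?r \<sigma>)"
      unfolding state_cost_def costate_functional(2)[OF u y] using int
      by (subst Bochner_Integration.integral_diff, simp_all)+
    have r: "\<bar>?r \<sigma>\<bar> \<le> (L * (norm (z - x))\<^sup>2) * ?e \<sigma>" if "\<sigma> \<ge> 0" for \<sigma>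
    proof -
      have z: "traj 0 z u \<sigma> = traj 0 x u \<sigma> + ?h \<sigma>"
        using trajectory_diff[of 0 z u \<sigma> x] by (simp add: algebra_simps)
      have "?r \<sigma> = exp (- lam * \<sigma>) * (g0 (traj 0 x u \<sigma> + ?h \<sigma>) - g0 (traj 0 x u \<sigma>) - pair (grad (traj 0 x u \<sigma>)) (?h \<sigma>))"
        unfolding z y[rule_format, OF that] by (simp add: algebra_simps)
      then have "\<bar>?r \<sigma>\<bar> \<le> exp (- lam * \<sigma>) * (L * (norm (?h \<sigma>))\<^sup>2)"
        using mult_left_mono[OF L(2)[of "traj 0 x u \<sigma>" "?h \<sigma>"], of "exp (- lam * \<sigma>)"] by (simp add: abs_mult)
      also have "\<dots> \<le> exp (- lam * \<sigma>) * (L * (exp (\<omega> * \<sigma>) * norm (z - x))\<^sup>2)"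
        by (intro mult_left_mono power_mono growth that L(1)) auto
      also have "\<dots> = (L * (norm (z - x))\<^sup>2) * (exp (- lam * \<sigma>) * (exp (\<omega> * \<sigma>))\<^sup>2)"
        by (simp add: power_mult_distrib)
      also have "exp (- lam * \<sigma>) * (exp (\<omega> * \<sigma>))\<^sup>2 = ?e \<sigma>"
        unfolding exp_double[symmetric] exp_add[symmetric] by (rule arg_cong[of _ _ exp]) (simp add: algebra_simps)
      finally show ?thesis .
    qed
    have ri: "integrable ?M ?r"
      by (intro Bochner_Integration.integrable_diff int) 
    have "\<bar>LINT \<sigma>|?M. ?r \<sigma>\<bar> \<le> (LINT \<sigma>|?M. \<bar>?r \<sigma>\<bar>)"
      by (rule integral_abs_bound)
    also have "\<dots> \<le> (LINT \<sigma>|?M. (L * (norm (z - x))\<^sup>2) * ?e \<sigma>)"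
      using ri e r by (intro integral_mono integrable_abs integrable_mult_right) auto
    also have "\<dots> = (L * (LINT \<sigma>|?M. ?e \<sigma>)) * (norm (z - x))\<^sup>2"
      by simp
    finally show ?thesis
      unfolding eq .
  qed
  then show thesis using that by blast
qed

section \<open>Differentiability of the value function\<close>

text \<open>
  The cost of the fixed control \<open>u\<close> bounds the value function from above, and its reflection at
  \<open>x\<close> bounds it from below, by convexity; both touch at \<open>x\<close>.
\<close>

lemma value_function_has_derivative:
  assumes opt: "optimal 0 x u y"
  shows "(\<Psi> has_derivative pair (costate pair S0 g0 lam y 0)) (at x)"
proof -
  have u: "u \<in> Lp 0" and min: "\<And>v. v \<in> Lp 0 \<Longrightarrow> J 0 x u \<le> J 0 x v"
    and y: "\<forall>\<sigma>\<ge>0. y \<sigma> = traj 0 x u \<sigma>"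
    using opt by (auto simp: optimal_couple_def)
  note ua = Lp_admissible[OF u]
  obtain k where k: "k \<ge> 0" "control_cost 0 u = ennreal k"
    by (rule optimal_cost_finite[OF u min]) auto
  let ?G = "\<lambda>z. state_cost 0 z u"
  let ?P = "pair (costate pair S0 g0 lam y 0)"
  have Ju: "J 0 z u = ereal (?G z + k)" for z
    using k by (simp add: cost_eq[OF ua] enn2ereal_ennreal)
  define V where "V z = (INF v\<in>Lp 0. J 0 z v)" for z
  have V_upper: "V z \<le> ereal (?G z + k)" for z
    unfolding V_def Ju[symmetric] by (rule INF_lower[OF u])
  \<comment> \<open>\<open>V\<close> is still extended-real valued here; the two bounds show that it is finite.\<close>
  have V_lower: "ereal (2 * (?G x + k) - (?G (2 *\<^sub>R x - z) + k)) \<le> V z" for z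
    unfolding V_def
  proof (rule INF_greatest)
    fix v assume v: "v \<in> Lp 0"
    note va = Lp_admissible[OF v]
    let ?w = "\<lambda>s. (1/2) *\<^sub>R v s + (1/2) *\<^sub>R u s"
    have w: "?w \<in> Lp 0" by (rule Lp_weighted_midpoint[OF p_pos v u])
    have x: "(1/2) *\<^sub>R z + (1/2) *\<^sub>R (2 *\<^sub>R x - z) = x"
      by (simp add: algebra_simps)
    show "ereal (2 * (?G x + k) - (?G (2 *\<^sub>R x - z) + k)) \<le> J 0 z v"
    proof (cases "control_cost 0 v")
      case (real l)
      have "control_cost 0 ?w \<le> ennreal (1/2) * ennreal l + ennreal (1/2) * ennreal k"
        using control_cost_midpoint[OF va ua] by (simp only: real k)
      also have "\<dots> = ennreal ((1/2) * l + (1/2) * k)"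
        using real k by (simp only: ennreal_mult[symmetric] ennreal_plus[symmetric])
      finally have Kw: "control_cost 0 ?w \<le> ennreal ((1/2) * l + (1/2) * k)" .
      have "ereal (?G x + k) \<le> J 0 x ?w"
        using min[OF w] by (simp only: Ju)
      also have "\<dots> \<le> ereal (state_cost 0 x ?w) + ereal ((1/2) * l + (1/2) * k)"
        unfolding cost_eq[OF Lp_admissible[OF w]] using Kw real k
        by (intro add_left_mono) (simp add: less_eq_ennreal.rep_eq enn2ereal_ennreal del: ennreal_plus)
      also have "\<dots> \<le> ereal (((1/2) * state_cost 0 z v + (1/2) * ?G (2 *\<^sub>R x - z)) + ((1/2) * l + (1/2) * k))"
        using state_cost_midpoint[OF va ua, of z "2 *\<^sub>R x - z"] unfolding x by simp
      finally have "2 * (?G x + k) - (?G (2 *\<^sub>R x - z) + k) \<le> state_cost 0 z v + l"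
        by simp
      then show ?thesis
        using real by (simp add: cost_eq[OF va] enn2ereal_ennreal)
    next
      case top
      then show ?thesis by (simp add: cost_eq[OF va])
    qed
  qed
  have \<Psi>: "\<Psi> z = real_of_ereal (V z)" for z
    by (simp add: value_function_def V_def)
  have V_real: "V z = ereal (\<Psi> z)" for z
    using V_upper[of z] V_lower[of z] unfolding \<Psi> by (cases "V z") auto
  have upper: "\<Psi> z \<le> ?G z + k" and lower: "2 * (?G x + k) - (?G (2 *\<^sub>R x - z) + k) \<le> \<Psi> z" for z
    using V_upper[of z] V_lower[of z] unfolding V_real by simp_all
  \<comment> \<open>At \<open>z = x\<close> both bounds equal the cost of \<open>u\<close>.\<close>
  have "2 *\<^sub>R x - x = x" by (simp add: scaleR_2)
  then have \<Psi>x: "\<Psi> x = ?G x + k"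
    using upper[of x] lower[of x] by simp
  obtain C where C: "\<And>z. \<bar>?G z - ?G x - ?P (z - x)\<bar> \<le> C * (norm (z - x))\<^sup>2"
    by (rule state_cost_quadratic_remainder[OF ua y]) auto
  have arith: "\<bar>d - b - q\<bar> \<le> r"
    if "\<bar>e - a + q\<bar> \<le> r" "\<bar>c - a - q\<bar> \<le> r" "d \<le> c + k" "2 * (a + k) - (e + k) \<le> d" "b = a + k"
    for a b c d e q r :: real
    using that by (smt (verit))
  show ?thesis
  proof (rule has_derivative_quadratic_remainder[OF pairing.bounded_linear_right])
    fix z
    have e: "2 *\<^sub>R x - z - x = - (z - x)" by (simp add: scaleR_2)
    have "\<bar>?G (2 *\<^sub>R x - z) - ?G x + ?P (z - x)\<bar> \<le> C * (norm (z - x))\<^sup>2"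
      using C[of "2 *\<^sub>R x - z"] unfolding e pairing.minus_right norm_minus_cancel by simp
    then show "\<bar>\<Psi> z - \<Psi> x - ?P (z - x)\<bar> \<le> C * (norm (z - x))\<^sup>2"
      using C[of z] upper[of z] lower[of z] \<Psi>x by (rule arith)
  qed
qed

section \<open>Dynamic programming\<close>

lemma state_cost_split:
  assumes u: "admissible t u" and "t \<le> c"
  shows "state_cost t z u = (LINT \<tau>|lebesgue_on {t..c}. exp (- lam * \<tau>) * g0 (traj t z u \<tau>))
    + state_cost c (traj t z u c) u"
proof -
  have "{t..} = {t..c} \<union> {c..}" "{t..c} \<inter> {c..} \<subseteq> {c}"
    using assms(2) by auto
  then have "state_cost t z u = (LINT \<tau>|lebesgue_on {t..c}. exp (- lam * \<tau>) * g0 (traj t z u \<tau>))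
      + (LINT \<tau>|lebesgue_on {c..}. exp (- lam * \<tau>) * g0 (traj t z u \<tau>))"
    using lebesgue_on_integral_Un[of "{t..c}" "{c..}" _ c] state_cost_integrable[OF u, of z]
    unfolding state_cost_def by simp
  also have "(LINT \<tau>|lebesgue_on {c..}. exp (- lam * \<tau>) * g0 (traj t z u \<tau>)) = state_cost c (traj t z u c) u"
    unfolding state_cost_def
    by (rule Bochner_Integration.integral_cong) (auto simp: trajectory_cocycle[OF u assms(2)])
  finally show ?thesis .
qed

lemma control_cost_split:
  assumes u: "admissible t u" and "t \<le> c"
  shows "control_cost t u =
    (\<integral>\<^sup>+\<tau>\<in>{t..<c}. ennreal (exp (- lam * \<tau>)) * e2ennreal (h0 (u \<tau>)) \<partial>lebesgue) + control_cost c u"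
proof -
  let ?q = "\<lambda>\<tau>. ennreal (exp (- lam * \<tau>)) * e2ennreal (h0 (u \<tau>))"
  have m: "(\<lambda>\<tau>. ?q \<tau> * indicator {t..} \<tau>) \<in> borel_measurable lebesgue"
    using control_cost_measurable(2)[OF u]
    by (subst borel_measurable_restrict_space_iff_ennreal[symmetric]) auto
  have m1: "(\<lambda>\<tau>. ?q \<tau> * indicator {t..<c} \<tau>) \<in> borel_measurable lebesgue"
    "(\<lambda>\<tau>. ?q \<tau> * indicator {c..} \<tau>) \<in> borel_measurable lebesgue"
  proof -
    have "(\<lambda>\<tau>. (?q \<tau> * indicator {t..} \<tau>) * indicator {t..<c} \<tau>) \<in> borel_measurable lebesgue"
      "(\<lambda>\<tau>. (?q \<tau> * indicator {t..} \<tau>) * indicator {c..} \<tau>) \<in> borel_measurable lebesgue"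
      using m by (auto intro!: borel_measurable_times_ennreal borel_measurable_indicator)
    moreover have "(\<lambda>\<tau>. (?q \<tau> * indicator {t..} \<tau>) * indicator {t..<c} \<tau>) = (\<lambda>\<tau>. ?q \<tau> * indicator {t..<c} \<tau>)"
      "(\<lambda>\<tau>. (?q \<tau> * indicator {t..} \<tau>) * indicator {c..} \<tau>) = (\<lambda>\<tau>. ?q \<tau> * indicator {c..} \<tau>)"
      using assms(2) by (auto simp: indicator_def fun_eq_iff)
    ultimately show "(\<lambda>\<tau>. ?q \<tau> * indicator {t..<c} \<tau>) \<in> borel_measurable lebesgue"
      "(\<lambda>\<tau>. ?q \<tau> * indicator {c..} \<tau>) \<in> borel_measurable lebesgue"
      by simp_all
  qed
  have "control_cost t u = (\<integral>\<^sup>+\<tau>. ?q \<tau> * indicator {t..} \<tau> \<partial>lebesgue)"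
    unfolding control_cost_def by (subst nn_integral_restrict_space) auto
  also have "\<dots> = (\<integral>\<^sup>+\<tau>. ?q \<tau> * indicator {t..<c} \<tau> + ?q \<tau> * indicator {c..} \<tau> \<partial>lebesgue)"
    using assms(2) by (intro nn_integral_cong) (auto simp: indicator_def)
  also have "\<dots> = (\<integral>\<^sup>+\<tau>\<in>{t..<c}. ?q \<tau> \<partial>lebesgue) + (\<integral>\<^sup>+\<tau>. ?q \<tau> * indicator {c..} \<tau> \<partial>lebesgue)"
    by (rule nn_integral_add[OF m1])
  also have "(\<integral>\<^sup>+\<tau>. ?q \<tau> * indicator {c..} \<tau> \<partial>lebesgue) = control_cost c u"
    unfolding control_cost_def by (subst nn_integral_restrict_space) auto
  finally show ?thesis .
qed

text \<open>
  Following \<open>u\<close> up to time \<open>\<tau>\<close> and \<open>v\<close> afterwards gives a competitor of \<open>u\<close> at time \<open>0\<close>. The two costs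
  share the part before \<open>\<tau>\<close>, which is finite because \<open>u\<close> is optimal, and can be cancelled.
\<close>

lemma optimal_tail:
  assumes opt: "optimal 0 x u y" and \<tau>: "\<tau> \<ge> 0"
  shows "optimal \<tau> (y \<tau>) u y"
proof -
  have u: "u \<in> Lp 0" and min: "\<And>v. v \<in> Lp 0 \<Longrightarrow> J 0 x u \<le> J 0 x v"
    and y: "\<And>\<sigma>. \<sigma> \<ge> 0 \<Longrightarrow> y \<sigma> = traj 0 x u \<sigma>"
    using opt by (auto simp: optimal_couple_def)
  note ua = Lp_admissible[OF u]
  have u\<tau>: "u \<in> Lp \<tau>" by (rule Lp_weighted_mono[OF p_pos u \<tau>])
  obtain k where k: "k \<ge> 0" "control_cost 0 u = ennreal k"
    by (rule optimal_cost_finite[OF u min]) auto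
  have "J \<tau> (y \<tau>) u \<le> J \<tau> (y \<tau>) v" if v: "v \<in> Lp \<tau>" for v
  proof -
    define w where "w s = (if s < \<tau> then u s else v s)" for s
    have w: "w \<in> Lp 0"
      unfolding w_def by (rule Lp_weighted_concat[OF p_pos u v \<tau>])
    note wa = Lp_admissible[OF w] and va = Lp_admissible[OF v]
    have wa\<tau>: "admissible \<tau> w" by (rule admissible_mono[OF wa \<tau>])
    have wy: "traj 0 x w s = traj 0 x u s" if "s \<le> \<tau>" for s
      by (rule trajectory_cong[OF wa ua]) (use that in \<open>simp add: w_def\<close>)
    have wv: "traj \<tau> (y \<tau>) w s = traj \<tau> (y \<tau>) v s" for s
      by (rule trajectory_cong[OF wa\<tau> va]) (simp add: w_def)
    define g where "g = (LINT \<sigma>|lebesgue_on {0..\<tau>}. exp (- lam * \<sigma>) * g0 (traj 0 x u \<sigma>))"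
    define h where "h = (\<integral>\<^sup>+\<sigma>\<in>{0..<\<tau>}. ennreal (exp (- lam * \<sigma>)) * e2ennreal (h0 (u \<sigma>)) \<partial>lebesgue)"
    have Gu: "state_cost 0 x u = g + state_cost \<tau> (y \<tau>) u"
      unfolding g_def y[OF \<tau>] by (rule state_cost_split[OF ua \<tau>])
    have Ku: "control_cost 0 u = h + control_cost \<tau> u"
      unfolding h_def by (rule control_cost_split[OF ua \<tau>])
    have "state_cost 0 x w = (LINT \<sigma>|lebesgue_on {0..\<tau>}. exp (- lam * \<sigma>) * g0 (traj 0 x w \<sigma>)) + state_cost \<tau> (traj 0 x w \<tau>) w"
      by (rule state_cost_split[OF wa \<tau>])
    also have "(LINT \<sigma>|lebesgue_on {0..\<tau>}. exp (- lam * \<sigma>) * g0 (traj 0 x w \<sigma>)) = g"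
      unfolding g_def by (rule Bochner_Integration.integral_cong) (auto simp: wy)
    also have "state_cost \<tau> (traj 0 x w \<tau>) w = state_cost \<tau> (y \<tau>) v"
      unfolding state_cost_def wy[OF order_refl] y[OF \<tau>, symmetric] wv ..
    finally have Gw: "state_cost 0 x w = g + state_cost \<tau> (y \<tau>) v" .
    have "control_cost 0 w = (\<integral>\<^sup>+\<sigma>\<in>{0..<\<tau>}. ennreal (exp (- lam * \<sigma>)) * e2ennreal (h0 (w \<sigma>)) \<partial>lebesgue) + control_cost \<tau> w"
      by (rule control_cost_split[OF wa \<tau>])
    also have "(\<integral>\<^sup>+\<sigma>\<in>{0..<\<tau>}. ennreal (exp (- lam * \<sigma>)) * e2ennreal (h0 (w \<sigma>)) \<partial>lebesgue) = h"
      unfolding h_def by (rule nn_integral_cong) (auto simp: w_def indicator_def)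
    also have "control_cost \<tau> w = control_cost \<tau> v"
      unfolding control_cost_def by (rule nn_integral_cong) (auto simp: w_def)
    finally have Kw: "control_cost 0 w = h + control_cost \<tau> v" .
    have fin: "h + control_cost \<tau> u = ennreal k" using Ku k by simp
    then obtain h' where h': "h = ennreal h'" "h' \<ge> 0"
      by (cases h) auto
    from fin obtain k' where k': "control_cost \<tau> u = ennreal k'" "k' \<ge> 0"
      by (cases "control_cost \<tau> u") auto
    have le: "ereal (g + state_cost \<tau> (y \<tau>) u) + enn2ereal (h + control_cost \<tau> u)
        \<le> ereal (g + state_cost \<tau> (y \<tau>) v) + enn2ereal (h + control_cost \<tau> v)"
      using min[OF w] unfolding cost_eq[OF ua] cost_eq[OF wa] Gu Ku Gw Kw .
    show ?thesis
    proof (cases "control_cost \<tau> v")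
      case (real l)
      then show ?thesis
        using le h' k' unfolding cost_eq[OF va] cost_eq[OF Lp_admissible[OF u\<tau>]]
        by (simp add: plus_ennreal.rep_eq enn2ereal_ennreal)
    next
      case top
      then show ?thesis by (simp add: cost_eq[OF va])
    qed
  qed
  moreover have "y s = traj \<tau> (y \<tau>) u s" if "s \<ge> \<tau>" for s
    using trajectory_cocycle[OF ua \<tau> that, of x] y \<tau> that by simp
  ultimately show ?thesis
    using u\<tau> unfolding optimal_couple_def by blast
qed

section \<open>Translation in time\<close>

text \<open>
  The dynamics and the running costs do not depend on time; only the discount factor does.
\<close>

lemma cost_translate:
  assumes u: "admissible (t + r) u" and u': "admissible t (\<lambda>s. u (s + r))"
  shows "J (t + r) z u = ereal (exp (- lam * r)) * J t z (\<lambda>s. u (s + r))"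
proof -
  have im: "(\<lambda>s. s + r) ` {t..} = {t + r..}"
    using image_add_atLeast[of r t] by (simp add: add.commute[of r] image_def)
  note T = lebesgue_on_translate[of "{t..}" r, unfolded im, simplified]
  have ex: "exp (- lam * (s + r)) = exp (- lam * r) * exp (- lam * s)" for s
    by (simp add: distrib_left flip: exp_add)
  have "state_cost (t + r) z u = (LINT \<tau>|distr (lebesgue_on {t..}) (lebesgue_on {t + r..}) (\<lambda>s. s + r).
      exp (- lam * \<tau>) * g0 (traj (t + r) z u \<tau>))"
    unfolding T(2) state_cost_def ..
  also have "\<dots> = (LINT s|lebesgue_on {t..}. exp (- lam * (s + r)) * g0 (traj (t + r) z u (s + r)))"
    using state_cost_integrable[OF u] by (intro integral_distr T(1)) auto
  also have "\<dots> = (LINT s|lebesgue_on {t..}. exp (- lam * r) * (exp (- lam * s) * g0 (traj t z (\<lambda>s. u (s + r)) s)))"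
    by (simp only: trajectory_translate[OF u] ex mult.assoc)
  also have "\<dots> = exp (- lam * r) * state_cost t z (\<lambda>s. u (s + r))"
    unfolding state_cost_def by (rule integral_mult_right_zero)
  finally have G: "state_cost (t + r) z u = exp (- lam * r) * state_cost t z (\<lambda>s. u (s + r))" .
  have "control_cost (t + r) u = (\<integral>\<^sup>+\<tau>. ennreal (exp (- lam * \<tau>)) * e2ennreal (h0 (u \<tau>))
      \<partial>distr (lebesgue_on {t..}) (lebesgue_on {t + r..}) (\<lambda>s. s + r))"
    unfolding T(2) control_cost_def ..
  also have "\<dots> = (\<integral>\<^sup>+s. ennreal (exp (- lam * (s + r))) * e2ennreal (h0 (u (s + r))) \<partial>lebesgue_on {t..})"
    using control_cost_measurable(2)[OF u] by (intro nn_integral_distr T(1)) auto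
  also have "\<dots> = (\<integral>\<^sup>+s. ennreal (exp (- lam * r)) * (ennreal (exp (- lam * s)) * e2ennreal (h0 (u (s + r)))) \<partial>lebesgue_on {t..})"
    by (simp only: ex ennreal_mult exp_ge_zero mult.assoc)
  also have "\<dots> = ennreal (exp (- lam * r)) * control_cost t (\<lambda>s. u (s + r))"
    unfolding control_cost_def by (rule nn_integral_cmult[OF control_cost_measurable(2)[OF u']])
  finally have K: "control_cost (t + r) u = ennreal (exp (- lam * r)) * control_cost t (\<lambda>s. u (s + r))" .
  show ?thesis
    unfolding cost_eq[OF u] cost_eq[OF u'] G K
    by (cases "control_cost t (\<lambda>s. u (s + r))")
      (simp_all add: times_ennreal.rep_eq enn2ereal_ennreal distrib_left)
qed

lemma optimal_translate:
  assumes opt: "optimal \<tau> z u y"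
  shows "optimal 0 z (\<lambda>s. u (s + \<tau>)) (\<lambda>s. y (s + \<tau>))"
proof -
  have u: "u \<in> Lp (0 + \<tau>)" and min: "\<And>v. v \<in> Lp \<tau> \<Longrightarrow> J \<tau> z u \<le> J \<tau> z v"
    and y: "\<And>\<sigma>. \<sigma> \<ge> \<tau> \<Longrightarrow> y \<sigma> = traj \<tau> z u \<sigma>"
    using opt by (auto simp: optimal_couple_def)
  have u': "(\<lambda>s. u (s + \<tau>)) \<in> Lp 0"
    by (rule Lp_weighted_translate[OF p_pos u])
  have "J 0 z (\<lambda>s. u (s + \<tau>)) \<le> J 0 z v" if v: "v \<in> Lp 0" for v
  proof -
    have "(\<lambda>s. v (s + - \<tau>)) \<in> Lp \<tau>"
      using v by (intro Lp_weighted_translate[OF p_pos]) simp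
    then have v': "(\<lambda>s. v (s - \<tau>)) \<in> Lp \<tau>" by simp
    have "ereal (exp (- lam * \<tau>)) * J 0 z (\<lambda>s. u (s + \<tau>)) \<le> ereal (exp (- lam * \<tau>)) * J 0 z v"
      using min[OF v'] cost_translate[OF Lp_admissible[OF u] Lp_admissible[OF u'], of z]
        cost_translate[of 0 \<tau> "\<lambda>s. v (s - \<tau>)" z] Lp_admissible[OF v'] Lp_admissible[OF v] by simp
    then show ?thesis
      by (subst (asm) ereal_mult_le_mult_iff) auto
  qed
  moreover have "y (s + \<tau>) = traj 0 z (\<lambda>s. u (s + \<tau>)) s" if "s \<ge> 0" for s
    using trajectory_translate[OF Lp_admissible[OF u], of z s] y[of "s + \<tau>"] that by simp
  ultimately show ?thesis
    using u' by (auto simp: optimal_couple_def)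
qed

lemma costate_translate:
  assumes opt: "optimal \<tau> z u y"
  shows "costate pair S0 g0 lam (\<lambda>s. y (s + \<tau>)) 0 = costate pair S0 g0 lam y \<tau>"
proof -
  have o: "optimal 0 z (\<lambda>s. u (s + \<tau>)) (\<lambda>s. y (s + \<tau>))"
    by (rule optimal_translate[OF opt])
  let ?f = "\<lambda>\<sigma>. exp (- lam * (\<sigma> - 0)) *\<^sub>R blinfun_apply (S0 (\<sigma> - 0)) (grad (y (\<sigma> + \<tau>)))"
  have ua: "admissible 0 (\<lambda>s. u (s + \<tau>))"
    using o Lp_admissible by (auto simp: optimal_couple_def)
  have y: "\<forall>s\<ge>0. y (s + \<tau>) = traj 0 z (\<lambda>s. u (s + \<tau>)) s"
    using o by (auto simp: optimal_couple_def)
  have im: "(\<lambda>s. s + - \<tau>) ` {\<tau>..} = {0..}"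
    using image_add_atLeast[of "- \<tau>" \<tau>] by (simp add: image_def)
  have "vector_bochner_integral (lebesgue_on {\<tau>..}) (\<lambda>s. ?f (s + - \<tau>)) = vector_bochner_integral (lebesgue_on {0..}) ?f"
    by (rule vector_bochner_integral_translate[OF _ im costate_integrand[OF ua y]]) simp_all
  then show ?thesis
    by (simp add: costate_def)
qed

end

section \<open>The co-state as gradient of the value function\<close>

theorem lemma4p8:
  fixes pair :: "'v::{real_inner, banach} \<Rightarrow> 'w::{real_inner, banach} \<Rightarrow> real"
    and D :: "'w set" and A :: "'w \<Rightarrow> 'w"
    and S :: "real \<Rightarrow> 'w \<Rightarrow>\<^sub>L 'w" and S0 :: "real \<Rightarrow> 'v \<Rightarrow>\<^sub>L 'v"
    and B :: "'u::{real_inner, banach} \<Rightarrow>\<^sub>L 'w"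
    and g0 :: "'w \<Rightarrow> real" and h0 :: "'u \<Rightarrow> ereal"
    and \<omega> lam p a b :: real
    and x :: 'w and ustar :: "real \<Rightarrow> 'u" and ystar :: "real \<Rightarrow> 'w"
  assumes duality: "dual_pairing pair"
    and hyp1: "generates_semigroup D A S"
    and adjoint: "adjoint_semigroup pair S S0"
    and hyp3: "\<omega> \<ge> 0" "\<And>\<tau> z. \<tau> \<ge> 0 \<Longrightarrow> norm (blinfun_apply (S \<tau>) z) \<le> exp (\<omega> * \<tau>) * norm z"
    and hyp4: "g0 \<in> Sigma0"
    and h0_range: "\<And>u. h0 u \<noteq> - \<infinity>"
    and hyp5: "ereal_convex h0" "lower_semicontinuous h0"
      "\<And>u1 u2. u1 \<noteq> u2 \<Longrightarrow> subdifferential h0 u1 \<inter> subdifferential h0 u2 = {}"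
    and hyp6: "convex_conjugate h0 0 = 0"
      "\<And>v. \<bar>convex_conjugate h0 v\<bar> \<noteq> \<infinity>"
      "(\<lambda>v. real_of_ereal (convex_conjugate h0 v)) \<in> Sigma0"
    and hyp7: "a > 0" "p \<ge> 2" "\<And>u. h0 u \<ge> ereal (a * norm u powr p + b)"
    and hyp8: "(p > 2 \<and> lam > 2 * \<omega>) \<or> (lam > \<omega> \<and> g0 \<in> growth_class 1)"
    and lam: "lam > 2 * \<omega>"
    and opt: "optimal_couple S B g0 h0 p lam 0 x ustar ystar"
  shows "(value_function S B g0 h0 p lam has_derivative
            pair (costate pair S0 g0 lam ystar 0)) (at x) \<and>
         (\<forall>\<tau>\<ge>0.
            (\<exists>u y. optimal_couple S B g0 h0 p lam \<tau> (ystar \<tau>) u y) \<and>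
            (\<forall>u y. optimal_couple S B g0 h0 p lam \<tau> (ystar \<tau>) u y \<longrightarrow>
               (value_function S B g0 h0 p lam has_derivative
                  pair (costate pair S0 g0 lam y \<tau>)) (at (ystar \<tau>))))"
proof -
  have h0_nonneg: "h0 c \<ge> 0" for c
  proof -
    have "ereal (0 \<bullet> c) - h0 c \<le> convex_conjugate h0 0"
      unfolding convex_conjugate_def by (rule SUP_upper) simp
    then show ?thesis
      using hyp6(1) by (cases "h0 c") auto
  qed
  have h0_proper: "\<exists>c. h0 c \<noteq> \<infinity>"
  proof (rule ccontr)
    assume "\<not> (\<exists>c. h0 c \<noteq> \<infinity>)"
    then have "convex_conjugate h0 0 = (SUP u::'u. - \<infinity>)"
      by (simp add: convex_conjugate_def)
    then show False
      using hyp6(1) by simp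
  qed
  interpret control_problem S B \<omega> lam pair S0 g0 h0 p
    by unfold_locales
      (use hyp1 hyp3 lam duality adjoint hyp4 hyp5(1,2) h0_nonneg h0_proper hyp7(2)
        in \<open>auto simp: generates_semigroup_def\<close>)
  show ?thesis
  proof (intro conjI allI impI)
    show "(value_function S B g0 h0 p lam has_derivative pair (costate pair S0 g0 lam ystar 0)) (at x)"
      by (rule value_function_has_derivative[OF opt])
  next
    fix \<tau> :: real assume "\<tau> \<ge> 0"
    with opt show "\<exists>u y. optimal_couple S B g0 h0 p lam \<tau> (ystar \<tau>) u y"
      by (blast intro: optimal_tail)
  next
    fix \<tau> u y assume o: "optimal_couple S B g0 h0 p lam \<tau> (ystar \<tau>) u y"
    show "(value_function S B g0 h0 p lam has_derivative pair (costate pair S0 g0 lam y \<tau>)) (at (ystar \<tau>))"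
      using value_function_has_derivative[OF optimal_translate[OF o]]
      unfolding costate_translate[OF o] .
  qed
qed

end
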